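(* Let $d\ge 1$, $\Omega=\mathbb T^d$, $a>0$, let $\Phi\in L^2(\Omega)$ be a real-valued even function, and let $s>d/2$. Assume that there exists $k_0\in\mathbb Z^d\setminus\{0\}$ such that $$\widehat\Phi(k_0)\neq 0,\qquad \widehat\Phi(k)\neq\widehat\Phi(k_0)\quad\text{for all } k\in\mathbb Z^d,\ k\neq\pm k_0.$$ Define $\mathcal F:\mathbb R\times X\to Y$ by $$\mathcal F(c,v):=a\Delta v+\nabla\cdot\bigl((c+v)\,\Phi*\nabla(c+v)\bigr),$$ and set $c_0=-\dfrac{a}{\widehat\Phi(k_0)}$. Then there exist $\varepsilon>0$, a neighborhood $U$ of $(c_0,0)$ in $\mathbb R\times X$, an element $v_0\in X$, and two $\mathcal C^1$ curves $\varphi:(-\varepsilon,\varepsilon)\to\mathbb R$ and $\psi:(-\varepsilon,\varepsilon)\to X$ such that $$\mathcal F^{-1}(0)\cap U=\bigl\{(\varphi(t),\,t v_0+t\psi(t)):\ |t|<\varepsilon\bigr\}\cup\bigl\{(c,0):\ |c-c_0|<\varepsilon\bigr\}.$$ Specifically, there exists a differentiable curve of nonconstant solutions to $$\nabla\cdot\bigl(a\nabla u+u\,\Phi*\nabla u\bigr)=0\qquad\text{in }\Omega,$$ namely, for all sufficiently small $t\neq 0$, the function $u_t=\varphi(t)+t v_0+t\psi(t)$ is a nonconstant solution.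
   Context: $\mathbb T^d=\mathbb R^d/\mathbb Z^d$ is the flat $d$-dimensional torus. Fourier convention: $\widehat f(k)=\int_{\mathbb T^d}f(y)e^{-2\pi i k\cdot y}\,dy$ for $k\in\mathbb Z^d$, so $f(y)=\sum_{k\in\mathbb Z^d}\widehat f(k)e^{2\pi i k\cdot y}$. The convolution $(\Phi*f)(y)=\int_{\mathbb T^d}\Phi(y-z)f(z)\,dz$ is the standard one on the torus, so that $\widehat{\Phi*f}(k)=\widehat\Phi(k)\widehat f(k)$; $\Phi*\nabla u$ is taken componentwise. $H^r(\Omega)$ denotes the ($L^2$-based) Sobolev space of real-valued functions on the torus. For the given $s>d/2$, $$X:=\Bigl\{v\in H^{s+2}(\Omega):\ \int_\Omega v=0,\ v(y)=v(-y)\Bigr\},\qquad Y:=\Bigl\{w\in H^{s}(\Omega):\ \int_\Omega w=0,\ w(y)=w(-y)\Bigr\},$$ with the norms of $H^{s+2}(\Omega)$ and $H^s(\Omega)$ respectively. Real numbers are identified with constant functions on $\Omega$; every constant function solves the equation. *)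

theory Defs
  imports "HOL-Analysis.Analysis"
begin

section \<open>Functions on the torus\<close>

text \<open>
  A function on the torus \<open>R^d / Z^d\<close> is a \<open>Z^d\<close>-periodic function on \<open>real^'n\<close>, \<open>d = CARD('n)\<close>; the type
  \<open>'n torus_fun\<close> consists of the real-valued Borel measurable ones, modulo equality almost everywhere.
  Integrals over the torus are integrals over the unit cell \<open>cbox 0 1 = [0,1]^d\<close>.
\<close>

definition int_vec :: "int^'n \<Rightarrow> real^'n" where
  "int_vec k = (\<chi> i. of_int (k $ i))"

definition periodic :: "(real^'n \<Rightarrow> 'b) \<Rightarrow> bool" where
  "periodic f \<longleftrightarrow> (\<forall>y k. f (y + int_vec k) = f y)"

definition torus_eq :: "(real^'n \<Rightarrow> real) \<Rightarrow> (real^'n \<Rightarrow> real) \<Rightarrow> bool" where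
  "torus_eq f g \<longleftrightarrow> f \<in> borel_measurable borel \<and> g \<in> borel_measurable borel \<and>
     periodic f \<and> periodic g \<and> (AE y in lborel. f y = g y)"

quotient_type 'n torus_fun = "real^'n \<Rightarrow> real" / partial: torus_eq
proof (rule part_equivpI)
  show "\<exists>f::real^'n \<Rightarrow> real. torus_eq f f"
    by (rule exI[of _ "\<lambda>_. 0"]) (simp add: torus_eq_def periodic_def)
  show "symp (torus_eq :: (real^'n \<Rightarrow> real) \<Rightarrow> _)"
    unfolding symp_def torus_eq_def by (metis (mono_tags, lifting) eventually_mono)
  show "transp (torus_eq :: (real^'n \<Rightarrow> real) \<Rightarrow> _)"
    unfolding transp_def torus_eq_def by (auto elim: eventually_elim2)
qed

instantiation torus_fun :: (finite) comm_ring_1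
begin

lift_definition zero_torus_fun :: "'a torus_fun" is "\<lambda>_. 0"
  by (simp add: torus_eq_def periodic_def)

lift_definition one_torus_fun :: "'a torus_fun" is "\<lambda>_. 1"
  by (simp add: torus_eq_def periodic_def)

lift_definition plus_torus_fun :: "'a torus_fun \<Rightarrow> 'a torus_fun \<Rightarrow> 'a torus_fun"
  is "\<lambda>f g y. f y + g y"
  by (auto simp: torus_eq_def periodic_def elim: eventually_elim2)

lift_definition minus_torus_fun :: "'a torus_fun \<Rightarrow> 'a torus_fun \<Rightarrow> 'a torus_fun"
  is "\<lambda>f g y. f y - g y"
  by (auto simp: torus_eq_def periodic_def elim: eventually_elim2)

lift_definition uminus_torus_fun :: "'a torus_fun \<Rightarrow> 'a torus_fun"
  is "\<lambda>f y. - f y"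
  by (auto simp: torus_eq_def periodic_def elim: eventually_mono)

lift_definition times_torus_fun :: "'a torus_fun \<Rightarrow> 'a torus_fun \<Rightarrow> 'a torus_fun"
  is "\<lambda>f g y. f y * g y"
  by (auto simp: torus_eq_def periodic_def elim: eventually_elim2)

instance
proof
  show "(0::'a torus_fun) \<noteq> 1"
    by transfer (simp add: torus_eq_def AE_iff_measurable[OF _ refl])
qed (transfer; auto simp: torus_eq_def periodic_def algebra_simps)+

end

instantiation torus_fun :: (finite) real_algebra_1
begin

lift_definition scaleR_torus_fun :: "real \<Rightarrow> 'a torus_fun \<Rightarrow> 'a torus_fun"
  is "\<lambda>c f y. c * f y"
  by (auto simp: torus_eq_def periodic_def elim: eventually_mono)

instance
  by standard (transfer; auto simp: torus_eq_def periodic_def algebra_simps)+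

end

lemma distr_lborel_diff_left:
  "distr lborel borel (\<lambda>x. z - x) = (lborel :: (real^'n) measure)"
proof -
  have "(lborel :: (real^'n) measure)
      = density (distr lborel borel (\<lambda>x. z + (-1) *\<^sub>R x)) (\<lambda>_. ennreal (\<bar>- 1\<bar> ^ DIM(real^'n)))"
    by (rule lborel_affine) simp
  then show ?thesis by (simp add: density_1)
qed

lemma AE_lborel_diff_left:
  fixes z :: "real^'n"
  assumes "AE y in lborel. P y"
  shows "AE y in lborel. P (z - y)"
proof -
  have "AE y in distr lborel borel (\<lambda>x. z - x). P y"
    using assms by (simp only: distr_lborel_diff_left)
  then show ?thesis by (rule AE_distrD[rotated]) simp
qed

text \<open>\<open>reflect v\<close> is the function \<open>y \<mapsto> v(-y)\<close>.\<close>

lift_definition reflect :: "'n::finite torus_fun \<Rightarrow> 'n torus_fun" is "\<lambda>f y. f (- y)"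
proof -
  fix f g :: "real^'n \<Rightarrow> real"
  assume fg: "torus_eq f g"
  have per: "periodic (\<lambda>y. h (- y))" if "periodic h" for h :: "real^'n \<Rightarrow> real"
    unfolding periodic_def
  proof (intro allI)
    fix y :: "real^'n" and k
    have "- (y + int_vec k) = - y + int_vec (- k)"
      by (simp add: int_vec_def vec_eq_iff)
    with that show "h (- (y + int_vec k)) = h (- y)"
      unfolding periodic_def by metis
  qed
  have "AE y in lborel. f (0 - y) = g (0 - y)"
    using fg by (intro AE_lborel_diff_left) (simp add: torus_eq_def)
  moreover have "(\<lambda>y. f (- y)) \<in> borel_measurable borel" "(\<lambda>y. g (- y)) \<in> borel_measurable borel"
    using fg unfolding torus_eq_def by (auto intro: measurable_compose[OF borel_measurable_uminus])
  ultimately show "torus_eq (\<lambda>y. f (- y)) (\<lambda>y. g (- y))"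
    using fg per by (simp add: torus_eq_def)
qed

lift_definition torus_integral :: "'n::finite torus_fun \<Rightarrow> real"
  is "\<lambda>f. LINT y:cbox 0 1|lborel. f y"
  by (auto simp: torus_eq_def intro!: set_lebesgue_integral_cong_AE elim: eventually_mono)

lift_definition torus_L1 :: "'n::finite torus_fun \<Rightarrow> bool"
  is "\<lambda>f. set_integrable lborel (cbox 0 1) f"
proof -
  fix f g :: "real^'n \<Rightarrow> real"
  assume "torus_eq f g"
  then show "set_integrable lborel (cbox 0 1) f = set_integrable lborel (cbox 0 1) g"
    unfolding torus_eq_def by (intro set_integrable_cong_AE) (auto elim: eventually_mono)
qed

definition torus_L2 :: "'n::finite torus_fun set" where
  "torus_L2 = {f. torus_L1 (f * f)}"

lift_definition fourier :: "'n::finite torus_fun \<Rightarrow> int^'n \<Rightarrow> complex"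
  is "\<lambda>f k. LINT y:cbox 0 1|lborel.
        complex_of_real (f y) * exp (- (2 * of_real pi * \<i> * of_real (int_vec k \<bullet> y)))"
  by (auto simp: torus_eq_def fun_eq_iff intro!: set_lebesgue_integral_cong_AE elim: eventually_mono)

text \<open>
  The Fourier coefficients of an even function are real, so that \<open>- a / fourier \<Phi> k0\<close> is the real
  number \<open>- a / Re (fourier \<Phi> k0)\<close>.
\<close>

lemma fourier_even_real:
  fixes \<Phi> :: "'n::finite torus_fun"
  assumes "reflect \<Phi> = \<Phi>"
  shows "fourier \<Phi> k \<in> \<real>"
  using assms
proof transfer
  fix f :: "real^'n \<Rightarrow> real" and k :: "int^'n"
  assume "torus_eq f f" and ev: "torus_eq (\<lambda>y. f (- y)) f"
  then have [measurable]: "f \<in> borel_measurable borel" and per: "periodic f"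
    by (auto simp: torus_eq_def)
  define e where "e y = exp (- (2 * of_real pi * \<i> * of_real (int_vec k \<bullet> y)))" for y :: "real^'n"
  have cis: "e y = cis (- (2 * pi * (int_vec k \<bullet> y)))" for y
    by (simp add: e_def cis_conv_exp mult_ac)
  have [measurable]: "e \<in> borel_measurable borel"
    unfolding e_def by (intro borel_measurable_continuous_onI continuous_intros)
  define F where "F y = indicator (cbox 0 1) y *\<^sub>R (complex_of_real (f y) * e y)" for y
  have [measurable]: "F \<in> borel_measurable borel"
    unfolding F_def by measurable
  have one: "1 - y = - y + int_vec 1" for y :: "real^'n"
    by (simp add: int_vec_def vec_eq_iff)
  have e1: "e (1 - y) = cnj (e y)" for y
  proof -
    have "int_vec k \<bullet> (1::real^'n) = of_int (\<Sum>i\<in>UNIV. k $ i)"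
      by (simp add: int_vec_def inner_vec_def)
    then have "- (2 * pi * (int_vec k \<bullet> (1 - y)))
        = 2 * pi * (int_vec k \<bullet> y) + 2 * pi * of_int (- (\<Sum>i\<in>UNIV. k $ i))"
      by (simp add: inner_diff_right algebra_simps)
    moreover have "cis (2 * pi * of_int (- (\<Sum>i\<in>UNIV. k $ i))) = 1"
      by (rule cis_multiple_2pi) (rule Ints_of_int)
    ultimately show ?thesis
      unfolding cis cis_cnj by (simp only: cis_mult[symmetric]) simp
  qed
  have "AE y in lborel. f (- y) = f y"
    using ev by (simp add: torus_eq_def)
  then have AE: "AE y in lborel. F (1 - y) = cnj (F y)"
  proof eventually_elim
    case (elim y)
    have "f (1 - y) = f y"
      using per elim unfolding one periodic_def by metis
    moreover have "indicator (cbox 0 (1::real^'n)) (1 - y) = (indicator (cbox 0 1) y :: real)"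
      by (auto simp: indicator_def mem_box_cart)
    ultimately show ?case
      by (simp add: F_def e1)
  qed
  have "cnj (integral\<^sup>L lborel F) = (LINT y|lborel. cnj (F y))"
    by simp
  also have "\<dots> = (LINT y|lborel. F (1 - y))"
    using AE measurable_compose[OF _ borel_measurable_continuous_onI[OF continuous_on_cnj[OF continuous_on_id]], of F]
    by (intro integral_cong_AE) (auto elim: eventually_mono)
  also have "\<dots> = integral\<^sup>L (distr lborel borel (\<lambda>y. 1 - y)) F"
    by (rule integral_distr[symmetric]) auto
  also have "\<dots> = integral\<^sup>L lborel F"
    by (simp only: distr_lborel_diff_left)
  finally have "cnj (integral\<^sup>L lborel F) = integral\<^sup>L lborel F" .
  then show "(LINT y:cbox 0 1|lborel.
      complex_of_real (f y) * exp (- (2 * of_real pi * \<i> * of_real (int_vec k \<bullet> y)))) \<in> \<real>"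
    unfolding set_lebesgue_integral_def F_def e_def by (simp add: Reals_cnj_iff)
qed

lift_definition convolution :: "'n::finite torus_fun \<Rightarrow> 'n torus_fun \<Rightarrow> 'n torus_fun"
  is "\<lambda>\<Phi> f y. LINT z:cbox 0 1|lborel. \<Phi> (y - z) * f z"
proof -
  fix \<Phi> \<Phi>' f f' :: "real^'n \<Rightarrow> real"
  assume \<Phi>: "torus_eq \<Phi> \<Phi>'" and f: "torus_eq f f'"
  have meas: "(\<lambda>y. LINT z:cbox 0 1|lborel. P (y - z) * g z) \<in> borel_measurable borel"
    if [measurable]: "P \<in> borel_measurable borel" "g \<in> borel_measurable borel"
    for P g :: "real^'n \<Rightarrow> real"
    unfolding set_lebesgue_integral_def by measurable
  have per: "periodic (\<lambda>y. LINT z:cbox 0 1|lborel. P (y - z) * g z)" if "periodic P"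
    for P g :: "real^'n \<Rightarrow> real"
    using that by (auto simp: periodic_def diff_add_eq[symmetric])
  have "(LINT z:cbox 0 1|lborel. \<Phi> (y - z) * f z) = (LINT z:cbox 0 1|lborel. \<Phi>' (y - z) * f' z)" for y
  proof (rule set_lebesgue_integral_cong_AE)
    have [measurable]: "\<Phi> \<in> borel_measurable borel" "\<Phi>' \<in> borel_measurable borel"
      "f \<in> borel_measurable borel" "f' \<in> borel_measurable borel"
      using \<Phi> f by (auto simp: torus_eq_def)
    show "(\<lambda>z. \<Phi> (y - z) * f z) \<in> borel_measurable lborel"
      "(\<lambda>z. \<Phi>' (y - z) * f' z) \<in> borel_measurable lborel"
      by measurable
    have "AE z in lborel. \<Phi> (y - z) = \<Phi>' (y - z)"
      using \<Phi> by (intro AE_lborel_diff_left) (simp add: torus_eq_def)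
    moreover have "AE z in lborel. f z = f' z"
      using f by (simp add: torus_eq_def)
    ultimately show "AE z\<in>cbox 0 1 in lborel. \<Phi> (y - z) * f z = \<Phi>' (y - z) * f' z"
      by eventually_elim simp
  qed simp
  with \<Phi> f meas per show "torus_eq (\<lambda>y. LINT z:cbox 0 1|lborel. \<Phi> (y - z) * f z)
      (\<lambda>y. LINT z:cbox 0 1|lborel. \<Phi>' (y - z) * f' z)"
    by (simp add: torus_eq_def)
qed


section \<open>Weak derivatives\<close>

text \<open>
  \<open>g\<close> is the weak partial derivative of \<open>f\<close> in direction \<open>i\<close>: both are integrable on the torus and
  \<open>\<integral> f \<partial>\<^sub>i\<phi> = - \<integral> g \<phi>\<close> for every periodic test function \<open>\<phi>\<close> of class \<open>C^1\<close>, whose total derivative is \<open>D\<close>.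
\<close>

lift_definition has_weak_partial :: "'n::finite torus_fun \<Rightarrow> 'n \<Rightarrow> 'n torus_fun \<Rightarrow> bool"
  is "\<lambda>f i g. set_integrable lborel (cbox 0 1) f \<and> set_integrable lborel (cbox 0 1) g \<and>
        (\<forall>(\<phi> :: real^'n \<Rightarrow> real) D. periodic \<phi> \<longrightarrow>
           (\<forall>y. (\<phi> has_derivative blinfun_apply (D y)) (at y)) \<longrightarrow> continuous_on UNIV D \<longrightarrow>
           (LINT y:cbox 0 1|lborel. f y * blinfun_apply (D y) (axis i 1))
             = - (LINT y:cbox 0 1|lborel. g y * \<phi> y))"
proof -
  fix f f' :: "real^'n \<Rightarrow> real" and i :: 'n and g g' :: "real^'n \<Rightarrow> real"
  assume f: "torus_eq f f'" and g: "torus_eq g g'"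
  have int: "set_integrable lborel (cbox 0 1) h = set_integrable lborel (cbox 0 1) h'"
    if "torus_eq h h'" for h h' :: "real^'n \<Rightarrow> real"
    using that unfolding torus_eq_def by (intro set_integrable_cong_AE) (auto elim: eventually_mono)
  have prod: "(LINT y:cbox 0 1|lborel. h y * \<phi> y) = (LINT y:cbox 0 1|lborel. h' y * \<phi> y)"
    if "torus_eq h h'" "\<phi> \<in> borel_measurable borel" for h h' \<phi> :: "real^'n \<Rightarrow> real"
    using that by (auto simp: torus_eq_def intro!: set_lebesgue_integral_cong_AE elim: eventually_mono)
  have meas: "\<phi> \<in> borel_measurable borel" "(\<lambda>y. blinfun_apply (D y) (axis i 1)) \<in> borel_measurable borel"
    if "\<forall>y. (\<phi> has_derivative blinfun_apply (D y)) (at y)" "continuous_on UNIV D"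
    for \<phi> :: "real^'n \<Rightarrow> real" and D
  proof -
    have "continuous_on UNIV \<phi>"
      using that(1) by (meson has_derivative_continuous continuous_at_imp_continuous_on)
    then show "\<phi> \<in> borel_measurable borel" by (rule borel_measurable_continuous_onI)
    show "(\<lambda>y. blinfun_apply (D y) (axis i 1)) \<in> borel_measurable borel"
      using that(2) by (intro borel_measurable_continuous_onI continuous_intros)
  qed
  show "(set_integrable lborel (cbox 0 1) f \<and> set_integrable lborel (cbox 0 1) g \<and>
        (\<forall>(\<phi> :: real^'n \<Rightarrow> real) D. periodic \<phi> \<longrightarrow>
           (\<forall>y. (\<phi> has_derivative blinfun_apply (D y)) (at y)) \<longrightarrow> continuous_on UNIV D \<longrightarrow>
           (LINT y:cbox 0 1|lborel. f y * blinfun_apply (D y) (axis i 1))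
             = - (LINT y:cbox 0 1|lborel. g y * \<phi> y))) =
        (set_integrable lborel (cbox 0 1) f' \<and> set_integrable lborel (cbox 0 1) g' \<and>
        (\<forall>(\<phi> :: real^'n \<Rightarrow> real) D. periodic \<phi> \<longrightarrow>
           (\<forall>y. (\<phi> has_derivative blinfun_apply (D y)) (at y)) \<longrightarrow> continuous_on UNIV D \<longrightarrow>
           (LINT y:cbox 0 1|lborel. f' y * blinfun_apply (D y) (axis i 1))
             = - (LINT y:cbox 0 1|lborel. g' y * \<phi> y)))"
    unfolding int[OF f] int[OF g]
    by (intro conj_cong refl all_cong1 imp_cong) (simp only: prod[OF f meas(2)] prod[OF g meas(1)])
qed

definition weakly_differentiable :: "'n::finite torus_fun \<Rightarrow> bool" where
  "weakly_differentiable f \<longleftrightarrow> (\<forall>i. \<exists>g. has_weak_partial f i g)"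

definition weak_partial :: "'n::finite \<Rightarrow> 'n torus_fun \<Rightarrow> 'n torus_fun" where
  "weak_partial i f = (THE g. has_weak_partial f i g)"

definition grad :: "'n::finite torus_fun \<Rightarrow> 'n torus_fun ^ 'n" where
  "grad f = (\<chi> i. weak_partial i f)"

definition divergence :: "'n::finite torus_fun ^ 'n \<Rightarrow> 'n torus_fun" where
  "divergence V = (\<Sum>i\<in>UNIV. weak_partial i (V $ i))"

definition laplacian :: "'n::finite torus_fun \<Rightarrow> 'n torus_fun" where
  "laplacian f = divergence (grad f)"

definition conv_field :: "'n::finite torus_fun \<Rightarrow> 'n torus_fun ^ 'n \<Rightarrow> 'n torus_fun ^ 'n" where
  "conv_field \<Phi> V = (\<chi> i. convolution \<Phi> (V $ i))"


section \<open>Sobolev spaces\<close>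

definition sobolev :: "real \<Rightarrow> 'n::finite torus_fun set" where
  "sobolev r = {f \<in> torus_L2.
     (\<lambda>k. (1 + (norm (int_vec k))\<^sup>2) powr r * (cmod (fourier f k))\<^sup>2) summable_on UNIV}"

definition sobolev_norm :: "real \<Rightarrow> 'n::finite torus_fun \<Rightarrow> real" where
  "sobolev_norm r f =
     sqrt (\<Sum>\<^sub>\<infinity>k. (1 + (norm (int_vec k))\<^sup>2) powr r * (cmod (fourier f k))\<^sup>2)"

definition sobolev_even0 :: "real \<Rightarrow> 'n::finite torus_fun set" where
  "sobolev_even0 r = {v \<in> sobolev r. torus_integral v = 0 \<and> reflect v = v}"

definition X_space :: "real \<Rightarrow> 'n::finite torus_fun set" where
  "X_space s = sobolev_even0 (s + 2)"

definition Y_space :: "real \<Rightarrow> 'n::finite torus_fun set" where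
  "Y_space s = sobolev_even0 s"

text \<open>
  The \<open>H^r\<close> norm depends on the parameter \<open>r\<close> and so is not the norm of a type: open sets and
  derivatives of curves are spelled out in terms of \<open>sobolev_norm\<close>.
\<close>

definition open_in_R_X :: "real \<Rightarrow> (real \<times> 'n::finite torus_fun) set \<Rightarrow> bool" where
  "open_in_R_X s U \<longleftrightarrow> U \<subseteq> UNIV \<times> X_space s \<and>
     (\<forall>(c, v)\<in>U. \<exists>\<delta>>0. \<forall>c'. \<forall>v'\<in>X_space s.
        \<bar>c' - c\<bar> < \<delta> \<and> sobolev_norm (s + 2) (v' - v) < \<delta> \<longrightarrow> (c', v') \<in> U)"

definition has_sobolev_derivative ::
    "real \<Rightarrow> (real \<Rightarrow> 'n::finite torus_fun) \<Rightarrow> 'n torus_fun \<Rightarrow> real set \<Rightarrow> real \<Rightarrow> bool" where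
  "has_sobolev_derivative r g g' I t \<longleftrightarrow>
     ((\<lambda>\<tau>. sobolev_norm r ((g \<tau> - g t) /\<^sub>R (\<tau> - t) - g')) \<longlongrightarrow> 0) (at t within I)"

definition differentiable_curve ::
    "real \<Rightarrow> 'n::finite torus_fun set \<Rightarrow> real set \<Rightarrow> (real \<Rightarrow> 'n torus_fun) \<Rightarrow> bool" where
  "differentiable_curve r S I g \<longleftrightarrow>
     (\<forall>t\<in>I. g t \<in> S \<and> (\<exists>g'\<in>S. has_sobolev_derivative r g g' I t))"

definition C1_curve ::
    "real \<Rightarrow> 'n::finite torus_fun set \<Rightarrow> real set \<Rightarrow> (real \<Rightarrow> 'n torus_fun) \<Rightarrow> bool" where
  "C1_curve r S I g \<longleftrightarrow> (\<exists>g'.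
     (\<forall>t\<in>I. g t \<in> S \<and> g' t \<in> S \<and> has_sobolev_derivative r g (g' t) I t) \<and>
     (\<forall>t\<in>I. ((\<lambda>\<tau>. sobolev_norm r (g' \<tau> - g' t)) \<longlongrightarrow> 0) (at t within I)))"


section \<open>The equation\<close>

definition bif_map :: "real \<Rightarrow> 'n::finite torus_fun \<Rightarrow> real \<Rightarrow> 'n torus_fun \<Rightarrow> 'n torus_fun" where
  "bif_map a \<Phi> c v =
     a *\<^sub>R laplacian v + divergence ((of_real c + v) *s conv_field \<Phi> (grad (of_real c + v)))"

text \<open>
  Differentiability of \<open>u\<close> and of the components of the flux is part of being a solution, since
  \<open>weak_partial\<close> is unspecified where no weak derivative exists.
\<close>

definition is_solution :: "real \<Rightarrow> 'n::finite torus_fun \<Rightarrow> 'n torus_fun \<Rightarrow> bool" where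
  "is_solution a \<Phi> u \<longleftrightarrow> weakly_differentiable u \<and>
     (let J = a *\<^sub>R grad u + u *s conv_field \<Phi> (grad u)
      in (\<forall>i. weakly_differentiable (J $ i)) \<and> divergence J = 0)"

end

theory Submission
  imports Defs
begin

text \<open>
  On the Fourier side the equation reads, after division by \<open>- 4 \<pi>\<^sup>2 |k|\<^sup>2\<close>,
  \<open>(a + c \<Phi>\<^sub>k) v\<^sub>k + \<Sum>\<^sub>j (k \<bullet> j) / |k|\<^sup>2 \<Phi>\<^sub>j v\<^sub>j v\<^sub>k\<^sub>-\<^sub>j = 0\<close> for \<open>k \<noteq> 0\<close>; the division restores the two derivatives
  lost in the nonlinearity, so that all terms are bounded on the weighted space \<open>l\<^sup>2\<close> isometric to \<open>H\<^sup>s\<^sup>+\<^sup>2\<close>.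
  At \<open>c = c\<^sub>0\<close> the linear part is diagonal, vanishes exactly at \<open>k = \<plusminus> k\<^sub>0\<close> and is otherwise bounded away from
  zero, because \<open>\<Phi>\<^sub>k\<close> tends to zero by Bessel's inequality. Writing \<open>v = t (e\<^sub>0 + y)\<close> with \<open>y\<close> vanishing at
  \<open>\<plusminus> k\<^sub>0\<close>, the equation at \<open>k\<^sub>0\<close> determines \<open>c\<close> as \<open>c\<^sub>0 - t \<beta>(y)\<close>, and the remaining ones become a fixed point
  equation \<open>y = t N(y)\<close> with a cubic polynomial \<open>N\<close>, which the contraction principle solves by a \<open>C\<^sup>1\<close> curve.
  Since \<open>s > d / 2\<close>, every function involved has an absolutely convergent Fourier series, and weak
  derivatives, products and convolutions act on the coefficients.
\<close>

section \<open>Square-summable families\<close>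

text \<open>The spaces \<open>X_space s\<close> vary with a real parameter and are not types,
  whereas contraction and differentiation ask for a Banach space type; hence \<open>l2\<close>, to
  which even functions are carried by weighting their coefficients. Evenness makes these
  coefficients real and ties the mode \<open>- k0\<close> to \<open>k0\<close>, so the kernel of the
  linearization is one-dimensional. The symbol \<open>a + c * P k0\<close> has the nonzero
  derivative \<open>P k0\<close> in \<open>c\<close>, which is the transversality that lets the
  equation at \<open>k0\<close> be solved for \<open>c\<close> explicitly. Evenness and zero mean
  are not imposed on the space of the contraction: \<open>N\<close> acts on all of
  \<open>l2\<close>, commutes with \<open>flip\<close> and has no modes at 0, \<open>k0\<close> and
  \<open>- k0\<close>, so uniqueness of the fixed point returns the symmetry. The ansatz
  \<open>t * (e0 + y)\<close> with bounded \<open>y\<close> only sees solutions whose remainder is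
  comparable with their kernel component. That every solution near the bifurcation point is of this
  kind is a separate estimate, \<open>small_solution_bound\<close>; it is what makes the zero set
  exactly two curves.\<close>

typedef 'i l2 = "{f :: 'i \<Rightarrow> real. (\<lambda>i. (f i)\<^sup>2) summable_on UNIV}"
  morphisms coord l2_of
  by (rule exI[of _ "\<lambda>_. 0"]) simp

setup_lifting type_definition_l2

text \<open>Finite partial norms are the common currency of this section: Minkowski and
  Cauchy-Schwarz hold for \<open>L2_set\<close>, and bounds uniform in the finite set pass to the
  infinite sums.\<close>

lemma square_summableI:
  fixes f :: "'a \<Rightarrow> real"
  assumes "\<And>F. finite F \<Longrightarrow> L2_set f F \<le> M"
  shows "(\<lambda>i. (f i)\<^sup>2) summable_on UNIV"
proof (rule nonneg_bdd_above_summable_on)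
  show "bdd_above (sum (\<lambda>i. (f i)\<^sup>2) ` {F. F \<subseteq> UNIV \<and> finite F})"
  proof (rule bdd_aboveI2)
    fix F :: "'a set" assume "F \<in> {F. F \<subseteq> UNIV \<and> finite F}"
    then have "L2_set f F \<le> M" using assms by auto
    then have "(L2_set f F)\<^sup>2 \<le> M\<^sup>2" by (intro power_mono) auto
    then show "(\<Sum>i\<in>F. (f i)\<^sup>2) \<le> M\<^sup>2" by (simp add: L2_set_def sum_nonneg)
  qed
qed simp

lemma L2_set_le_infsum:
  assumes "(\<lambda>i. (f i)\<^sup>2) summable_on UNIV" "finite F"
  shows "L2_set f F \<le> sqrt (\<Sum>\<^sub>\<infinity>i. (f i)\<^sup>2)"
  unfolding L2_set_def using assms by (intro real_sqrt_le_mono finite_sum_le_infsum) auto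

lemma sqrt_infsum_square_le:
  fixes f :: "'a \<Rightarrow> real"
  assumes "\<And>F. finite F \<Longrightarrow> L2_set f F \<le> M"
  shows "sqrt (\<Sum>\<^sub>\<infinity>i. (f i)\<^sup>2) \<le> M"
proof (rule real_le_lsqrt)
  show "0 \<le> M" using assms[of "{}"] by simp
  show "(\<Sum>\<^sub>\<infinity>i. (f i)\<^sup>2) \<le> M\<^sup>2"
  proof (rule infsum_le_finite_sums[OF square_summableI[OF assms]])
    fix F :: "'a set" assume "finite F"
    then have "(L2_set f F)\<^sup>2 \<le> M\<^sup>2" using assms by (intro power_mono) auto
    then show "(\<Sum>i\<in>F. (f i)\<^sup>2) \<le> M\<^sup>2" by (simp add: L2_set_def sum_nonneg)
  qed
qed

lemma L2_set_diff_le: "L2_set (\<lambda>i. f i - g i) F \<le> L2_set f F + L2_set g F"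
  using L2_set_triangle_ineq[of f "\<lambda>i. - g i" F] by (simp add: L2_set_def)

instantiation l2 :: (type) real_vector
begin

lift_definition zero_l2 :: "'a l2" is "\<lambda>_. 0" by simp

lift_definition plus_l2 :: "'a l2 \<Rightarrow> 'a l2 \<Rightarrow> 'a l2" is "\<lambda>f g i. f i + g i"
proof -
  fix f g :: "'a \<Rightarrow> real"
  assume fg: "(\<lambda>i. (f i)\<^sup>2) summable_on UNIV" "(\<lambda>i. (g i)\<^sup>2) summable_on UNIV"
  show "(\<lambda>i. (f i + g i)\<^sup>2) summable_on UNIV"
    by (rule square_summableI,
        rule order_trans[OF L2_set_triangle_ineq add_mono[OF fg[THEN L2_set_le_infsum]]])
qed

lift_definition minus_l2 :: "'a l2 \<Rightarrow> 'a l2 \<Rightarrow> 'a l2" is "\<lambda>f g i. f i - g i"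
proof -
  fix f g :: "'a \<Rightarrow> real"
  assume fg: "(\<lambda>i. (f i)\<^sup>2) summable_on UNIV" "(\<lambda>i. (g i)\<^sup>2) summable_on UNIV"
  show "(\<lambda>i. (f i - g i)\<^sup>2) summable_on UNIV"
    by (rule square_summableI,
        rule order_trans[OF L2_set_diff_le add_mono[OF fg[THEN L2_set_le_infsum]]])
qed

lift_definition uminus_l2 :: "'a l2 \<Rightarrow> 'a l2" is "\<lambda>f i. - f i" by simp

lift_definition scaleR_l2 :: "real \<Rightarrow> 'a l2 \<Rightarrow> 'a l2" is "\<lambda>c f i. c * f i"
  by (simp add: power_mult_distrib summable_on_cmult_right)

instance
  by standard (transfer; auto simp: algebra_simps)+

end

instantiation l2 :: (type) real_normed_vector
begin

lift_definition norm_l2 :: "'a l2 \<Rightarrow> real" is "\<lambda>f. sqrt (\<Sum>\<^sub>\<infinity>i. (f i)\<^sup>2)" .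

definition dist_l2 :: "'a l2 \<Rightarrow> 'a l2 \<Rightarrow> real" where "dist_l2 x y = norm (x - y)"
definition sgn_l2 :: "'a l2 \<Rightarrow> 'a l2" where "sgn_l2 x = x /\<^sub>R norm x"
definition uniformity_l2 :: "('a l2 \<times> 'a l2) filter" where
  "uniformity_l2 = (INF e\<in>{0<..}. principal {(x, y). dist x y < e})"
definition open_l2 :: "'a l2 set \<Rightarrow> bool" where
  "open_l2 U = (\<forall>x\<in>U. \<forall>\<^sub>F (x', y) in uniformity. x' = x \<longrightarrow> y \<in> U)"

instance
proof
  fix x y :: "'a l2" and c :: real
  show "norm (x + y) \<le> norm x + norm y"
    by transfer (rule sqrt_infsum_square_le, rule order_trans[OF L2_set_triangle_ineq],
      intro add_mono L2_set_le_infsum)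
  show "norm (c *\<^sub>R x) = \<bar>c\<bar> * norm x"
    by transfer (simp add: power_mult_distrib infsum_cmult_right' real_sqrt_mult)
  show "norm x = 0 \<longleftrightarrow> x = 0"
  proof transfer
    fix f :: "'a \<Rightarrow> real" assume f: "(\<lambda>i. (f i)\<^sup>2) summable_on UNIV"
    have "f i = 0" if "(\<Sum>\<^sub>\<infinity>i. (f i)\<^sup>2) = 0" for i
      using nonneg_infsum_le_0D[of "\<lambda>i. (f i)\<^sup>2" UNIV i] f that by simp
    then show "sqrt (\<Sum>\<^sub>\<infinity>i. (f i)\<^sup>2) = 0 \<longleftrightarrow> f = (\<lambda>_. 0)"
      by (auto simp: fun_eq_iff)
  qed
qed (transfer; auto simp: algebra_simps dist_l2_def sgn_l2_def uniformity_l2_def open_l2_def)+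

end

lemma coord_simps [simp]:
  "coord 0 i = 0" "coord (x + y) i = coord x i + coord y i"
  "coord (x - y) i = coord x i - coord y i" "coord (- x) i = - coord x i"
  "coord (c *\<^sub>R x) i = c * coord x i"
  by (transfer; simp)+

lemma l2_eqI: "(\<And>i. coord x i = coord y i) \<Longrightarrow> x = y"
  by transfer auto

lemma L2_set_le_norm: "finite F \<Longrightarrow> L2_set (coord x) F \<le> norm x"
  by transfer (rule L2_set_le_infsum)

lemma norm_l2_leI: "(\<And>F. finite F \<Longrightarrow> L2_set (coord x) F \<le> M) \<Longrightarrow> norm x \<le> M"
  by transfer (rule sqrt_infsum_square_le)

lemma summable_coord_square: "(\<lambda>i. (coord x i)\<^sup>2) summable_on UNIV"
  by transfer

lemma norm_l2_infsum: "norm x = sqrt (\<Sum>\<^sub>\<infinity>i. (coord x i)\<^sup>2)"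
  by transfer (rule refl)

lemma abs_coord_le: "\<bar>coord x i\<bar> \<le> norm x"
  using L2_set_le_norm[of "{i}" x] by (simp add: L2_set_def)

lemma bounded_linear_coord: "bounded_linear (\<lambda>x. coord x i)"
  by (rule bounded_linear_intro[of _ 1]) (auto simp: abs_coord_le)

lemma L2_set_abs_mono:
  assumes "\<And>i. i \<in> F \<Longrightarrow> \<bar>f i\<bar> \<le> \<bar>g i\<bar>"
  shows "L2_set f F \<le> L2_set g F"
  unfolding L2_set_def using assms
  by (intro real_sqrt_le_mono sum_mono) (metis abs_le_square_iff)

text \<open>Multipliers and the quadratic operator enter \<open>l2\<close> this way: a coordinate
  formula only has to be dominated.\<close>

lemma dominated_l2:
  assumes "\<And>i. \<bar>f i\<bar> \<le> \<bar>coord y i\<bar>"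
  obtains x where "coord x = f" "norm x \<le> norm y"
proof -
  have *: "L2_set f F \<le> norm y" if "finite F" for F
    using L2_set_abs_mono[of F f "coord y"] assms L2_set_le_norm[OF that, of y] by force
  have c: "coord (l2_of f) = f"
    using square_summableI[OF *] by (simp add: l2_of_inverse)
  show ?thesis
    using that[OF c] * norm_l2_leI[of "l2_of f"] c by simp
qed

lemma abs_summable_coord_mult:
  "(\<lambda>i. \<bar>coord x i * coord y i\<bar>) summable_on UNIV"
  "(\<Sum>\<^sub>\<infinity>i. \<bar>coord x i * coord y i\<bar>) \<le> norm x * norm y"
proof -
  have *: "(\<Sum>i\<in>F. \<bar>coord x i * coord y i\<bar>) \<le> norm x * norm y" if "finite F" for F
    using L2_set_mult_ineq[of "coord x" "coord y" F]
      mult_mono[OF L2_set_le_norm[OF that, of x] L2_set_le_norm[OF that, of y]]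
    by (simp add: abs_mult)
  show s: "(\<lambda>i. \<bar>coord x i * coord y i\<bar>) summable_on UNIV"
    by (rule nonneg_bdd_above_summable_on) (auto intro!: bdd_aboveI2 *)
  show "(\<Sum>\<^sub>\<infinity>i. \<bar>coord x i * coord y i\<bar>) \<le> norm x * norm y"
    by (rule infsum_le_finite_sums[OF s]) (rule *)
qed

text \<open>The limit is taken coordinatewise. A finite partial norm depends continuously on
  finitely many coordinates, so the Cauchy bound survives the limit on each finite set, uniformly in
  the set.\<close>

instance l2 :: (type) banach
proof
  fix X :: "nat \<Rightarrow> 'a l2"
  assume X: "Cauchy X"
  have "Cauchy (\<lambda>n. coord (X n) i)" for i
    using bounded_linear.Cauchy[OF bounded_linear_coord X] .
  then have "\<forall>i. \<exists>l. (\<lambda>n. coord (X n) i) \<longlonglongrightarrow> l"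
    by (auto simp: Cauchy_convergent_iff convergent_def)
  then obtain f where f: "\<And>i. (\<lambda>n. coord (X n) i) \<longlonglongrightarrow> f i" by metis
  have tail: "L2_set (\<lambda>i. coord (X m) i - f i) F \<le> e"
    if e: "\<forall>m\<ge>N. \<forall>n\<ge>N. norm (X m - X n) < e" and "m \<ge> N" "finite F" for N m e F
  proof (rule Lim_bounded)
    show "(\<lambda>n. L2_set (coord (X m - X n)) F) \<longlonglongrightarrow> L2_set (\<lambda>i. coord (X m) i - f i) F"
      unfolding L2_set_def coord_simps by (intro tendsto_intros f)
    show "\<forall>n\<ge>N. L2_set (coord (X m - X n)) F \<le> e"
      using e that(2,3) by (meson L2_set_le_norm less_imp_le order_trans)
  qed
  have C: "\<exists>N. \<forall>m\<ge>N. \<forall>n\<ge>N. norm (X m - X n) < e" if "e > 0" for e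
    using X that unfolding Cauchy_def dist_norm by blast
  then obtain N where N: "\<forall>m\<ge>N. \<forall>n\<ge>N. norm (X m - X n) < 1"
    using zero_less_one by blast
  have "L2_set f F \<le> norm (X N) + 1" if "finite F" for F
    using L2_set_diff_le[of "coord (X N)" "\<lambda>i. coord (X N) i - f i" F] tail[OF N order_refl that]
      L2_set_le_norm[OF that, of "X N"] by simp
  then have c: "coord (l2_of f) = f"
    by (intro l2_of_inverse) (auto intro: square_summableI)
  have "X \<longlonglongrightarrow> l2_of f"
  proof (rule metric_LIMSEQ_I)
    fix e :: real assume e: "e > 0"
    then obtain N where N: "\<forall>m\<ge>N. \<forall>n\<ge>N. norm (X m - X n) < e / 2"
      using C[of "e / 2"] by auto
    have "norm (X m - l2_of f) \<le> e / 2" if "m \<ge> N" for m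
      by (rule norm_l2_leI) (use tail[OF N that] in \<open>simp add: c cong: L2_set_cong\<close>)
    then show "\<exists>N. \<forall>n\<ge>N. dist (X n) (l2_of f) < e"
      using e by (intro exI[of _ N]) (force simp: dist_norm)
  qed
  then show "convergent X" by (auto simp: convergent_def)
qed

text \<open>Supplies the translates needed for convolutions and the reflection \<open>flip\<close>,
  all of them isometries.\<close>

lemma coord_reindex:
  assumes "bij p"
  obtains x where "\<And>i. coord x i = coord y (p i)" "norm x = norm y"
proof -
  have "(\<lambda>i. (coord y (p i))\<^sup>2) summable_on UNIV"
    using summable_on_reindex_bij_betw[OF assms, of "\<lambda>i. (coord y i)\<^sup>2"] summable_coord_square by simp
  then have c: "coord (l2_of (\<lambda>i. coord y (p i))) = (\<lambda>i. coord y (p i))"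
    by (simp add: l2_of_inverse)
  moreover have "norm (l2_of (\<lambda>i. coord y (p i))) = norm y"
    unfolding norm_l2_infsum c by (simp add: infsum_reindex_bij_betw[OF assms, of "\<lambda>i. (coord y i)\<^sup>2"])
  ultimately show ?thesis using that by metis
qed

text \<open>The convolution is an absolutely convergent series of translates of \<open>y\<close>.\<close>

lemma convolution_l1_l2:
  fixes b :: "'i::ab_group_add \<Rightarrow> real"
  assumes b: "(\<lambda>j. \<bar>b j\<bar>) summable_on UNIV"
  obtains z where "\<And>k. ((\<lambda>j. b j * coord y (k - j)) has_sum coord z k) UNIV"
    "norm z \<le> (\<Sum>\<^sub>\<infinity>j. \<bar>b j\<bar>) * norm y"
proof -
  have "\<exists>x. (\<forall>k. coord x k = coord y (k - j)) \<and> norm x = norm y" for j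
  proof -
    have "bij (\<lambda>k. k - j)" by (rule bij_betw_byWitness[of _ "\<lambda>k. k + j"]) auto
    then show ?thesis by (rule coord_reindex[of _ y]) blast
  qed
  then obtain S where S: "\<And>j k. coord (S j) k = coord y (k - j)" "\<And>j. norm (S j) = norm y"
    by metis
  have eq: "(\<lambda>j. norm (b j *\<^sub>R S j)) = (\<lambda>j. \<bar>b j\<bar> * norm y)"
    by (simp add: S)
  have abs: "(\<lambda>j. norm (b j *\<^sub>R S j)) summable_on UNIV"
    unfolding eq using b by (intro summable_on_cmult_left) simp
  then have sum: "((\<lambda>j. b j *\<^sub>R S j) has_sum (\<Sum>\<^sub>\<infinity>j. b j *\<^sub>R S j)) UNIV"
    by (simp add: abs_summable_summable)
  have "((\<lambda>j. b j * coord y (k - j)) has_sum coord (\<Sum>\<^sub>\<infinity>j. b j *\<^sub>R S j) k) UNIV" for k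
    using has_sum_bounded_linear[OF bounded_linear_coord sum, of k] by (simp add: o_def S)
  moreover have "norm (\<Sum>\<^sub>\<infinity>j. b j *\<^sub>R S j) \<le> (\<Sum>\<^sub>\<infinity>j. norm (b j *\<^sub>R S j))"
    by (rule norm_infsum_bound) (rule abs)
  then have "norm (\<Sum>\<^sub>\<infinity>j. b j *\<^sub>R S j) \<le> (\<Sum>\<^sub>\<infinity>j. \<bar>b j\<bar>) * norm y"
    unfolding eq using b by (subst (asm) infsum_cmult_left) auto
  ultimately show ?thesis using that by blast
qed

section \<open>Weights on the integer lattice\<close>

text \<open>The bracket of \<open>k\<close> to the power \<open>r\<close>. The exponent is halved so
  that the square of \<open>wt r\<close> is the weight in \<open>sobolev_norm r\<close>, and
  multiplying coefficients by \<open>wt r\<close> becomes an isometry into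
  \<open>l2\<close>.\<close>

definition wt :: "real \<Rightarrow> int^'n \<Rightarrow> real" where
  "wt r k = (1 + (norm (int_vec k))\<^sup>2) powr (r / 2)"

lemma int_vec_simps [simp]:
  "int_vec 0 = 0" "int_vec (j + k) = int_vec j + int_vec k"
  "int_vec (j - k) = int_vec j - int_vec k" "int_vec (- k) = - int_vec k"
  by (simp_all add: int_vec_def vec_eq_iff)

lemma int_vec_eq_iff [simp]: "int_vec j = int_vec k \<longleftrightarrow> j = k"
  by (simp add: int_vec_def vec_eq_iff)

lemma int_vec_eq_0_iff [simp]: "int_vec k = 0 \<longleftrightarrow> k = 0"
  using int_vec_eq_iff[of k 0] by (simp del: int_vec_eq_iff)

lemma one_le_norm_int_vec: "k \<noteq> 0 \<Longrightarrow> 1 \<le> norm (int_vec k)"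
proof -
  assume "k \<noteq> 0"
  then obtain i where "k $ i \<noteq> 0" by (auto simp: vec_eq_iff)
  then have "1 \<le> \<bar>int_vec k $ i\<bar>" by (simp add: int_vec_def flip: of_int_abs)
  also have "\<dots> \<le> norm (int_vec k)" using component_le_norm_cart by blast
  finally show ?thesis .
qed

lemma one_plus_sq_pos: "0 < 1 + (x::real)\<^sup>2"
  by (simp add: add_pos_nonneg)

lemma wt_pos [simp]: "0 < wt r k"
  by (simp add: wt_def add_pos_nonneg less_imp_neq[OF one_plus_sq_pos, symmetric])

lemma wt_nonneg [simp]: "0 \<le> wt r k"
  by (rule less_imp_le) (rule wt_pos)

lemma wt_neq_0 [simp]: "wt r k \<noteq> 0"
  using wt_pos[of r k] by linarith

lemma wt_minus [simp]: "wt r (- k) = wt r k"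
  by (simp add: wt_def)

lemma wt_add: "wt (r + q) k = wt r k * wt q k"
  by (simp add: wt_def add_divide_distrib powr_add)

lemma wt_uminus: "wt (- r) k = inverse (wt r k)"
  by (simp add: wt_def powr_minus)

lemma wt_square: "(wt r k)\<^sup>2 = (1 + (norm (int_vec k))\<^sup>2) powr r"
  by (simp add: wt_def power2_eq_square flip: powr_add)

lemma wt_mono: "r \<le> q \<Longrightarrow> wt r k \<le> wt q k"
  unfolding wt_def by (rule powr_mono) auto

lemma wt_0 [simp]: "wt 0 k = 1"
  by (simp add: wt_def less_imp_neq[OF one_plus_sq_pos, symmetric])

lemma one_le_wt: "0 \<le> r \<Longrightarrow> 1 \<le> wt r k"
  using wt_mono[of 0 r k] by simp

lemma wt_1: "wt 1 k = sqrt (1 + (norm (int_vec k))\<^sup>2)"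
  by (simp add: wt_def powr_half_sqrt)

lemma wt_2: "wt 2 k = 1 + (norm (int_vec k))\<^sup>2"
  by (simp add: wt_def less_imp_neq[OF one_plus_sq_pos, symmetric] add_nonneg_nonneg)

lemma norm_le_wt_1: "norm (int_vec k) \<le> wt 1 k"
  unfolding wt_1 by (rule real_le_rsqrt) simp

text \<open>Nonzero lattice points have length at least 1, so bracket and length are comparable;
  this makes the division by the length of \<open>k\<close> harmless in the kernel bound
  below.\<close>

lemma wt_1_le: "k \<noteq> 0 \<Longrightarrow> wt 1 k \<le> 2 * norm (int_vec k)"
proof -
  assume "k \<noteq> 0"
  then have "1 \<le> (norm (int_vec k))\<^sup>2"
    using one_le_norm_int_vec[of k] by (simp add: one_le_power)
  then show ?thesis unfolding wt_1 by (intro real_le_lsqrt) (auto simp: power_mult_distrib)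
qed

text \<open>Either \<open>j\<close> or \<open>k - j\<close> has at least half the length of
  \<open>k\<close>, and its bracket alone suffices; \<open>2 powr r\<close> is the price of that
  half.\<close>

lemma wt_triangle:
  assumes "0 \<le> r"
  shows "wt r k \<le> 2 powr r * (wt r j + wt r (k - j))"
proof -
  have *: "wt r k \<le> 2 powr r * wt r l" if "norm (int_vec k) \<le> 2 * norm (int_vec l)" for l :: "int^'n"
  proof -
    have "(norm (int_vec k))\<^sup>2 \<le> (2 * norm (int_vec l))\<^sup>2"
      using that by (intro power_mono) auto
    then have "1 + (norm (int_vec k))\<^sup>2 \<le> 2\<^sup>2 * (1 + (norm (int_vec l))\<^sup>2)"
      by (simp add: power_mult_distrib)
    then have "wt r k \<le> (2\<^sup>2 * (1 + (norm (int_vec l))\<^sup>2)) powr (r / 2)"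
      unfolding wt_def using assms by (intro powr_mono2) (auto simp: add_nonneg_nonneg)
    also have "\<dots> = (2\<^sup>2) powr (r / 2) * wt r l"
      unfolding wt_def by (rule powr_mult)
    also have "(2\<^sup>2) powr (r / 2) = (2 powr 2) powr (r / 2)" by simp
    also have "\<dots> = 2 powr r" by (simp add: powr_powr del: powr_numeral)
    finally show ?thesis .
  qed
  have n: "norm (int_vec k) \<le> norm (int_vec j) + norm (int_vec (k - j))"
    using norm_triangle_ineq[of "int_vec j" "int_vec (k - j)"] by simp
  have p: "0 \<le> 2 powr r * wt r l" for l :: "int^'n"
    using wt_pos[of r l] by (intro mult_nonneg_nonneg) (auto intro: less_imp_le)
  show ?thesis
  proof (cases "norm (int_vec (k - j)) \<le> norm (int_vec j)")
    case True
    then have "wt r k \<le> 2 powr r * wt r j" using n by (intro *) simp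
    then show ?thesis using p[of "k - j"] unfolding distrib_left by linarith
  next
    case False
    then have "wt r k \<le> 2 powr r * wt r (k - j)" using n by (intro *) simp
    then show ?thesis using p[of j] unfolding distrib_left by linarith
  qed
qed

text \<open>Comparison with \<open>n powr (- 2 * p)\<close> on each of two half-lines, which share
  the point 0.\<close>

lemma summable_int_powr:
  assumes "p > 1 / 2"
  shows "(\<lambda>m::int. (1 + (real_of_int m)\<^sup>2) powr - p) summable_on UNIV"
proof -
  define f where "f m = (1 + (real_of_int m)\<^sup>2) powr - p" for m
  have "summable (\<lambda>n. real n powr (- 2 * p))"
    using assms by (simp add: summable_real_powr_iff)
  moreover have "f (int n) \<le> real n powr (- 2 * p)" if "n \<ge> 1" for n
  proof -
    have "f (int n) \<le> ((real n)\<^sup>2) powr - p"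
      unfolding f_def using assms that by (intro powr_mono2') auto
    also have "(real n)\<^sup>2 = real n powr 2" using that by simp
    also have "(real n powr 2) powr - p = real n powr (- 2 * p)"
      by (simp only: powr_powr) simp
    finally show ?thesis .
  qed
  ultimately have "summable (\<lambda>n. f (int n))"
    by (intro summable_comparison_test[of "\<lambda>n. f (int n)"]) (auto simp: f_def)
  then have n: "(\<lambda>n. f (int n)) summable_on UNIV"
    by (intro norm_summable_imp_summable_on) (simp add: f_def)
  have "f summable_on range int"
    using n by (subst summable_on_reindex) (auto simp: o_def)
  moreover have "f summable_on range (\<lambda>n. - int n)"
    using n by (subst summable_on_reindex) (auto simp: o_def f_def inj_def)
  ultimately have "f summable_on (range int \<union> range (\<lambda>n. - int n))"
    by (rule summable_on_union)
  also have "range int \<union> range (\<lambda>n. - int n) = UNIV"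
    by (auto simp: image_iff) (metis int_cases2)
  finally show ?thesis by (simp add: f_def)
qed

text \<open>The lattice sum is dominated by a product of one-dimensional ones, since
  \<open>1 + |k|\<^sup>2\<close> is at least the geometric mean of the numbers \<open>1 + k\<^sub>i\<^sup>2\<close>.\<close>

lemma summable_wt:
  assumes "r > real CARD('n)"
  shows "(\<lambda>k::int^'n. wt (- r) k) summable_on UNIV"
proof -
  define d where "d = real CARD('n)"
  have d: "d > 0" by (simp add: d_def)
  define p where "p = r / (2 * d)"
  have p: "p > 1 / 2" using assms d by (simp add: p_def d_def field_simps)
  define f where "f m = (1 + (real_of_int m)\<^sup>2) powr - p" for m
  have "(\<lambda>g. \<Prod>i\<in>(UNIV::'n set). f (g i)) summable_on (PiE UNIV (\<lambda>_. UNIV))"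
    using abs_summable_on_prod_PiE[of "UNIV::'n set" "\<lambda>_::'n. UNIV::int set" "\<lambda>_. f"] summable_int_powr[OF p]
    by (simp add: f_def abs_summable_equivalent[symmetric] prod_nonneg)
  moreover have "range (vec_nth :: int^'n \<Rightarrow> 'n \<Rightarrow> int) = UNIV"
    by (rule surjI[of _ vec_lambda]) (simp add: vec_lambda_inverse)
  ultimately have "((\<lambda>g. \<Prod>i\<in>(UNIV::'n set). f (g i)) \<circ> vec_nth) summable_on UNIV"
    by (subst summable_on_reindex[symmetric]) (auto simp: inj_def vec_nth_inject)
  then have s: "(\<lambda>k::int^'n. \<Prod>i\<in>UNIV. f (k $ i)) summable_on UNIV"
    by (simp add: o_def)
  show ?thesis
  proof (rule summable_on_comparison_test[OF s])
    fix k :: "int^'n"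
    show "0 \<le> wt (- r) k" using wt_pos[of "- r" k] by linarith
    let ?q = "1 + (norm (int_vec k))\<^sup>2"
    have "wt (- r) k = ?q powr (- p * d)"
      using d by (simp add: wt_def p_def field_simps)
    also have "\<dots> = (\<Prod>i\<in>(UNIV::'n set). ?q powr (- p))"
      by (simp add: d_def powr_power mult_ac less_imp_neq[OF one_plus_sq_pos, symmetric])
    also have "\<dots> \<le> (\<Prod>i\<in>UNIV. f (k $ i))"
    proof (rule prod_mono, intro conjI)
      fix i :: 'n
      have "\<bar>int_vec k $ i\<bar> \<le> norm (int_vec k)" by (rule component_le_norm_cart)
      then have "(real_of_int (k $ i))\<^sup>2 \<le> (norm (int_vec k))\<^sup>2"
        using power_mono[of "\<bar>int_vec k $ i\<bar>" "norm (int_vec k)" 2] by (simp add: int_vec_def)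
      then show "?q powr (- p) \<le> f (k $ i)"
        unfolding f_def using p by (intro powr_mono2') (auto simp: one_plus_sq_pos)
    qed simp
    finally show "wt (- r) k \<le> (\<Prod>i\<in>UNIV. f (k $ i))" .
  qed
qed

text \<open>Squaring doubles the exponent, so half the dimension becomes the whole dimension. The
  lower bound on \<open>s\<close> acts through this sequence.\<close>

lemma wt_l2:
  assumes "q > real CARD('n) / 2"
  obtains g :: "(int^'n) l2" where "coord g = wt (- q)"
proof -
  have "(wt (- q) k)\<^sup>2 = wt (- (2 * q)) k" for k :: "int^'n"
    unfolding power2_eq_square wt_add[symmetric] by (rule arg_cong[of _ _ "\<lambda>r. wt r k"]) simp
  then have "(\<lambda>k::int^'n. (wt (- q) k)\<^sup>2) summable_on UNIV"
    using summable_wt[of "2 * q", where 'n='n] assms by simp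
  then show ?thesis using that[of "l2_of (wt (- q))"] by (simp add: l2_of_inverse)
qed

section \<open>Multipliers and the quadratic convolution operator\<close>

text \<open>The reflection \<open>y \<mapsto> - y\<close> of the torus, seen on Fourier
  coefficients; even functions correspond to fixed points.\<close>

definition flip :: "'i::ab_group_add l2 \<Rightarrow> 'i l2" where
  "flip x = l2_of (\<lambda>k. coord x (- k))"

lemma bij_minus: "bij (uminus :: 'i::ab_group_add \<Rightarrow> 'i)"
  by (rule bij_betw_byWitness[of _ uminus]) auto

lemma coord_eqI:
  assumes "coord x = f"
  shows "coord (l2_of f) = f"
  using assms by (metis coord_inverse)

lemma coord_flip [simp]: "coord (flip x) k = coord x (- k)"
proof -
  obtain y where "\<And>k. coord y k = coord x (- k)"
    by (rule coord_reindex[OF bij_minus, of x]) blast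
  then have "coord y = (\<lambda>k. coord x (- k))" by auto
  then show ?thesis unfolding flip_def by (simp add: coord_eqI)
qed

lemma norm_flip [simp]: "norm (flip x) = norm x"
proof -
  obtain y where "\<And>k. coord y k = coord x (- k)" "norm y = norm x"
    by (rule coord_reindex[OF bij_minus, of x]) blast
  moreover from this have "y = flip x" by (intro l2_eqI) simp
  ultimately show ?thesis by simp
qed

definition multiplier :: "('i \<Rightarrow> real) \<Rightarrow> 'i l2 \<Rightarrow> 'i l2" where
  "multiplier m x = l2_of (\<lambda>k. m k * coord x k)"

lemma
  assumes "\<And>k. \<bar>m k\<bar> \<le> M"
  shows coord_multiplier: "coord (multiplier m x) k = m k * coord x k"
    and norm_multiplier: "norm (multiplier m x) \<le> M * norm x"
    and bounded_linear_multiplier: "bounded_linear (multiplier m)"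
proof -
  have M: "M \<ge> 0" using assms[of undefined] by linarith
  have "\<bar>m k * coord x k\<bar> \<le> \<bar>coord (M *\<^sub>R x) k\<bar>" for x k
    using mult_right_mono[OF assms[of k], of "\<bar>coord x k\<bar>"] M by (simp add: abs_mult)
  from dominated_l2[OF this]
  have *: "coord (multiplier m x) = (\<lambda>k. m k * coord x k) \<and> norm (multiplier m x) \<le> M * norm x" for x
    unfolding multiplier_def using M by (metis abs_of_nonneg coord_inverse norm_scaleR)
  then show "coord (multiplier m x) k = m k * coord x k" "norm (multiplier m x) \<le> M * norm x"
    by auto
  show "bounded_linear (multiplier m)"
    by (rule bounded_linear_intro[of _ M]) (auto intro!: l2_eqI simp: * algebra_simps)
qed

text \<open>Kernel of the quadratic term in the weighted coordinates \<open>wt r j * v j\<close>,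
  after division by \<open>- (4 * pi\<^sup>2) * (norm (int_vec k))\<^sup>2\<close>. At
  \<open>k = 0\<close> division by zero makes it 0, in accordance with the vanishing mean of a
  divergence.\<close>

definition quad_kernel :: "real \<Rightarrow> (int^'n \<Rightarrow> real) \<Rightarrow> int^'n \<Rightarrow> int^'n \<Rightarrow> real" where
  "quad_kernel r P k j =
     wt r k * (int_vec k \<bullet> int_vec j) / (norm (int_vec k))\<^sup>2 * P j / (wt r j * wt r (k - j))"

text \<open>By Cauchy-Schwarz the quotient of the inner product by the squared length of
  \<open>k\<close> is at most the length of \<open>j\<close> over that of \<open>k\<close>: one
  order of weight moves from \<open>k\<close> to \<open>j\<close>. The remaining
  \<open>wt (r - 1) k\<close> is split by \<open>wt_triangle\<close> and cancels against
  \<open>j\<close> or \<open>k - j\<close>, so that each term keeps a weight on a single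
  factor.\<close>

lemma abs_quad_kernel_le:
  fixes k j :: "int^'n"
  assumes P: "\<And>k. \<bar>P k\<bar> \<le> M" and r: "r \<ge> 1"
  shows "\<bar>quad_kernel r P k j\<bar> \<le> 2 powr r * M * (wt (1 - r) j + wt (1 - r) (k - j))"
proof (cases "k = 0")
  case True
  have "M \<ge> 0" using P[of 0] by linarith
  then show ?thesis using True wt_pos[of "1 - r" j]
    by (simp add: quad_kernel_def mult_nonneg_nonneg add_nonneg_nonneg less_imp_le)
next
  case False
  have M: "M \<ge> 0" using P[of 0] by linarith
  let ?n = "norm (int_vec k)"
  have n: "?n > 0" using False by simp
  have "\<bar>int_vec k \<bullet> int_vec j\<bar> / ?n\<^sup>2 \<le> (?n * norm (int_vec j)) / ?n\<^sup>2"
    by (intro divide_right_mono Cauchy_Schwarz_ineq2) auto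
  also have "\<dots> = norm (int_vec j) / ?n" using n by (simp add: power2_eq_square)
  also have "\<dots> \<le> wt 1 j / ?n" using norm_le_wt_1[of j] n by (intro divide_right_mono) auto
  also have "\<dots> \<le> wt 1 j / (wt 1 k / 2)"
    using wt_1_le[OF False] n wt_pos[of 1 k] wt_pos[of 1 j] by (intro divide_left_mono) auto
  finally have *: "\<bar>int_vec k \<bullet> int_vec j\<bar> / ?n\<^sup>2 \<le> 2 * wt 1 j / wt 1 k" by (simp add: mult.commute)
  have "\<bar>quad_kernel r P k j\<bar> = wt r k * (\<bar>int_vec k \<bullet> int_vec j\<bar> / ?n\<^sup>2) * \<bar>P j\<bar> / (wt r j * wt r (k - j))"
    using wt_pos[of r k] wt_pos[of r j] wt_pos[of r "k - j"] by (simp add: quad_kernel_def abs_mult abs_divide del: wt_pos)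
  also have "\<dots> \<le> wt r k * (2 * wt 1 j / wt 1 k) * M / (wt r j * wt r (k - j))"
    using * P[of j] M wt_pos[of r k] wt_pos[of r j] wt_pos[of r "k - j"] wt_pos[of 1 j] wt_pos[of 1 k]
    by (intro divide_right_mono mult_mono mult_left_mono mult_nonneg_nonneg) (auto simp: less_imp_le)
  also have "\<dots> = 2 * M * (wt (r - 1) k * wt (1 - r) j * wt (- r) (k - j))"
    using wt_add[of "r - 1" 1 k] wt_add[of "1 - r" r j] wt_uminus[of r "k - j"] wt_add[of 1 "- r" j] wt_uminus[of r j]
    by (simp add: field_simps)
  also have "\<dots> \<le> 2 * M * ((2 powr (r - 1) * (wt (r - 1) j + wt (r - 1) (k - j))) * wt (1 - r) j * wt (- r) (k - j))"
    using M r wt_pos[of "1 - r" j] wt_pos[of "- r" "k - j"]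
    by (intro mult_left_mono mult_right_mono wt_triangle) (auto simp: less_imp_le)
  also have "\<dots> = 2 powr r * M * (wt (- r) (k - j) + wt (1 - r) j * wt (- 1) (k - j))"
  proof -
    have "wt (r - 1) j * wt (1 - r) j = 1" using wt_add[of "r - 1" "1 - r" j] by simp
    moreover have "wt (r - 1) (k - j) * wt (- r) (k - j) = wt (- 1) (k - j)"
      using wt_add[of "r - 1" "- r" "k - j"] by simp
    moreover have "2 * 2 powr (r - 1) = 2 powr r" by (simp add: powr_diff)
    moreover have "2 * M * ((p * (a + b)) * c * d) = (2 * p) * M * ((a * c) * d + c * (b * d))" for p a b c d :: real
      by (simp add: algebra_simps)
    ultimately show ?thesis by (simp only: mult_1)
  qed
  \<comment> \<open>The first term is better by one order and the second by a factor
    \<open>wt (- 1)\<close>; both are weakened to a symmetric bound.\<close>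
  also have "\<dots> \<le> 2 powr r * M * (wt (1 - r) j + wt (1 - r) (k - j))"
  proof -
    have "wt (- r) (k - j) \<le> wt (1 - r) (k - j)" by (rule wt_mono) simp
    moreover have "wt (1 - r) j * wt (- 1) (k - j) \<le> wt (1 - r) j"
      using wt_mono[of "- 1" 0 "k - j"] wt_pos[of "1 - r" j] by (intro mult_right_le_one_le) (auto simp: less_imp_le)
    ultimately have "wt (- r) (k - j) + wt (1 - r) j * wt (- 1) (k - j) \<le> wt (1 - r) j + wt (1 - r) (k - j)"
      by linarith
    then show ?thesis using M by (intro mult_left_mono) auto
  qed
  finally show ?thesis .
qed

text \<open>\<open>P\<close> stands for the real Fourier coefficients of \<Phi> and \<open>r\<close>
  for \<open>s + 2\<close>. The bound on \<open>r\<close> is what makes \<open>wt (1 - r)\<close>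
  square summable.\<close>

locale quadratic =
  fixes r :: real and P :: "int^'n \<Rightarrow> real" and M :: real
  assumes P_le: "\<And>k. \<bar>P k\<bar> \<le> M" and P_even: "\<And>k. P (- k) = P k"
    and r: "r > 1 + real CARD('n) / 2"
begin

lemma M_nonneg: "M \<ge> 0"
  using P_le[of 0] by linarith

text \<open>The kernel bound splits the sum into two convolutions. In each, the weight
  \<open>wt (1 - r)\<close> sits on one factor and makes it absolutely summable by Cauchy-Schwarz,
  so \<open>convolution_l1_l2\<close> applies; the two equal estimates give the factor 2 in the
  constant.\<close>

lemma ex_quad:
  "\<exists>z. (\<forall>k. ((\<lambda>j. quad_kernel r P k j * coord x j * coord y (k - j)) has_sum coord z k) UNIV) \<and>
     norm z \<le> (2 powr r * M * 2 * sqrt (\<Sum>\<^sub>\<infinity>k::int^'n. (wt (1 - r) k)\<^sup>2)) * (norm x * norm y)"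
proof -
  define N where "N = sqrt (\<Sum>\<^sub>\<infinity>k::int^'n. (wt (1 - r) k)\<^sup>2)"
  have r1: "r \<ge> 1" using r by (smt (verit) divide_nonneg_nonneg of_nat_0_le_iff)
  obtain g :: "(int^'n) l2" where g: "coord g = wt (1 - r)"
  proof (rule wt_l2[of "r - 1", where 'n='n])
    show "r - 1 > real CARD('n) / 2" using r by simp
  qed (rule that, simp)
  have ng: "norm g = N" by (simp add: norm_l2_infsum g N_def)
  obtain ax where ax: "coord ax = (\<lambda>k. \<bar>coord x k\<bar>)" "norm ax \<le> norm x"
    by (rule dominated_l2[of "\<lambda>k. \<bar>coord x k\<bar>" x]) auto
  obtain ay where ay: "coord ay = (\<lambda>k. \<bar>coord y k\<bar>)" "norm ay \<le> norm y"
    by (rule dominated_l2[of "\<lambda>k. \<bar>coord y k\<bar>" y]) auto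
  obtain z1 where z1: "\<And>k. ((\<lambda>j. (wt (1 - r) j * \<bar>coord x j\<bar>) * \<bar>coord y (k - j)\<bar>) has_sum coord z1 k) UNIV"
    "norm z1 \<le> N * norm x * norm y"
  proof (rule convolution_l1_l2[of "\<lambda>j. coord g j * coord ax j" ay])
    fix z assume z: "\<And>k. ((\<lambda>j. coord g j * coord ax j * coord ay (k - j)) has_sum coord z k) UNIV"
      "norm z \<le> (\<Sum>\<^sub>\<infinity>j. \<bar>coord g j * coord ax j\<bar>) * norm ay"
    have "norm z \<le> (N * norm x) * norm y"
      using z(2) abs_summable_coord_mult(2)[of g ax] ax ay ng
      by (intro order_trans[OF z(2)] mult_mono order_trans[OF abs_summable_coord_mult(2)]) auto
    then show thesis using that[of z] z(1) by (simp add: g ax ay)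
  qed (rule abs_summable_coord_mult)
  obtain z2 where z2: "\<And>k. ((\<lambda>j. (wt (1 - r) j * \<bar>coord y j\<bar>) * \<bar>coord x (k - j)\<bar>) has_sum coord z2 k) UNIV"
    "norm z2 \<le> N * norm x * norm y"
  proof (rule convolution_l1_l2[of "\<lambda>j. coord g j * coord ay j" ax])
    fix z assume z: "\<And>k. ((\<lambda>j. coord g j * coord ay j * coord ax (k - j)) has_sum coord z k) UNIV"
      "norm z \<le> (\<Sum>\<^sub>\<infinity>j. \<bar>coord g j * coord ay j\<bar>) * norm ax"
    have "norm z \<le> (N * norm y) * norm x"
      using z(2) abs_summable_coord_mult(2)[of g ay] ax ay ng
      by (intro order_trans[OF z(2)] mult_mono order_trans[OF abs_summable_coord_mult(2)]) auto
    then show thesis using that[of z] z(1) by (simp add: g ax ay mult_ac)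
  qed (rule abs_summable_coord_mult)
  \<comment> \<open>The second convolution was formed with the roles of \<open>x\<close> and
    \<open>y\<close> exchanged; \<open>j \<mapsto> k - j\<close> brings it to the summation variable
    of the first.\<close>
  have z2': "((\<lambda>j. (wt (1 - r) (k - j) * \<bar>coord y (k - j)\<bar>) * \<bar>coord x j\<bar>) has_sum coord z2 k) UNIV" for k
  proof -
    have "bij (\<lambda>j. k - j)" by (rule bij_betw_byWitness[of _ "\<lambda>j. k - j"]) auto
    from has_sum_reindex_bij_betw[OF this, of "\<lambda>j. (wt (1 - r) j * \<bar>coord y j\<bar>) * \<bar>coord x (k - j)\<bar>"] z2(1)[of k]
    show ?thesis by simp
  qed
  define C where "C = 2 powr r * M"
  have C: "C \<ge> 0" using M_nonneg by (simp add: C_def)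
  define z where "z = C *\<^sub>R (z1 + z2)"
  have sum_z: "((\<lambda>j. C * (wt (1 - r) j + wt (1 - r) (k - j)) * (\<bar>coord x j\<bar> * \<bar>coord y (k - j)\<bar>)) has_sum coord z k) UNIV" for k
    using has_sum_cmult_right[OF has_sum_add[OF z1(1)[of k] z2'[of k]], of C]
    by (simp add: z_def algebra_simps)
  have bound: "norm (quad_kernel r P k j * coord x j * coord y (k - j))
      \<le> C * (wt (1 - r) j + wt (1 - r) (k - j)) * (\<bar>coord x j\<bar> * \<bar>coord y (k - j)\<bar>)" for k j
    using mult_right_mono[OF abs_quad_kernel_le[OF P_le r1, where k=k and j=j], of "\<bar>coord x j\<bar> * \<bar>coord y (k - j)\<bar>"]
    by (simp add: abs_mult C_def mult.assoc)
  have nsum: "(\<lambda>j. norm (quad_kernel r P k j * coord x j * coord y (k - j))) summable_on UNIV" for k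
    by (rule summable_on_comparison_test[OF has_sum_imp_summable[OF sum_z[of k]]], rule bound, rule norm_ge_zero)
  define f where "f k = (\<Sum>\<^sub>\<infinity>j. quad_kernel r P k j * coord x j * coord y (k - j))" for k
  have f: "((\<lambda>j. quad_kernel r P k j * coord x j * coord y (k - j)) has_sum f k) UNIV" for k
    unfolding f_def using abs_summable_summable[OF nsum[of k]] by (rule has_sum_infsum)
  have "\<bar>f k\<bar> \<le> \<bar>coord z k\<bar>" for k
  proof -
    have "norm (f k) \<le> (\<Sum>\<^sub>\<infinity>j. norm (quad_kernel r P k j * coord x j * coord y (k - j)))"
      unfolding f_def by (rule norm_infsum_bound[OF nsum])
    also have "\<dots> \<le> coord z k"
      using infsum_mono[OF nsum[of k] has_sum_imp_summable[OF sum_z[of k]] bound] infsumI[OF sum_z[of k]] by simp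
    finally show ?thesis by simp
  qed
  from dominated_l2[OF this] obtain q where q: "coord q = f" "norm q \<le> norm z" by auto
  have "norm z \<le> C * (norm z1 + norm z2)"
    unfolding z_def using C by (simp add: mult_left_mono norm_triangle_ineq)
  also have "\<dots> \<le> C * (N * norm x * norm y + N * norm x * norm y)"
    using C z1(2) z2(2) by (intro mult_left_mono add_mono)
  also have "\<dots> = (2 powr r * M * 2 * N) * (norm x * norm y)" by (simp add: C_def algebra_simps)
  finally show ?thesis using q f N_def by (intro exI[of _ q]) auto
qed

definition quad :: "(int^'n) l2 \<Rightarrow> (int^'n) l2 \<Rightarrow> (int^'n) l2" where
  "quad x y = (SOME z. (\<forall>k. ((\<lambda>j. quad_kernel r P k j * coord x j * coord y (k - j)) has_sum coord z k) UNIV) \<and>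
     norm z \<le> (2 powr r * M * 2 * sqrt (\<Sum>\<^sub>\<infinity>k::int^'n. (wt (1 - r) k)\<^sup>2)) * (norm x * norm y))"

lemma has_sum_quad: "((\<lambda>j. quad_kernel r P k j * coord x j * coord y (k - j)) has_sum coord (quad x y) k) UNIV"
  and norm_quad: "norm (quad x y) \<le> (2 powr r * M * 2 * sqrt (\<Sum>\<^sub>\<infinity>k::int^'n. (wt (1 - r) k)\<^sup>2)) * (norm x * norm y)"
  using someI_ex[OF ex_quad[of x y]] unfolding quad_def[symmetric] by auto

lemma quad_eqI:
  assumes "\<And>k. ((\<lambda>j. quad_kernel r P k j * coord x j * coord y (k - j)) has_sum coord z k) UNIV"
  shows "quad x y = z"
  using has_sum_unique[OF has_sum_quad assms] by (rule l2_eqI)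

lemma bounded_bilinear_quad: "bounded_bilinear quad"
proof
  fix x x' y y' :: "(int^'n) l2" and c :: real
  show "quad (x + x') y = quad x y + quad x' y"
    using has_sum_add[OF has_sum_quad[of _ x y] has_sum_quad[of _ x' y]]
    by (intro quad_eqI) (simp add: algebra_simps)
  show "quad x (y + y') = quad x y + quad x y'"
    using has_sum_add[OF has_sum_quad[of _ x y] has_sum_quad[of _ x y']]
    by (intro quad_eqI) (simp add: algebra_simps)
  show "quad (c *\<^sub>R x) y = c *\<^sub>R quad x y"
    using has_sum_cmult_right[OF has_sum_quad[of _ x y], of c]
    by (intro quad_eqI) (simp add: algebra_simps)
  show "quad x (c *\<^sub>R y) = c *\<^sub>R quad x y"
    using has_sum_cmult_right[OF has_sum_quad[of _ x y], of c]
    by (intro quad_eqI) (simp add: algebra_simps)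
  show "\<exists>K. \<forall>a b. norm (quad a b) \<le> norm a * norm b * K"
    using norm_quad by (metis mult.commute)
qed

lemma coord_quad_0 [simp]: "coord (quad x y) 0 = 0"
  using has_sum_unique[OF has_sum_quad[of 0 x y], of 0] by (simp add: quad_kernel_def)

text \<open>The kernel is unchanged when both indices change sign, because \<open>P\<close> is
  even.\<close>

lemma flip_quad: "flip (quad x y) = quad (flip x) (flip y)"
proof (rule quad_eqI[symmetric])
  fix k
  have "quad_kernel r P k j = quad_kernel r P (- k) (- j)" for j
  proof -
    have "- k + j = - (k - j)" by simp
    then have "wt r (- k + j) = wt r (k - j)" by (simp only: wt_minus)
    then show ?thesis by (simp add: quad_kernel_def P_even)
  qed
  then show "((\<lambda>j. quad_kernel r P k j * coord (flip x) j * coord (flip y) (k - j)) has_sum coord (flip (quad x y)) k) UNIV"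
    using has_sum_reindex_bij_betw[OF bij_minus, of "\<lambda>j. quad_kernel r P (- k) j * coord x j * coord y (- k - j)"]
      has_sum_quad[of "- k" x y] by simp
qed

end

section \<open>Integration of periodic functions\<close>

text \<open>The unit cube as a measure of total mass 1: integrals over the torus become Bochner
  integrals over a finite measure space, without set restrictions.\<close>

definition cell :: "(real^'n) measure" where
  "cell = density lborel (indicator (cbox 0 1))"

lemma sets_cell [measurable_cong, simp]: "sets cell = sets borel"
  and space_cell [simp]: "space cell = UNIV"
  by (simp_all add: cell_def)

lemma borel_measurable_cell [simp]: "borel_measurable cell = borel_measurable borel"
  by (rule measurable_cong_sets) auto

lemma emeasure_cell_UNIV: "emeasure (cell :: (real^'n) measure) UNIV = 1"
proof -
  have "(1::real^'n) \<bullet> b = 1" if "b \<in> Basis" for b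
    using that by (auto simp: Basis_vec_def inner_axis)
  then show ?thesis
    by (simp add: cell_def emeasure_density emeasure_lborel_cbox_eq)
qed

lemma
  fixes f :: "real^'n \<Rightarrow> 'b::{banach, second_countable_topology}"
  assumes [measurable]: "f \<in> borel_measurable borel"
  shows set_integrable_cbox_eq: "set_integrable lborel (cbox 0 1) f = integrable cell f"
    and set_integral_cbox_eq: "(LINT y:cbox 0 1|lborel. f y) = integral\<^sup>L cell f"
proof -
  have c: "cell = density lborel (\<lambda>y. ennreal (indicator (cbox 0 1) y))"
    by (simp add: cell_def ennreal_indicator)
  show "set_integrable lborel (cbox 0 1) f = integrable cell f"
    unfolding c set_integrable_def by (subst integrable_density) auto
  show "(LINT y:cbox 0 1|lborel. f y) = integral\<^sup>L cell f"
    unfolding c set_lebesgue_integral_def by (subst integral_density) auto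
qed

lemma AE_cell_iff: "(AE y in cell. R y) \<longleftrightarrow> (AE y in lborel. y \<in> cbox 0 1 \<longrightarrow> R y)"
  unfolding cell_def by (subst AE_density) (auto simp: indicator_def)

lemma finite_measure_cell: "finite_measure (cell :: (real^'n) measure)"
  by (rule finite_measureI) (simp add: emeasure_cell_UNIV)

interpretation cell: finite_measure "cell :: (real^'n) measure"
  by (rule finite_measure_cell)

lemma measure_cell_UNIV [simp]: "measure (cell :: (real^'n) measure) UNIV = 1"
  by (simp add: measure_def emeasure_cell_UNIV)

lemma integrable_cell_bounded:
  fixes f :: "real^'n \<Rightarrow> 'b::{banach, second_countable_topology}"
  assumes "f \<in> borel_measurable borel" "\<And>y. norm (f y) \<le> B"
  shows "integrable cell f"
  using assms by (intro cell.integrable_const_bound[of _ B]) auto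

lemma integrable_cell_bounded_mult:
  fixes f g :: "real^'n \<Rightarrow> 'b::{banach, second_countable_topology, real_normed_algebra}"
  assumes "f \<in> borel_measurable borel" "\<And>y. norm (f y) \<le> B" "integrable cell g"
  shows "integrable cell (\<lambda>y. f y * g y)"
proof (rule Bochner_Integration.integrable_bound[of cell "\<lambda>y. B *\<^sub>R norm (g y)"])
  show "(\<lambda>y. f y * g y) \<in> borel_measurable cell"
    using assms borel_measurable_integrable[OF assms(3)] by simp
  show "AE y in cell. norm (f y * g y) \<le> norm (B *\<^sub>R norm (g y))"
  proof (rule AE_I2)
    fix y
    have "norm (f y * g y) \<le> norm (f y) * norm (g y)" by (rule norm_mult_ineq)
    also have "\<dots> \<le> \<bar>B\<bar> * norm (g y)"
      using assms(2)[of y] by (intro mult_right_mono) auto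
    finally show "norm (f y * g y) \<le> norm (B *\<^sub>R norm (g y))" by (simp add: abs_mult)
  qed
qed (use assms(3) in auto)

section \<open>The tiling of space by integer translates, and invariance of the integral\<close>

definition half_open_cell :: "(real^'n) set" where
  "half_open_cell = {y. \<forall>i. 0 \<le> y $ i \<and> y $ i < 1}"

definition floor_vec :: "real^'n \<Rightarrow> int^'n" where
  "floor_vec y = (\<chi> i. \<lfloor>y $ i\<rfloor>)"

lemma half_open_cell_measurable [measurable]: "half_open_cell \<in> sets (borel :: (real^'n) measure)"
  unfolding half_open_cell_def by measurable

lemma diff_int_vec_in_half_open_cell: "y - int_vec k \<in> half_open_cell \<longleftrightarrow> k = floor_vec y"
proof -
  have "(0 \<le> y $ i - of_int (k $ i) \<and> y $ i - of_int (k $ i) < 1) \<longleftrightarrow> k $ i = \<lfloor>y $ i\<rfloor>" for i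
    by linarith
  then show ?thesis
    by (simp add: half_open_cell_def int_vec_def floor_vec_def vec_eq_iff)
qed

lemma AE_frontier_cell: "AE y in lborel. y \<notin> cbox 0 1 - box 0 (1::real^'n)"
proof -
  have "AE y in lebesgue. y \<notin> cbox 0 1 - box 0 (1::real^'n)"
    using negligible_frontier_interval[of 0 "1::real^'n"]
    by (intro AE_not_in) (simp add: negligible_iff_null_sets)
  then show ?thesis by (subst (asm) AE_completion_iff) auto
qed

lemma cell_half_open: "cell = density lborel (indicator half_open_cell)"
  unfolding cell_def
proof (rule density_cong)
  have sub: "half_open_cell \<subseteq> cbox 0 (1::real^'n)" and sup: "box 0 (1::real^'n) \<subseteq> half_open_cell"
    by (auto simp: half_open_cell_def mem_box_cart less_imp_le)
  show "AE y in lborel. indicator (cbox 0 (1::real^'n)) y = (indicator half_open_cell y :: ennreal)"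
    using AE_frontier_cell by eventually_elim (use sub sup in \<open>auto simp: indicator_def\<close>)
qed auto

text \<open>Exactly one integer translate of the half-open cell contains \<open>y\<close>. The
  lattice sum is written as an integral over a counting measure so that it can be exchanged with the
  integral over space.\<close>

lemma nn_integral_count_floor:
  "(\<integral>\<^sup>+k. indicator half_open_cell (y - int_vec k) \<partial>count_space UNIV) = 1"
proof -
  have "(\<lambda>k. indicator half_open_cell (y - int_vec k) :: ennreal) = indicator {floor_vec y}"
    by (auto simp: fun_eq_iff indicator_def diff_int_vec_in_half_open_cell)
  then show ?thesis by simp
qed

lemma nn_integral_lborel_translate:
  assumes [measurable]: "f \<in> borel_measurable borel"
  shows "(\<integral>\<^sup>+y. f (y + a :: real^'n) \<partial>lborel) = (\<integral>\<^sup>+y. f y \<partial>lborel)"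
proof -
  have "(\<integral>\<^sup>+y. f y \<partial>lborel) = (\<integral>\<^sup>+y. f y \<partial>distr lborel borel ((+) a))"
    by (simp only: lborel_distr_plus)
  also have "\<dots> = (\<integral>\<^sup>+y. f (a + y) \<partial>lborel)"
    by (rule nn_integral_distr) auto
  finally show ?thesis by (simp add: add.commute)
qed

lemma nn_integral_lborel_reflect:
  assumes [measurable]: "f \<in> borel_measurable borel"
  shows "(\<integral>\<^sup>+y. f (a - y :: real^'n) \<partial>lborel) = (\<integral>\<^sup>+y. f y \<partial>lborel)"
proof -
  have "(\<integral>\<^sup>+y. f y \<partial>lborel) = (\<integral>\<^sup>+y. f y \<partial>distr lborel borel (\<lambda>y. a - y))"
    by (simp only: distr_lborel_diff_left)
  also have "\<dots> = (\<integral>\<^sup>+y. f (a - y) \<partial>lborel)"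
    by (rule nn_integral_distr) auto
  finally show ?thesis by simp
qed

lemma periodic_diff: "periodic F \<Longrightarrow> F (y - int_vec k) = F y"
  unfolding periodic_def by (metis diff_add_cancel)

text \<open>Both sides are cut along the tiling of the space by the integer translates of the cell.\<close>

lemma nn_integral_half_open_reflect:
  assumes [measurable]: "F \<in> borel_measurable (borel :: (real^'n) measure)" and F: "periodic F"
  shows "(\<integral>\<^sup>+y. indicator half_open_cell y * F (z - y) \<partial>lborel)
       = (\<integral>\<^sup>+y. indicator half_open_cell y * F y \<partial>lborel)"
proof -
  let ?Q = "indicator half_open_cell :: real^'n \<Rightarrow> ennreal"
  have "(\<integral>\<^sup>+y. ?Q y * F (z - y) \<partial>lborel) = (\<integral>\<^sup>+y. ?Q (z - y) * F y \<partial>lborel)"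
    using nn_integral_lborel_reflect[of "\<lambda>y. ?Q (z - y) * F y" z] by simp
  also have "\<dots> = (\<integral>\<^sup>+y. (\<integral>\<^sup>+k. ?Q (y - int_vec k) * (?Q (z - y) * F y) \<partial>count_space UNIV) \<partial>lborel)"
    by (simp add: nn_integral_multc nn_integral_count_floor)
  also have "\<dots> = (\<integral>\<^sup>+k. (\<integral>\<^sup>+y. ?Q (y - int_vec k) * (?Q (z - y) * F y) \<partial>lborel) \<partial>count_space UNIV)"
    by (rule nn_integral_count_space_nn_integral) auto
  also have "\<dots> = (\<integral>\<^sup>+k. (\<integral>\<^sup>+y. ?Q y * (?Q (z - y - int_vec k) * F y) \<partial>lborel) \<partial>count_space UNIV)"
  proof (rule nn_integral_cong)
    fix k :: "int^'n"
    have "(\<integral>\<^sup>+y. ?Q (y - int_vec k) * (?Q (z - y) * F y) \<partial>lborel)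
        = (\<integral>\<^sup>+y. ?Q (y + int_vec k - int_vec k) * (?Q (z - (y + int_vec k)) * F (y + int_vec k)) \<partial>lborel)"
      by (rule nn_integral_lborel_translate[symmetric]) auto
    also have "\<dots> = (\<integral>\<^sup>+y. ?Q y * (?Q (z - y - int_vec k) * F y) \<partial>lborel)"
      using F by (simp add: periodic_def diff_diff_eq)
    finally show "(\<integral>\<^sup>+y. ?Q (y - int_vec k) * (?Q (z - y) * F y) \<partial>lborel)
        = (\<integral>\<^sup>+y. ?Q y * (?Q (z - y - int_vec k) * F y) \<partial>lborel)" .
  qed
  also have "\<dots> = (\<integral>\<^sup>+y. (\<integral>\<^sup>+k. ?Q y * (?Q (z - y - int_vec k) * F y) \<partial>count_space UNIV) \<partial>lborel)"
    by (rule nn_integral_count_space_nn_integral[symmetric]) auto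
  also have "\<dots> = (\<integral>\<^sup>+y. ?Q y * F y \<partial>lborel)"
    by (simp add: nn_integral_multc nn_integral_cmult nn_integral_count_floor)
  finally show ?thesis .
qed

text \<open>The representative modulo the lattice that lies in the half-open cell. It turns
  reflections of the torus into measurable maps of the cell to itself.\<close>

definition wrap :: "real^'n \<Rightarrow> real^'n" where
  "wrap y = y - int_vec (floor_vec y)"

lemma wrap_measurable [measurable]: "(wrap :: real^'n \<Rightarrow> _) \<in> borel_measurable borel"
proof -
  have "(\<lambda>y::real^'n. \<chi> i. y $ i - of_int \<lfloor>y $ i\<rfloor>) \<in> borel_measurable borel"
    by (subst borel_measurable_euclidean_space) (auto simp: Basis_vec_def inner_axis)
  moreover have "(\<lambda>y::real^'n. \<chi> i. y $ i - of_int \<lfloor>y $ i\<rfloor>) = wrap"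
    by (simp add: fun_eq_iff wrap_def int_vec_def floor_vec_def vec_eq_iff)
  ultimately show ?thesis by simp
qed

lemma periodic_wrap: "periodic F \<Longrightarrow> F (wrap y) = F y"
  unfolding wrap_def by (rule periodic_diff)

lemma wrap_add: "wrap (y + int_vec k) = wrap y"
  by (simp add: wrap_def floor_vec_def int_vec_def vec_eq_iff)

lemma wrap_half_open: "y \<in> half_open_cell \<Longrightarrow> wrap y = y"
proof -
  assume "y \<in> half_open_cell"
  then have "floor_vec y = 0"
    using diff_int_vec_in_half_open_cell[of y 0] by simp
  then show ?thesis by (simp add: wrap_def)
qed

text \<open>Invariance is stated for the measure, so that it yields both integrability and integrals
  for Banach-valued functions at once.\<close>

lemma distr_cell_reflect: "distr cell cell (\<lambda>y. wrap (z - y)) = (cell :: (real^'n) measure)"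
proof (rule measure_eqI)
  fix A assume "A \<in> sets (distr cell cell (\<lambda>y. wrap (z - y :: real^'n)))"
  then have [measurable]: "A \<in> sets borel" by simp
  have m: "(\<lambda>y::real^'n. wrap (z - y)) \<in> measurable cell cell" by measurable
  have "emeasure (distr cell cell (\<lambda>y. wrap (z - y))) A = emeasure cell ((\<lambda>y. wrap (z - y)) -` A)"
    using m by (simp add: emeasure_distr)
  also have "\<dots> = (\<integral>\<^sup>+y. indicator half_open_cell y * indicator A (wrap (z - y)) \<partial>lborel)"
    unfolding cell_half_open using measurable_sets[OF m, of A]
    by (subst emeasure_density) (auto intro!: nn_integral_cong simp: indicator_def)
  also have "\<dots> = (\<integral>\<^sup>+y. indicator half_open_cell y * indicator A (wrap y) \<partial>lborel)"
    by (rule nn_integral_half_open_reflect[of "\<lambda>y. indicator A (wrap y)"])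
      (auto simp: periodic_def wrap_add)
  also have "\<dots> = (\<integral>\<^sup>+y. indicator half_open_cell y * indicator A y \<partial>lborel)"
    by (rule nn_integral_cong) (simp add: indicator_def wrap_half_open)
  also have "\<dots> = emeasure cell A"
    unfolding cell_half_open by (subst emeasure_density) auto
  finally show "emeasure (distr cell cell (\<lambda>y. wrap (z - y))) A = emeasure cell A" .
qed simp

lemma
  fixes F :: "real^'n \<Rightarrow> 'b::{banach, second_countable_topology}"
  assumes [measurable]: "F \<in> borel_measurable borel" and F: "periodic F"
  shows integral_cell_reflect: "(LINT y|cell. F (z - y)) = (LINT y|cell. F y)"
    and integrable_cell_reflect: "integrable cell (\<lambda>y. F (z - y)) \<longleftrightarrow> integrable cell F"
proof -
  have eq: "F (z - y) = F (wrap (z - y))" for y using periodic_wrap[OF F] by simp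
  have m: "(\<lambda>y::real^'n. wrap (z - y)) \<in> measurable cell cell" by measurable
  have "(LINT y|cell. F (z - y)) = (LINT y|distr cell cell (\<lambda>y. wrap (z - y)). F y)"
    unfolding eq by (rule integral_distr[symmetric]) (auto intro: m)
  then show "(LINT y|cell. F (z - y)) = (LINT y|cell. F y)"
    by (simp only: distr_cell_reflect)
  have "integrable cell (\<lambda>y. F (z - y)) \<longleftrightarrow> integrable (distr cell cell (\<lambda>y. wrap (z - y))) F"
    unfolding eq by (rule integrable_distr_eq[symmetric]) (auto intro: m)
  then show "integrable cell (\<lambda>y. F (z - y)) \<longleftrightarrow> integrable cell F"
    by (simp only: distr_cell_reflect)
qed

lemma periodic_uminus: "periodic F \<Longrightarrow> periodic (\<lambda>y. F (- y))"
  unfolding periodic_def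
proof (intro allI)
  fix y k assume F: "\<forall>y k. F (y + int_vec k) = F y"
  have "F (- y + int_vec (- k)) = F (- y)" using F by blast
  then show "F (- (y + int_vec k)) = F (- y)" by simp
qed

text \<open>A translation is the composition of two reflections.\<close>

lemma integral_cell_translate:
  fixes F :: "real^'n \<Rightarrow> 'b::{banach, second_countable_topology}"
  assumes [measurable]: "F \<in> borel_measurable borel" and F: "periodic F"
  shows "(LINT y|cell. F (y + z)) = (LINT y|cell. F y)"
proof -
  have "(LINT y|cell. F (- (- z - y))) = (LINT y|cell. F (- y))"
    by (rule integral_cell_reflect) (auto intro: periodic_uminus F)
  also have "\<dots> = (LINT y|cell. F y)"
    using integral_cell_reflect[of F 0] F by simp
  finally show ?thesis by (simp add: add.commute)
qed

section \<open>Characters of the torus\<close>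

definition chr :: "int^'n \<Rightarrow> real^'n \<Rightarrow> complex" where
  "chr k y = cis (2 * pi * (int_vec k \<bullet> y))"

lemma exp_eq_cnj_chr: "exp (- (2 * of_real pi * \<i> * of_real (int_vec k \<bullet> y))) = cnj (chr k y)"
  unfolding chr_def cis_cnj by (simp add: cis_conv_exp mult_ac)

lemma chr_simps [simp]: "chr 0 y = 1" "norm (chr k y) = 1" "chr (- k) y = cnj (chr k y)" "chr k 0 = 1"
  by (simp_all add: chr_def cis_cnj)

lemma chr_add_index: "chr (j + k) y = chr j y * chr k y"
  by (simp add: chr_def cis_mult inner_add_left distrib_left)

lemma chr_diff_index: "chr (j - k) y = chr j y * cnj (chr k y)"
  using chr_add_index[of j "- k" y] by simp

lemma chr_add: "chr k (y + z) = chr k y * chr k z"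
  by (simp add: chr_def cis_mult inner_add_right distrib_left)

lemma chr_minus: "chr k (- z) = cnj (chr k z)"
  by (simp add: chr_def cis_cnj)

lemma chr_diff: "chr k (y - z) = chr k y * cnj (chr k z)"
  using chr_add[of k y "- z"] by (simp add: chr_minus)

lemma chr_int_vec [simp]: "chr k (int_vec m) = 1"
proof -
  have "int_vec k \<bullet> int_vec m = real_of_int (\<Sum>i\<in>UNIV. k $ i * m $ i)"
    by (simp add: int_vec_def inner_vec_def)
  then show ?thesis unfolding chr_def by (metis Ints_of_int cis_multiple_2pi)
qed

lemma periodic_chr: "periodic (chr k)"
  by (simp add: periodic_def chr_add)

lemma continuous_on_chr [continuous_intros]: "continuous_on A (chr k)"
  unfolding chr_def cis_conv_exp by (intro continuous_intros)

lemma borel_measurable_chr [measurable]: "chr k \<in> borel_measurable borel"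
  by (rule borel_measurable_continuous_onI) (rule continuous_on_chr)

text \<open>For \<open>k \<noteq> 0\<close> a shift by half a period, in a coordinate in which
  \<open>k\<close> does not vanish, changes the sign of the character but not its integral.\<close>

lemma integral_chr:
  fixes k :: "int^'n"
  shows "(LINT y|cell. chr k y) = (if k = 0 then 1 else 0)"
proof (cases "k = 0")
  case False
  then obtain i where i: "k $ i \<noteq> 0" by (auto simp: vec_eq_iff)
  define z :: "real^'n" where "z = axis i (1 / (2 * of_int (k $ i)))"
  have "2 * pi * (int_vec k \<bullet> z) = pi"
    using i by (simp add: z_def inner_axis int_vec_def)
  then have "chr k z = - 1" by (simp only: chr_def cis_pi)
  then have "(LINT y|cell. chr k y) = - (LINT y|cell. chr k y)"
    using integral_cell_translate[OF borel_measurable_chr periodic_chr, of k z] by (simp add: chr_add)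
  then show ?thesis using False by (simp add: eq_neg_iff_add_eq_0)
qed simp

lemma integrable_mult_chr:
  assumes "integrable cell f"
  shows "integrable cell (\<lambda>y. f y * chr k y)" "integrable cell (\<lambda>y. chr k y * f y)"
  using integrable_cell_bounded_mult[of "chr k" 1 f] assms by (simp_all add: mult.commute)

section \<open>Uniqueness of Fourier coefficients\<close>

inductive trig_poly :: "(real^'n \<Rightarrow> complex) \<Rightarrow> bool" where
  chr: "trig_poly (\<lambda>y. c * chr k y)"
| add: "trig_poly f \<Longrightarrow> trig_poly g \<Longrightarrow> trig_poly (\<lambda>y. f y + g y)"

lemma trig_poly_sum: "finite A \<Longrightarrow> (\<And>i. i \<in> A \<Longrightarrow> trig_poly (f i)) \<Longrightarrow> trig_poly (\<lambda>y. \<Sum>i\<in>A. f i y)"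
proof (induction rule: finite_induct)
  case empty
  show ?case using chr[of 0 0] by simp
qed (simp add: trig_poly.add)

lemma trig_poly_mult_chr: "trig_poly g \<Longrightarrow> trig_poly (\<lambda>y. c * chr k y * g y)"
proof (induction rule: trig_poly.induct)
  case (chr d l)
  show ?case using trig_poly.chr[of "c * d" "k + l"] by (simp add: chr_add_index mult_ac)
next
  case (add f g)
  then show ?case using trig_poly.add[OF add.IH] by (simp add: distrib_left)
qed

lemma trig_poly_mult: "trig_poly f \<Longrightarrow> trig_poly g \<Longrightarrow> trig_poly (\<lambda>y. f y * g y)"
proof (induction rule: trig_poly.induct)
  case (chr c k)
  then show ?case by (rule trig_poly_mult_chr)
next
  case (add f h)
  then show ?case using trig_poly.add[of "\<lambda>y. f y * g y" "\<lambda>y. h y * g y"] by (simp add: distrib_right)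
qed

text \<open>The torus as a product of circles: real polynomials in the coordinates restrict to
  trigonometric polynomials, which makes Stone-Weierstrass applicable.\<close>

definition torus_emb :: "real^'n \<Rightarrow> complex^'n" where
  "torus_emb y = (\<chi> i. cis (2 * pi * y $ i))"

lemma continuous_on_torus_emb: "continuous_on A torus_emb"
  unfolding torus_emb_def cis_conv_exp by (intro continuous_intros)

lemma trig_poly_coordinate:
  fixes b :: "complex^'n"
  assumes "b \<in> Basis"
  shows "trig_poly (\<lambda>y. of_real (torus_emb y \<bullet> b))"
proof -
  obtain i u where b: "b = axis i u" "u = 1 \<or> u = \<i>"
    using assms by (auto simp: Basis_vec_def Basis_complex_def)
  define k :: "int^'n" where "k = axis i 1"
  have "int_vec k = axis i (1::real)" by (simp add: k_def int_vec_def axis_def vec_eq_iff)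
  then have c: "chr k y = torus_emb y $ i" for y
    by (simp add: chr_def torus_emb_def inner_axis' )
  show ?thesis using b(2)
  proof
    assume u: "u = 1"
    have "of_real (torus_emb y \<bullet> b) = (1/2) * chr k y + (1/2) * chr (- k) y" for y
      unfolding b u inner_axis chr_simps c by (simp add: complex_eq_iff)
    then show ?thesis using trig_poly.add[OF trig_poly.chr[of "1/2" k] trig_poly.chr[of "1/2" "- k"]] by simp
  next
    assume u: "u = \<i>"
    have "of_real (torus_emb y \<bullet> b) = (- \<i> / 2) * chr k y + (\<i> / 2) * chr (- k) y" for y
      unfolding b u inner_axis chr_simps c by (simp add: complex_eq_iff)
    then show ?thesis using trig_poly.add[OF trig_poly.chr[of "- \<i> / 2" k] trig_poly.chr[of "\<i> / 2" "- k"]] by simp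
  qed
qed

lemma trig_poly_polynomial:
  fixes p :: "complex^'n \<Rightarrow> real"
  assumes "real_polynomial_function p"
  shows "trig_poly (\<lambda>y. of_real (p (torus_emb y)))"
  using assms
proof (induction rule: real_polynomial_function.induct)
  case (linear f)
  have "of_real (f (torus_emb y)) = (\<Sum>b\<in>Basis. of_real (f b) * chr 0 y * of_real (torus_emb y \<bullet> b))" for y :: "real^'n"
  proof -
    have "f (torus_emb y) = f (\<Sum>b\<in>Basis. (torus_emb y \<bullet> b) *\<^sub>R b)"
      by (simp only: euclidean_representation)
    also have "\<dots> = (\<Sum>b\<in>Basis. (torus_emb y \<bullet> b) * f b)"
      using linear by (simp add: bounded_linear.linear linear_sum linear_cmul)
    finally show ?thesis by (simp add: mult_ac)
  qed
  moreover have "trig_poly (\<lambda>y::real^'n. \<Sum>b\<in>Basis. of_real (f b) * chr 0 y * of_real (torus_emb y \<bullet> b))"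
    by (intro trig_poly_sum trig_poly_mult_chr trig_poly_coordinate) auto
  ultimately show ?case by simp
next
  case (const c)
  show ?case using trig_poly.chr[of "of_real c" 0] by simp
next
  case (add f g)
  then show ?case using trig_poly.add by force
next
  case (mult f g)
  then show ?case using trig_poly_mult by force
qed

text \<open>The hypotheses are deliberately asymmetric: \<open>a\<close> may be an end point while
  \<open>b\<close> is interior, so no boundary point of the closed cell is identified with an
  interior one.\<close>

lemma cis_2pi_eq:
  assumes "cis (2 * pi * a) = cis (2 * pi * b)" "0 \<le> a" "a \<le> 1" "0 < b" "b < 1"
  shows "a = b"
proof -
  have "cis (2 * pi * (a - b)) = 1"
    using assms(1) by (simp add: right_diff_distrib flip: cis_divide)
  then have "cos (2 * pi * (a - b)) = 1" by (simp add: complex_eq_iff)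
  then obtain n :: int where "2 * pi * (a - b) = of_int n * 2 * pi"
    using cos_one_2pi_int by blast
  then have n: "a - b = of_int n" by simp
  then have "\<bar>of_int n :: real\<bar> < 1" using assms by linarith
  then have "n = 0" by linarith
  with n show ?thesis by simp
qed

text \<open>The integral of \<open>f\<close> against a test function is shown to vanish for growing
  classes: trigonometric polynomials, continuous functions of \<open>torus_emb\<close>, indicators
  of compact sets inside the open cell, of closed sets, and finally of Borel sets, where vanishing
  forces \<open>f\<close> to be zero almost everywhere.\<close>

context
  fixes f :: "real^'n \<Rightarrow> real"
  assumes f: "integrable cell f" and f0: "\<And>k. (LINT y|cell. of_real (f y) * chr k y) = 0"
begin

lemma f_meas [measurable]: "f \<in> borel_measurable borel"
  using borel_measurable_integrable[OF f] by simp

lemma integral_trig_poly_0: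
  assumes "trig_poly p"
  shows "integrable cell (\<lambda>y. of_real (f y) * p y) \<and> (LINT y|cell. of_real (f y) * p y) = 0"
  using assms
proof (induction rule: trig_poly.induct)
  case (chr c k)
  have i: "integrable cell (\<lambda>y. of_real (f y) * chr k y)"
    by (rule integrable_mult_chr) (use f in auto)
  have "(\<lambda>y. of_real (f y) * (c * chr k y)) = (\<lambda>y. c * (of_real (f y) * chr k y))" by (auto simp: mult_ac)
  then show ?case using i f0[of k] by simp
next
  case (add g h)
  then show ?case by (simp add: distrib_left)
qed

text \<open>Uniform approximation on the compact product of circles by polynomials costs at most
  \<open>e\<close> times the L1 norm of \<open>f\<close>.\<close>

lemma integral_continuous_torus_0:
  fixes G :: "complex^'n \<Rightarrow> real"
  assumes G: "continuous_on UNIV G"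
  shows "(LINT y|cell. f y * G (torus_emb y)) = 0"
proof -
  define T where "T = {z::complex^'n. \<forall>i. norm (z $ i) = 1}"
  have "T = (\<Inter>i. {z. norm (z $ i) = 1})" by (auto simp: T_def)
  then have cl: "closed T"
    by (simp add: closed_INT closed_Collect_eq continuous_intros)
  have "norm z \<le> sqrt (real CARD('n))" if "z \<in> T" for z
    using that by (simp add: T_def norm_vec_def L2_set_def)
  then have "bounded T" by (auto simp: bounded_iff)
  with cl have T: "compact T" by (simp add: compact_eq_bounded_closed)
  have ET: "torus_emb y \<in> T" for y :: "real^'n" by (simp add: T_def torus_emb_def)
  have Em: "torus_emb \<in> borel_measurable (borel :: (real^'n) measure)"
    by (rule borel_measurable_continuous_onI) (rule continuous_on_torus_emb)
  have Gm: "(\<lambda>y::real^'n. G (torus_emb y)) \<in> borel_measurable borel"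
    by (rule measurable_compose[OF Em borel_measurable_continuous_onI[OF G]])
  define I where "I = (LINT y|cell. \<bar>f y\<bar>)"
  have I0: "I \<ge> 0" by (simp add: I_def)
  have H: "\<bar>LINT y|cell. f y * G (torus_emb y)\<bar> \<le> e * I" if e: "e > 0" for e
  proof -
    obtain p where p: "real_polynomial_function p" "\<And>z. z \<in> T \<Longrightarrow> \<bar>G z - p z\<bar> < e"
      using Stone_Weierstrass_real_polynomial_function[OF T continuous_on_subset[OF G] e] by auto
    have tp: "trig_poly (\<lambda>y::real^'n. of_real (p (torus_emb y)))" by (rule trig_poly_polynomial[OF p(1)])
    have ip: "integrable cell (\<lambda>y. f y * p (torus_emb y))"
      using integrable_Re[OF conjunct1[OF integral_trig_poly_0[OF tp]]] by simp
    have p0: "(LINT y|cell. f y * p (torus_emb y)) = 0"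
      using integral_trig_poly_0[OF tp] by (simp flip: of_real_mult)
    have pm: "(\<lambda>y::real^'n. p (torus_emb y)) \<in> borel_measurable borel"
      using p(1) continuous_on_polymonial_function[of p UNIV]
      by (intro measurable_compose[OF Em] borel_measurable_continuous_onI) (simp add: real_polynomial_function_eq)
    have id: "integrable cell (\<lambda>y. (G (torus_emb y) - p (torus_emb y)) * f y)"
      using p(2)[OF ET] Gm pm by (intro integrable_cell_bounded_mult[where B=e] f) (auto intro: less_imp_le)
    have "(LINT y|cell. f y * G (torus_emb y))
        = (LINT y|cell. (G (torus_emb y) - p (torus_emb y)) * f y + f y * p (torus_emb y))"
      by (rule Bochner_Integration.integral_cong) (auto simp: algebra_simps)
    also have "\<dots> = (LINT y|cell. (G (torus_emb y) - p (torus_emb y)) * f y)"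
      using id ip p0 by simp
    also have "\<bar>\<dots>\<bar> \<le> (LINT y|cell. e * \<bar>f y\<bar>)"
    proof (rule order_trans[OF integral_abs_bound], rule integral_mono)
      show "\<bar>(G (torus_emb y) - p (torus_emb y)) * f y\<bar> \<le> e * \<bar>f y\<bar>" for y
        using p(2)[OF ET, of y] by (simp add: abs_mult mult_right_mono)
      show "integrable cell (\<lambda>y. \<bar>(G (torus_emb y) - p (torus_emb y)) * f y\<bar>)"
        using id by (rule integrable_abs)
      show "integrable cell (\<lambda>y. e * \<bar>f y\<bar>)"
        using f by (intro integrable_mult_right integrable_abs)
    qed
    also have "\<dots> = e * I" by (simp add: I_def)
    finally show ?thesis .
  qed
  have "\<bar>LINT y|cell. f y * G (torus_emb y)\<bar> \<le> 0"
  proof (rule field_le_epsilon)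
    fix e :: real assume e: "e > 0"
    \<comment> \<open>The summand 1 in the denominator covers the case \<open>I = 0\<close>.\<close>
    have "\<bar>LINT y|cell. f y * G (torus_emb y)\<bar> \<le> (e / (I + 1)) * I" using H[of "e / (I + 1)"] e I0 by simp
    also have "\<dots> \<le> e" using e I0 by (simp add: field_simps)
    finally show "\<bar>LINT y|cell. f y * G (torus_emb y)\<bar> \<le> 0 + e" by simp
  qed
  then show ?thesis by simp
qed

text \<open>Inside the open cell \<open>torus_emb\<close> glues no point of the cube to
  \<open>K\<close>, so the indicator of \<open>K\<close> is on the cell a limit of continuous
  functions of \<open>torus_emb\<close>; dominated convergence does the rest.\<close>

lemma integral_compact_0:
  assumes K: "compact K" "K \<subseteq> box 0 1"
  shows "(LINT y|cell. indicator K y * f y) = 0"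
proof -
  have EK: "compact (torus_emb ` K)" by (rule compact_continuous_image[OF continuous_on_torus_emb K(1)])
  have iff: "torus_emb y \<in> torus_emb ` K \<longleftrightarrow> y \<in> K" if "y \<in> cbox 0 1" for y
  proof
    assume "torus_emb y \<in> torus_emb ` K"
    then obtain x where x: "x \<in> K" "torus_emb y = torus_emb x" by auto
    have "y $ i = x $ i" for i
    proof (rule cis_2pi_eq)
      show "cis (2 * pi * y $ i) = cis (2 * pi * x $ i)"
        using x(2) by (simp add: torus_emb_def vec_eq_iff)
      show "0 \<le> y $ i" "y $ i \<le> 1" using that by (auto simp: mem_box_cart)
      show "0 < x $ i" "x $ i < 1" using x(1) K(2) by (auto simp: mem_box_cart subset_iff)
    qed
    with x(1) show "y \<in> K" by (metis vec_eq_iff)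
  qed auto
  show ?thesis
  \<comment> \<open>The distance to the empty set is 0 by convention, so the cutoffs below would
    tend to 1 instead of 0.\<close>
  proof (cases "K = {}")
    case False
    \<comment> \<open>Continuous cutoffs: 1 on the image of \<open>K\<close>, and for
      \<open>n > 0\<close> vanishing at distance at least \<open>1 / n\<close> from it.\<close>
    define G where "G n z = max 0 (1 - real n * infdist z (torus_emb ` K))" for n z
    have Gc: "continuous_on UNIV (G n)" for n
      unfolding G_def by (intro continuous_intros)
    have lim: "(\<lambda>n. f y * G n (torus_emb y)) \<longlonglongrightarrow> indicator K y * f y" if "y \<in> cbox 0 1" for y
    proof (cases "y \<in> K")
      case True
      then show ?thesis by (simp add: G_def)
    next
      case False
      then have "torus_emb y \<notin> torus_emb ` K" using iff[OF that] by simp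
      then have d: "infdist (torus_emb y) (torus_emb ` K) > 0"
        using in_closed_iff_infdist_zero[OF compact_imp_closed[OF EK], of "torus_emb y"] \<open>K \<noteq> {}\<close>
          infdist_nonneg[of "torus_emb y" "torus_emb ` K"] by simp
      then obtain N where N: "1 < real N * infdist (torus_emb y) (torus_emb ` K)"
        using ex_less_of_nat_mult by blast
      have "G n (torus_emb y) = 0" if "n \<ge> N" for n
      proof -
        have "real N * infdist (torus_emb y) (torus_emb ` K) \<le> real n * infdist (torus_emb y) (torus_emb ` K)"
          using that d by (intro mult_right_mono) auto
        then show ?thesis using N by (simp add: G_def)
      qed
      then have "\<forall>\<^sub>F n in sequentially. f y * G n (torus_emb y) = indicator K y * f y"
        using False by (auto simp: eventually_sequentially)
      then show ?thesis by (rule tendsto_eventually)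
    qed
    have Em: "torus_emb \<in> borel_measurable (borel :: (real^'n) measure)"
      by (rule borel_measurable_continuous_onI) (rule continuous_on_torus_emb)
    have [measurable]: "(\<lambda>y. G n (torus_emb y)) \<in> borel_measurable (borel :: (real^'n) measure)" for n
      by (rule measurable_compose[OF Em borel_measurable_continuous_onI[OF Gc]])
    have [measurable]: "K \<in> sets borel" using K(1) by (simp add: borel_compact)
    have "(\<lambda>n. LINT y|cell. f y * G n (torus_emb y)) \<longlonglongrightarrow> (LINT y|cell. indicator K y * f y)"
    proof (rule integral_dominated_convergence[where w="\<lambda>y. \<bar>f y\<bar>"])
      show "AE y in cell. (\<lambda>n. f y * G n (torus_emb y)) \<longlonglongrightarrow> indicator K y * f y"
        unfolding AE_cell_iff using lim by auto
      show "AE y in cell. norm (f y * G n (torus_emb y)) \<le> \<bar>f y\<bar>" for n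
        by (rule AE_I2) (auto simp: G_def abs_mult infdist_nonneg intro!: mult_left_le)
      show "integrable cell (\<lambda>y. \<bar>f y\<bar>)" using f by simp
    qed (unfold borel_measurable_cell, measurable)
    then show ?thesis
      using integral_continuous_torus_0[OF Gc] by (simp add: tendsto_const_iff)
  qed simp
qed

lemma integral_closed_0:
  assumes A: "closed A"
  shows "(LINT y|cell. indicator A y * f y) = 0"
proof -
  \<comment> \<open>Boxes whose distance to the faces tends to 0 exhaust the open cell; what they
    miss of the closed cell is a null set.\<close>
  define K where "K n = A \<inter> cbox (\<chi> i. 1 / (real n + 2)) (\<chi> i. 1 - 1 / (real n + 2))" for n
  have K: "compact (K n)" "K n \<subseteq> box 0 (1::real^'n)" for n
  proof -
    show "compact (K n)" unfolding K_def using A by (simp add: closed_Int_compact)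
    show "K n \<subseteq> box 0 (1::real^'n)"
    proof
      fix y assume "y \<in> K n"
      then have "1 / (real n + 2) \<le> y $ i" "y $ i \<le> 1 - 1 / (real n + 2)" for i
        by (auto simp: K_def mem_box_cart)
      moreover have "0 < 1 / (real n + 2)" by simp
      ultimately have "0 < y $ i" "y $ i < 1" for i
        by (meson less_le_trans, smt (verit))
      then show "y \<in> box 0 1" by (simp add: mem_box_cart)
    qed
  qed
  have [measurable]: "A \<in> sets borel" "K n \<in> sets borel" for n
    using A K(1) by (auto simp: borel_compact)
  have box: "AE y in cell. y \<in> box 0 (1::real^'n)"
    using AE_frontier_cell unfolding AE_cell_iff by eventually_elim auto
  have lim: "(\<lambda>n. indicator (K n) y * f y) \<longlonglongrightarrow> indicator A y * f y" if y: "y \<in> box 0 1" for y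
  proof -
    define m where "m = Min (range (\<lambda>i. min (y $ i) (1 - y $ i)))"
    have mle: "m \<le> y $ i" "m \<le> 1 - y $ i" for i
      using Min_le[of "range (\<lambda>i. min (y $ i) (1 - y $ i))" "min (y $ i) (1 - y $ i)"] by (auto simp: m_def)
    have "m \<in> range (\<lambda>i. min (y $ i) (1 - y $ i))" unfolding m_def by (rule Min_in) auto
    then have "m > 0" using y by (auto simp: mem_box_cart)
    then obtain N where N: "inverse (real (Suc N)) < m" using reals_Archimedean by blast
    have "y \<in> K n \<longleftrightarrow> y \<in> A" if "n \<ge> N" for n
    proof -
      have "1 / (real n + 2) \<le> inverse (real (Suc N))"
        using that by (simp add: field_simps)
      then have "1 / (real n + 2) \<le> m" using N by linarith
      then have "1 / (real n + 2) \<le> y $ i" "y $ i \<le> 1 - 1 / (real n + 2)" for i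
        using mle[of i] by linarith+
      then show ?thesis by (simp add: K_def mem_box_cart)
    qed
    then have "\<forall>\<^sub>F n in sequentially. indicator (K n) y * f y = indicator A y * f y"
      unfolding eventually_sequentially by (intro exI[of _ N]) (simp add: indicator_def)
    then show ?thesis by (rule tendsto_eventually)
  qed
  have "(\<lambda>n. LINT y|cell. indicator (K n) y * f y) \<longlonglongrightarrow> (LINT y|cell. indicator A y * f y)"
  proof (rule integral_dominated_convergence[where w="\<lambda>y. \<bar>f y\<bar>"])
    show "AE y in cell. (\<lambda>n. indicator (K n) y * f y) \<longlonglongrightarrow> indicator A y * f y"
      using box by eventually_elim (rule lim)
    show "AE y in cell. norm (indicator (K n) y * f y) \<le> \<bar>f y\<bar>" for n
      by (rule AE_I2) (auto simp: indicator_def)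
    show "integrable cell (\<lambda>y. \<bar>f y\<bar>)" using f by simp
  qed (unfold borel_measurable_cell, measurable)
  then show ?thesis
    using integral_compact_0[OF K] by (simp add: tendsto_const_iff)
qed

text \<open>Closed sets form a generator stable under intersection, so a Dynkin class argument
  suffices. The step for complements uses that the integral over the whole cell vanishes, the whole
  space being closed.\<close>

lemma integral_borel_0:
  assumes "A \<in> sets borel"
  shows "(LINT y:A|cell. f y) = 0"
proof -
  have "Int_stable (Collect (closed :: (real^'n) set \<Rightarrow> bool))"
    by (auto simp: Int_stable_def)
  moreover have "Collect closed \<subseteq> Pow (UNIV :: (real^'n) set)" by simp
  moreover have "A \<in> sigma_sets UNIV (Collect closed)"
    using assms by (simp add: borel_eq_closed)
  ultimately show ?thesis
  proof (induction rule: sigma_sets_induct_disjoint)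
    case (basic A)
    then show ?case using integral_closed_0[of A] by (simp add: set_lebesgue_integral_def)
  next
    case empty
    show ?case by (simp add: set_lebesgue_integral_def)
  next
    case (compl A)
    then have [measurable]: "A \<in> sets borel" by (simp add: borel_eq_closed)
    have i: "integrable cell (\<lambda>y. indicator A y *\<^sub>R f y)"
      by (rule integrable_mult_indicator) (auto simp: f)
    have "(LINT y:UNIV - A|cell. f y) = (LINT y|cell. indicator UNIV y * f y - indicator A y *\<^sub>R f y)"
      unfolding set_lebesgue_integral_def
      by (rule Bochner_Integration.integral_cong) (auto simp: indicator_def)
    also have "\<dots> = (LINT y|cell. indicator UNIV y * f y) - (LINT y|cell. indicator A y *\<^sub>R f y)"
      using f i by (intro Bochner_Integration.integral_diff) auto
    finally show ?case
      using compl integral_closed_0[of UNIV] by (simp add: set_lebesgue_integral_def)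
  next
    case (union A)
    then have m: "A i \<in> sets borel" for i by (auto simp: borel_eq_closed)
    have "(LINT y:(\<Union>i. A i)|cell. f y) = (\<Sum>i. (LINT y:(A i)|cell. f y))"
    proof (rule lebesgue_integral_countable_add)
      show "A i \<in> sets cell" for i using m by simp
      show "A i \<inter> A j = {}" if "i \<noteq> j" for i j using union(1) that by (auto simp: disjoint_family_on_def)
      have "(\<Union>i. A i) \<in> sets cell" using m by auto
      then show "set_integrable cell (\<Union>i. A i) f"
        unfolding set_integrable_def using f by (rule integrable_mult_indicator)
    qed
    then show ?case using union by simp
  qed
qed

lemma cell_AE_0: "AE y in cell. f y = 0"
  using density_unique_real[OF f, of "\<lambda>_. 0"] integral_borel_0
  by (simp add: set_lebesgue_integral_def)

end

section \<open>Absolutely convergent trigonometric series\<close>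

instance bcontfun :: (metric_space, banach) banach ..

text \<open>The series is summed in the Banach space of bounded continuous functions. Evaluation at
  a point and integration against a fixed function are bounded linear there and hence commute with
  the sum.\<close>

definition trig_bcontfun :: "(int^'n \<Rightarrow> complex) \<Rightarrow> (real^'n) \<Rightarrow>\<^sub>C complex" where
  "trig_bcontfun c = (\<Sum>\<^sub>\<infinity>k. Bcontfun (\<lambda>y. c k * chr k y))"

definition trig :: "(int^'n \<Rightarrow> complex) \<Rightarrow> real^'n \<Rightarrow> complex" where
  "trig c = apply_bcontfun (trig_bcontfun c)"

lemma apply_bcontfun_chr: "apply_bcontfun (Bcontfun (\<lambda>y. c * chr k y)) = (\<lambda>y. c * chr k y)"
  by (rule Bcontfun_inverse, rule bcontfun_normI[of _ "norm c"])
    (auto intro!: continuous_intros simp: norm_mult)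

lemma continuous_on_trig: "continuous_on A (trig c)"
  by (simp add: trig_def)

lemma borel_measurable_trig [measurable]: "trig c \<in> borel_measurable borel"
  by (rule borel_measurable_continuous_onI) (rule continuous_on_trig)

lemma norm_trig_le: "norm (trig c y) \<le> norm (trig_bcontfun c)"
  unfolding trig_def by (rule norm_bounded)

context
  fixes c :: "int^'n \<Rightarrow> complex"
  assumes c: "(\<lambda>k. norm (c k)) summable_on UNIV"
begin

lemma has_sum_trig_bcontfun:
  "((\<lambda>k. Bcontfun (\<lambda>y. c k * chr k y)) has_sum trig_bcontfun c) UNIV"
proof -
  have "norm (Bcontfun (\<lambda>y. c k * chr k y)) \<le> norm (c k)" for k
    by (rule norm_bound) (simp add: apply_bcontfun_chr norm_mult)
  then have "(\<lambda>k. norm (Bcontfun (\<lambda>y. c k * chr k y))) summable_on UNIV"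
    by (intro summable_on_comparison_test[OF c]) auto
  then show ?thesis
    unfolding trig_bcontfun_def by (simp add: abs_summable_summable)
qed

lemma has_sum_trig: "((\<lambda>k. c k * chr k y) has_sum trig c y) UNIV"
proof -
  have "bounded_linear (\<lambda>h::(real^'n) \<Rightarrow>\<^sub>C complex. apply_bcontfun h y)"
    by (rule bounded_linear_intro[of _ 1]) (auto intro: norm_bounded)
  from has_sum_bounded_linear[OF this has_sum_trig_bcontfun]
  show ?thesis by (simp add: o_def apply_bcontfun_chr trig_def)
qed

text \<open>Integration against \<open>g\<close> is a bounded functional for the supremum norm, with
  bound the L1 norm of \<open>g\<close>; termwise integration is its continuity.\<close>

lemma has_sum_integral_trig:
  assumes g: "integrable cell g"
  shows "((\<lambda>k. c k * (LINT y|cell. chr k y * g y)) has_sum (LINT y|cell. trig c y * g y)) UNIV"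
proof -
  have i: "integrable cell (\<lambda>y. apply_bcontfun h y * g y)" for h :: "(real^'n) \<Rightarrow>\<^sub>C complex"
    by (rule integrable_cell_bounded_mult[where B="norm h"])
      (auto intro!: norm_bounded g borel_measurable_continuous_onI)
  have "bounded_linear (\<lambda>h::(real^'n) \<Rightarrow>\<^sub>C complex. LINT y|cell. apply_bcontfun h y * g y)"
  proof (rule bounded_linear_intro[of _ "LINT y|cell. norm (g y)"])
    show "norm (LINT y|cell. apply_bcontfun h y * g y) \<le> norm h * (LINT y|cell. norm (g y))"
      for h :: "(real^'n) \<Rightarrow>\<^sub>C complex"
    proof -
      have "norm (LINT y|cell. apply_bcontfun h y * g y) \<le> (LINT y|cell. norm (apply_bcontfun h y * g y))"
        by (rule integral_norm_bound)
      also have "\<dots> \<le> (LINT y|cell. norm h * norm (g y))"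
      proof (rule integral_mono)
        show "integrable cell (\<lambda>y. norm (apply_bcontfun h y * g y))" by (rule integrable_norm[OF i])
        show "norm (apply_bcontfun h y * g y) \<le> norm h * norm (g y)" for y
          by (simp add: norm_mult mult_right_mono norm_bounded)
      qed (use g in simp)
      finally show ?thesis by simp
    qed
  qed (use i in \<open>auto simp: distrib_right\<close>)
  from has_sum_bounded_linear[OF this has_sum_trig_bcontfun]
  have "((\<lambda>k. LINT y|cell. c k * chr k y * g y) has_sum (LINT y|cell. trig c y * g y)) UNIV"
    by (simp add: o_def apply_bcontfun_chr trig_def)
  then show ?thesis by (simp add: mult.assoc)
qed

lemma periodic_trig: "periodic (trig c)"
  unfolding periodic_def
proof (intro allI)
  fix y k
  have "((\<lambda>j. c j * chr j y) has_sum trig c (y + int_vec k)) UNIV"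
    using has_sum_trig[of "y + int_vec k"] by (simp add: chr_add)
  then show "trig c (y + int_vec k) = trig c y" using has_sum_trig by (rule has_sum_unique)
qed

lemma trig_hermitian:
  assumes "\<And>k. c (- k) = cnj (c k)"
  shows "cnj (trig c y) = trig c y"
proof -
  have "((\<lambda>k. cnj (c k * chr k y)) has_sum cnj (trig c y)) UNIV"
    using has_sum_trig by (subst has_sum_cnj_iff)
  then have "((\<lambda>k. c (- k) * chr (- k) y) has_sum cnj (trig c y)) UNIV"
    by (simp add: assms)
  then have "((\<lambda>k. c k * chr k y) has_sum cnj (trig c y)) UNIV"
    using has_sum_reindex_bij_betw[OF bij_minus, of "\<lambda>k. c k * chr k y"] by simp
  then show ?thesis using has_sum_trig by (rule has_sum_unique)
qed

end

text \<open>The exceptional null set is translated by all integer vectors, of which there are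
  countably many.\<close>

lemma AE_lborel_of_cell:
  assumes R: "AE y in cell. R y" and per: "\<And>y k. R (y + int_vec k) = R y"
  shows "AE y in (lborel :: (real^'n) measure). R y"
proof -
  have "AE y in lborel. y \<in> cbox 0 1 \<longrightarrow> R y" using R by (simp add: AE_cell_iff)
  then obtain N where N: "\<And>y. y \<in> space lborel - N \<Longrightarrow> y \<in> cbox 0 1 \<longrightarrow> R y"
    "N \<in> null_sets (lborel :: (real^'n) measure)"
    by (rule AE_E3) (rule that)
  have [measurable]: "N \<in> sets borel" using N(2) by auto
  have "AE y in (lborel :: (real^'n) measure). y - int_vec k \<notin> N" for k
  proof -
    have e: "emeasure lborel N = 0" using N(2) by auto
    have "(\<integral>\<^sup>+y. indicator N (y - int_vec k) \<partial>lborel) = (\<integral>\<^sup>+y. indicator N y \<partial>lborel)"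
      using nn_integral_lborel_translate[of "indicator N" "- int_vec k"] by simp
    then have "(\<integral>\<^sup>+y. indicator N (y - int_vec k) \<partial>lborel) = 0" using e by simp
    then have "AE y in lborel. indicator N (y - int_vec k) = (0::ennreal)"
      by (subst (asm) nn_integral_0_iff_AE) auto
    then show ?thesis by eventually_elim (auto simp: indicator_def split: if_splits)
  qed
  then have "AE y in (lborel :: (real^'n) measure). \<forall>k. y - int_vec k \<notin> N"
    by (simp add: AE_all_countable)
  then show ?thesis
  proof eventually_elim
    case (elim y)
    let ?k = "floor_vec y"
    have "y - int_vec ?k \<in> half_open_cell" by (simp add: diff_int_vec_in_half_open_cell)
    then have "y - int_vec ?k \<in> cbox 0 1" by (auto simp: half_open_cell_def mem_box_cart less_imp_le)
    then have "R (y - int_vec ?k)" using N(1)[of "y - int_vec ?k"] elim by simp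
    then show ?case using per[of "y - int_vec ?k" ?k] by simp
  qed
qed

text \<open>Instead of computing boundary terms: the integral of the translate
  \<open>h (y + t *\<^sub>R axis i 1)\<close> does not depend on \<open>t\<close>, and
  differentiating it under the integral sign at \<open>t = 0\<close> gives the integral of the
  partial derivative.\<close>

lemma integral_partial_0:
  fixes h :: "real^'n \<Rightarrow> complex"
  assumes h: "periodic h" and D: "\<And>y. (h has_derivative D y) (at y)"
    and cont: "continuous_on UNIV (\<lambda>y. D y (axis i 1))"
  shows "(LINT y|cell. D y (axis i 1)) = 0"
proof -
  let ?e = "axis i 1 :: real^'n"
  have hc: "continuous_on UNIV h"
    by (intro continuous_at_imp_continuous_on ballI has_derivative_continuous[OF D])
  have conv: "set_integrable lborel (cbox 0 1) g" if "continuous_on UNIV g" for g :: "real^'n \<Rightarrow> complex"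
    unfolding set_integrable_def using that
    by (intro borel_integrable_compact) (auto intro: continuous_on_subset)
  have eq: "(LINT y|cell. g y) = integral (cbox 0 1) g" if g: "continuous_on UNIV g" for g :: "real^'n \<Rightarrow> complex"
    using set_borel_integral_eq_integral(2)[OF conv[OF g]] set_integral_cbox_eq[OF borel_measurable_continuous_onI[OF g]] by simp
  have shift: "continuous_on UNIV (\<lambda>y. h (y + t *\<^sub>R ?e))" for t
    by (rule continuous_on_compose2[OF hc]) (auto intro!: continuous_intros)
  have "((\<lambda>t. integral (cbox 0 1) (\<lambda>y. h (y + t *\<^sub>R ?e))) has_vector_derivative
      integral (cbox 0 1) (\<lambda>y. D (y + 0 *\<^sub>R ?e) ?e)) (at 0 within UNIV)"
  proof (rule leibniz_rule_vector_derivative)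
    fix t :: real and y :: "real^'n"
    have "((\<lambda>t. y + t *\<^sub>R ?e) has_derivative (\<lambda>s. s *\<^sub>R ?e)) (at t)"
      by (auto intro!: derivative_eq_intros)
    then have "((\<lambda>t. h (y + t *\<^sub>R ?e)) has_derivative (\<lambda>s. D (y + t *\<^sub>R ?e) (s *\<^sub>R ?e))) (at t)"
      by (rule has_derivative_compose) (rule D)
    moreover have "D (y + t *\<^sub>R ?e) (s *\<^sub>R ?e) = s *\<^sub>R D (y + t *\<^sub>R ?e) ?e" for s
      by (rule linear_cmul[OF has_derivative_linear[OF D]])
    ultimately show "((\<lambda>t. h (y + t *\<^sub>R ?e)) has_vector_derivative D (y + t *\<^sub>R ?e) ?e) (at t within UNIV)"
      by (simp add: has_vector_derivative_def)
  next
    show "(\<lambda>y. h (y + t *\<^sub>R ?e)) integrable_on cbox 0 1" for t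
      using set_borel_integral_eq_integral(1)[OF conv[OF shift]] .
    show "continuous_on (UNIV \<times> cbox 0 1) (\<lambda>(t, y). D (y + t *\<^sub>R ?e) ?e)"
      unfolding case_prod_beta
      by (rule continuous_on_compose2[OF cont]) (auto intro!: continuous_intros)
  qed auto
  moreover have "integral (cbox 0 1) (\<lambda>y. h (y + t *\<^sub>R ?e)) = (LINT y|cell. h y)" for t
    using integral_cell_translate[OF borel_measurable_continuous_onI[OF hc] h, of "t *\<^sub>R ?e"] eq[OF shift] by simp
  ultimately have "((\<lambda>t::real. LINT y|cell. h y) has_vector_derivative integral (cbox 0 1) (\<lambda>y. D y ?e)) (at 0)"
    by simp
  then have "integral (cbox 0 1) (\<lambda>y. D y ?e) = 0"
    by (rule vector_derivative_unique_at[OF _ has_vector_derivative_const])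
  then show ?thesis using eq[OF cont] by simp
qed

lemma has_derivative_chr:
  "(chr k has_derivative (\<lambda>v. 2 * of_real pi * \<i> * of_real (int_vec k \<bullet> v) * chr k y)) (at y)"
proof -
  have "((\<lambda>y. \<i> * complex_of_real (2 * pi * (int_vec k \<bullet> y))) has_derivative
      (\<lambda>v. \<i> * complex_of_real (2 * pi * (int_vec k \<bullet> v)))) (at y)"
    by (intro has_derivative_mult_right has_derivative_of_real has_derivative_inner_right has_derivative_ident)
  from has_derivative_compose[OF this has_field_derivative_imp_has_derivative[OF DERIV_exp]]
  show ?thesis unfolding chr_def cis_conv_exp by (simp add: mult_ac)
qed

text \<open>Integration by parts, obtained from the product rule for \<open>chr k\<close> times the
  test function.\<close>

lemma integral_chr_mult_partial:
  fixes \<phi> :: "real^'n \<Rightarrow> real"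
  assumes \<phi>: "periodic \<phi>" "\<And>y. (\<phi> has_derivative blinfun_apply (D y)) (at y)" "continuous_on UNIV D"
  shows "(LINT y|cell. chr k y * of_real (D y (axis i 1)))
       = - (2 * of_real pi * \<i> * of_int (k $ i)) * (LINT y|cell. chr k y * of_real (\<phi> y))"
proof -
  let ?e = "axis i 1 :: real^'n"
  have c\<phi>: "continuous_on UNIV \<phi>"
    by (intro continuous_at_imp_continuous_on ballI has_derivative_continuous[OF \<phi>(2)])
  have e: "int_vec k \<bullet> ?e = of_int (k $ i)" by (simp add: inner_axis int_vec_def)
  have "(LINT y|cell. chr k y * of_real (D y ?e) + 2 * of_real pi * \<i> * of_real (int_vec k \<bullet> ?e) * chr k y * of_real (\<phi> y)) = 0"
  proof (rule integral_partial_0[where h="\<lambda>y. chr k y * of_real (\<phi> y)" and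
        D="\<lambda>y v. chr k y * of_real (D y v) + 2 * of_real pi * \<i> * of_real (int_vec k \<bullet> v) * chr k y * of_real (\<phi> y)"])
    show "periodic (\<lambda>y. chr k y * of_real (\<phi> y))"
      using \<phi>(1) periodic_chr[of k] by (simp add: periodic_def)
    show "((\<lambda>y. chr k y * of_real (\<phi> y)) has_derivative
        (\<lambda>v. chr k y * of_real (D y v) + 2 * of_real pi * \<i> * of_real (int_vec k \<bullet> v) * chr k y * of_real (\<phi> y))) (at y)" for y
      by (intro has_derivative_mult has_derivative_chr has_derivative_of_real \<phi>(2))
    show "continuous_on UNIV (\<lambda>y. chr k y * of_real (D y ?e) + 2 * of_real pi * \<i> * of_real (int_vec k \<bullet> ?e) * chr k y * of_real (\<phi> y))"
      by (intro continuous_intros c\<phi> \<phi>(3))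
  qed
  moreover have i: "integrable cell g" if "continuous_on UNIV g" for g :: "real^'n \<Rightarrow> complex"
  proof -
    have "set_integrable lborel (cbox 0 1) g"
      unfolding set_integrable_def using that
      by (intro borel_integrable_compact) (auto intro: continuous_on_subset)
    then show ?thesis using set_integrable_cbox_eq[OF borel_measurable_continuous_onI[OF that]] by simp
  qed
  moreover have "integrable cell (\<lambda>y. chr k y * of_real (D y ?e))"
    by (intro i continuous_intros \<phi>(3))
  moreover have "integrable cell (\<lambda>y. chr k y * of_real (\<phi> y))"
    by (intro i continuous_intros c\<phi>)
  ultimately show ?thesis
    by (simp add: e mult.assoc add_eq_0_iff)
qed

section \<open>Fourier coefficients on the torus\<close>

lemma torus_eq_refl: "torus_eq f f \<longleftrightarrow> f \<in> borel_measurable borel \<and> periodic f"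
  by (simp add: torus_eq_def)

lemma torus_eq_cellI:
  fixes f g :: "real^'n \<Rightarrow> real"
  assumes "f \<in> borel_measurable borel" "g \<in> borel_measurable borel" "periodic f" "periodic g"
    and "AE y in cell. f y = g y"
  shows "torus_eq f g"
proof -
  have "AE y in lborel. f y = g y"
    using assms(3,4) by (intro AE_lborel_of_cell[OF assms(5)]) (simp add: periodic_def)
  with assms show ?thesis by (simp add: torus_eq_def)
qed

lemma borel_measurable_cnj_chr [measurable]: "(\<lambda>y. cnj (chr k y)) \<in> borel_measurable borel"
proof -
  have "(\<lambda>y. cnj (chr k y)) = chr (- k)" by (simp add: fun_eq_iff)
  then show ?thesis by simp
qed

abbreviation fourier_int :: "(real^'n \<Rightarrow> real) \<Rightarrow> int^'n \<Rightarrow> complex" where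
  "fourier_int f k \<equiv> LINT y:cbox 0 1|lborel.
     complex_of_real (f y) * exp (- (2 * of_real pi * \<i> * of_real (int_vec k \<bullet> y)))"

lemma fourier_cell:
  fixes f :: "real^'n \<Rightarrow> real"
  assumes [measurable]: "f \<in> borel_measurable borel"
  shows "fourier_int f k
       = (LINT y|cell. of_real (f y) * cnj (chr k y))"
  unfolding exp_eq_cnj_chr by (rule set_integral_cbox_eq) measurable

lemma integrable_mult_cnj_chr:
  assumes "integrable cell f"
  shows "integrable cell (\<lambda>y. f y * cnj (chr k y))"
  using integrable_mult_chr(1)[OF assms, of "- k"] by simp

lemma fourier_hermitian:
  fixes f :: "'n::finite torus_fun"
  shows "fourier f (- k) = cnj (fourier f k)"
proof (transfer fixing: k)
  fix f :: "real^'n \<Rightarrow> real" assume "torus_eq f f"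
  then have [measurable]: "f \<in> borel_measurable borel" by (simp add: torus_eq_refl)
  have "(LINT y|cell. of_real (f y) * cnj (chr (- k) y)) = (LINT y|cell. cnj (of_real (f y) * cnj (chr k y)))"
    by simp
  also have "\<dots> = cnj (LINT y|cell. of_real (f y) * cnj (chr k y))"
    by (simp del: complex_cnj_mult)
  finally show "fourier_int f (- k)
     = cnj (fourier_int f k)"
    by (simp only: fourier_cell \<open>f \<in> borel_measurable borel\<close>)
qed

lemma torus_L1_add [intro]: "torus_L1 f \<Longrightarrow> torus_L1 g \<Longrightarrow> torus_L1 (f + g)"
  and torus_L1_diff [intro]: "torus_L1 f \<Longrightarrow> torus_L1 g \<Longrightarrow> torus_L1 (f - g)"
  and torus_L1_scaleR [intro]: "torus_L1 f \<Longrightarrow> torus_L1 (c *\<^sub>R f)"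
  by (transfer; simp add: torus_eq_refl set_integral_add set_integral_diff)+

lemma torus_L1_1 [intro, simp]: "torus_L1 1"
  and torus_L1_0 [intro, simp]: "torus_L1 0"
  by (transfer; simp add: set_integrable_cbox_eq)+

lemma torus_L1_of_real [intro, simp]: "torus_L1 (of_real c)"
  unfolding of_real_def by (rule torus_L1_scaleR) simp

lemma fourier_add:
  fixes f g :: "'n::finite torus_fun"
  shows "torus_L1 f \<Longrightarrow> torus_L1 g \<Longrightarrow> fourier (f + g) k = fourier f k + fourier g k"
proof (transfer fixing: k)
  fix f g :: "real^'n \<Rightarrow> real"
  assume "torus_eq f f" "torus_eq g g"
    and i: "set_integrable lborel (cbox 0 1) f" "set_integrable lborel (cbox 0 1) g"
  then have m: "f \<in> borel_measurable borel" "g \<in> borel_measurable borel" by (auto simp: torus_eq_refl)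
  then have "integrable cell f" "integrable cell g" using i by (simp_all add: set_integrable_cbox_eq)
  then have "integrable cell (\<lambda>y. complex_of_real (f y) * cnj (chr k y))"
    "integrable cell (\<lambda>y. complex_of_real (g y) * cnj (chr k y))"
    by (auto intro: integrable_mult_cnj_chr)
  moreover have m': "(\<lambda>y. f y + g y) \<in> borel_measurable borel" using m by measurable
  ultimately show "fourier_int (\<lambda>y. f y + g y) k =
     fourier_int f k + fourier_int g k"
    unfolding fourier_cell[OF m(1)] fourier_cell[OF m(2)] fourier_cell[OF m'] by (simp add: distrib_right)
qed

lemma fourier_scaleR:
  fixes f :: "'n::finite torus_fun"
  shows "fourier (c *\<^sub>R f) k = of_real c * fourier f k"
proof (transfer fixing: k c)
  fix f :: "real^'n \<Rightarrow> real"
  assume "torus_eq f f"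
  then have m: "f \<in> borel_measurable borel" by (auto simp: torus_eq_refl)
  then have m': "(\<lambda>y. c * f y) \<in> borel_measurable borel" by measurable
  show "fourier_int (\<lambda>y. c * f y) k =
     of_real c * fourier_int f k"
    unfolding fourier_cell[OF m] fourier_cell[OF m'] by (simp add: mult.assoc)
qed

lemma fourier_diff:
  fixes f g :: "'n::finite torus_fun"
  assumes "torus_L1 f" "torus_L1 g"
  shows "fourier (f - g) k = fourier f k - fourier g k"
  using fourier_add[OF assms(1) torus_L1_scaleR[OF assms(2), of "- 1"], of k] fourier_scaleR[of "- 1" g k]
  by simp

lemma fourier_0 [simp]: "fourier 0 k = 0"
  using fourier_scaleR[of 0 0 k] by simp

lemma fourier_1:
  fixes k :: "int^'n"
  shows "fourier 1 k = (if k = 0 then 1 else 0)"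
proof (transfer fixing: k)
  have "(LINT y|cell. of_real 1 * cnj (chr k y)) = (LINT y|cell. chr (- k) y)" by simp
  then show "fourier_int (\<lambda>_. 1) k = (if k = 0 then 1 else 0)"
    by (subst fourier_cell) (simp_all only: borel_measurable_const integral_chr neg_equal_0_iff_equal)
qed

lemma fourier_of_real: "fourier (of_real c :: 'n::finite torus_fun) k = (if k = 0 then of_real c else 0)"
proof -
  have "of_real c = c *\<^sub>R (1 :: 'n torus_fun)" by (simp only: of_real_def)
  then show ?thesis by (simp add: fourier_scaleR fourier_1)
qed

lemma fourier_zero_torus_integral:
  fixes f :: "'n::finite torus_fun"
  shows "fourier f 0 = of_real (torus_integral f)"
proof transfer
  fix f :: "real^'n \<Rightarrow> real"
  assume "torus_eq f f"
  then have m: "f \<in> borel_measurable borel" by (auto simp: torus_eq_refl)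
  show "fourier_int f 0 =
      of_real (LINT y:cbox 0 1|lborel. f y)"
    unfolding fourier_cell[OF m] set_integral_cbox_eq[OF m] by simp
qed

lemma fourier_eqI:
  fixes f g :: "'n::finite torus_fun"
  assumes "torus_L1 f" "torus_L1 g" "\<And>k. fourier f k = fourier g k"
  shows "f = g"
proof -
  have "f - g = 0" if "torus_L1 (f - g)" "\<forall>k. fourier (f - g) k = 0"
    using that
  proof (transfer)
    fix f g :: "real^'n \<Rightarrow> real"
    let ?h = "\<lambda>y. f y - g y"
    assume "torus_eq f f" "torus_eq g g" and i: "set_integrable lborel (cbox 0 1) ?h"
      and z: "\<forall>k. (fourier_int ?h k) = 0"
    then have m: "?h \<in> borel_measurable borel" and p: "periodic ?h"
      by (auto simp: torus_eq_refl periodic_def)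
    have "(LINT y|cell. of_real (?h y) * cnj (chr k y)) = 0" for k
      using z unfolding fourier_cell[OF m] by blast
    from this[of "- k" for k] have "(LINT y|cell. of_real (?h y) * chr k y) = 0" for k by simp
    moreover have "integrable cell ?h" using i m by (simp add: set_integrable_cbox_eq)
    ultimately have "AE y in cell. ?h y = 0" by (rule cell_AE_0[rotated])
    then show "torus_eq ?h (\<lambda>_. 0)"
      using m p by (intro torus_eq_cellI) (auto simp: periodic_def)
  qed
  then show ?thesis using assms by (simp add: torus_L1_diff fourier_diff)
qed

text \<open>The real part and the default value 0 make the construction total; for
  \<open>hermitian\<close> coefficients the series converges and is real, so neither changes
  anything.\<close>

lift_definition trig_fun :: "(int^'n \<Rightarrow> complex) \<Rightarrow> 'n::finite torus_fun" is
  "\<lambda>c y. if (\<lambda>k. norm (c k)) summable_on UNIV then Re (trig c y) else 0"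
proof -
  fix c :: "int^'n \<Rightarrow> complex"
  show "torus_eq (\<lambda>y. if (\<lambda>k. norm (c k)) summable_on UNIV then Re (trig c y) else 0)
      (\<lambda>y. if (\<lambda>k. norm (c k)) summable_on UNIV then Re (trig c y) else 0)"
    using periodic_trig[of c] by (auto simp: torus_eq_refl periodic_def)
qed

definition hermitian :: "(int^'n \<Rightarrow> complex) \<Rightarrow> bool" where
  "hermitian c \<longleftrightarrow> (\<lambda>k. norm (c k)) summable_on UNIV \<and> (\<forall>k. c (- k) = cnj (c k))"

lemma of_real_Re_trig: "hermitian c \<Longrightarrow> of_real (Re (trig c y)) = trig c y"
  using trig_hermitian[of c y] unfolding hermitian_def by (metis Reals_cnj_iff of_real_Re)

lemma Re_trig_measurable [measurable]: "(\<lambda>y. Re (trig c y)) \<in> borel_measurable borel"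
  by measurable

lemma abs_Re_trig_le: "\<bar>Re (trig c y)\<bar> \<le> norm (trig_bcontfun c)"
  by (rule order_trans[OF abs_Re_le_cmod norm_trig_le])

lemma torus_L1_trig_fun_mult:
  fixes g :: "'n::finite torus_fun"
  assumes "hermitian c" "torus_L1 g"
  shows "torus_L1 (trig_fun c * g)"
  using assms(2)
proof (transfer fixing: c)
  fix g :: "real^'n \<Rightarrow> real"
  assume "torus_eq g g" and i: "set_integrable lborel (cbox 0 1) g"
  then have [measurable]: "g \<in> borel_measurable borel" by (auto simp: torus_eq_refl)
  have s: "(\<lambda>k. norm (c k)) summable_on UNIV" using assms by (simp add: hermitian_def)
  have "integrable cell (\<lambda>y. Re (trig c y) * g y)"
    using i by (intro integrable_cell_bounded_mult[where B="norm (trig_bcontfun c)"])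
      (auto simp: set_integrable_cbox_eq abs_Re_trig_le)
  then show "set_integrable lborel (cbox 0 1)
      (\<lambda>y. (if (\<lambda>k. norm (c k)) summable_on UNIV then Re (trig c y) else 0) * g y)"
    by (simp add: s set_integrable_cbox_eq)
qed

lemma torus_L1_trig_fun: "hermitian c \<Longrightarrow> torus_L1 (trig_fun c)"
  using torus_L1_trig_fun_mult[of c 1] by simp

lemma torus_L2_trig_fun: "hermitian c \<Longrightarrow> trig_fun c \<in> torus_L2"
  by (simp add: torus_L2_def torus_L1_trig_fun_mult torus_L1_trig_fun)

text \<open>Only the first factor is expanded. The second may be an arbitrary integrable function,
  since the series is integrated term by term against it.\<close>

lemma has_sum_fourier_trig_fun_mult:
  fixes g :: "'n::finite torus_fun"
  assumes c: "hermitian c" and g: "torus_L1 g"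
  shows "((\<lambda>j. c j * fourier g (k - j)) has_sum fourier (trig_fun c * g) k) UNIV"
  using g
proof (transfer fixing: c k)
  fix g :: "real^'n \<Rightarrow> real"
  assume "torus_eq g g" and i: "set_integrable lborel (cbox 0 1) g"
  then have m: "g \<in> borel_measurable borel" by (auto simp: torus_eq_refl)
  have s: "(\<lambda>k. norm (c k)) summable_on UNIV" using c by (simp add: hermitian_def)
  have m': "(\<lambda>y. Re (trig c y) * g y) \<in> borel_measurable borel" using m by measurable
  have "integrable cell g" using i m by (simp add: set_integrable_cbox_eq)
  then have "integrable cell (\<lambda>y. complex_of_real (g y) * cnj (chr k y))"
    by (auto intro: integrable_mult_cnj_chr)
  from has_sum_integral_trig[OF s this]
  have "((\<lambda>j. c j * (LINT y|cell. of_real (g y) * cnj (chr (k - j) y))) has_sum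
      (LINT y|cell. of_real (Re (trig c y) * g y) * cnj (chr k y))) UNIV"
    by (simp add: of_real_Re_trig[OF c] chr_diff_index mult_ac)
  then show "((\<lambda>j. c j * fourier_int g (k - j)) has_sum
     fourier_int (\<lambda>y. (if (\<lambda>k. norm (c k)) summable_on UNIV then Re (trig c y) else 0) * g y) k) UNIV"
    using s by (simp only: fourier_cell[OF m] fourier_cell[OF m'] if_True)
qed

text \<open>The product formula with second factor 1, where a single term survives.\<close>

lemma fourier_trig_fun:
  fixes c :: "int^'n \<Rightarrow> complex"
  shows "hermitian c \<Longrightarrow> fourier (trig_fun c) k = c k"
proof -
  assume c: "hermitian c"
  have "((\<lambda>j. c j * fourier 1 (k - j)) has_sum c k) UNIV"
    by (rule has_sum_finite_neutralI[of "{k}"]) (auto simp: fourier_1)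
  then show ?thesis
    using has_sum_unique has_sum_fourier_trig_fun_mult[OF c torus_L1_1, of k] by fastforce
qed

lemma fourier_bound:
  fixes f :: "'n::finite torus_fun"
  shows "torus_L1 f \<Longrightarrow> \<exists>B. \<forall>k. norm (fourier f k) \<le> B"
proof transfer
  fix f :: "real^'n \<Rightarrow> real"
  assume "torus_eq f f" and i: "set_integrable lborel (cbox 0 1) f"
  then have m: "f \<in> borel_measurable borel" by (auto simp: torus_eq_refl)
  have "norm (LINT y|cell. of_real (f y) * cnj (chr k y)) \<le> (LINT y|cell. \<bar>f y\<bar>)" for k
    using integral_norm_bound[of cell "\<lambda>y. of_real (f y) * cnj (chr k y)"] by (simp add: norm_mult)
  then show "\<exists>B. \<forall>k. norm (fourier_int f k) \<le> B"
    unfolding fourier_cell[OF m] by blast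
qed

lemma reflect_trig_fun:
  fixes c :: "int^'n \<Rightarrow> complex"
  assumes "\<And>k. c (- k) = c k"
  shows "reflect (trig_fun c) = trig_fun c"
proof (transfer fixing: c)
  have "trig c (- y) = trig c y" if s: "(\<lambda>k. norm (c k)) summable_on UNIV" for y
  proof -
    have "((\<lambda>k. c (- k) * chr (- k) (- y)) has_sum trig c (- y)) UNIV"
      using has_sum_trig[OF s, of "- y"] has_sum_reindex_bij_betw[OF bij_minus, of "\<lambda>k. c k * chr k (- y)"] by simp
    then have "((\<lambda>k. c k * chr k y) has_sum trig c (- y)) UNIV"
      by (simp add: assms chr_minus)
    then show ?thesis using has_sum_trig[OF s] by (rule has_sum_unique)
  qed
  then have "(\<lambda>y. if (\<lambda>k. norm (c k)) summable_on UNIV then Re (trig c (- y)) else 0)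
      = (\<lambda>y. if (\<lambda>k. norm (c k)) summable_on UNIV then Re (trig c y) else 0)" by auto
  moreover have "torus_eq \<dots> \<dots>"
    using periodic_trig[of c] by (auto simp: torus_eq_refl periodic_def)
  ultimately show "torus_eq (\<lambda>y. if (\<lambda>k. norm (c k)) summable_on UNIV then Re (trig c (- y)) else 0)
      (\<lambda>y. if (\<lambda>k. norm (c k)) summable_on UNIV then Re (trig c y) else 0)"
    by (simp only:)
qed

text \<open>The series for \<open>trig c\<close> is integrated term by term against
  \<open>P (y - z)\<close>. The resulting identity holds at every point \<open>y\<close>.\<close>

lemma convolution_trig_fun:
  fixes P :: "'n::finite torus_fun"
  assumes c: "hermitian c" and P: "torus_L1 P"
  shows "convolution P (trig_fun c) = trig_fun (\<lambda>k. fourier P k * c k)"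
proof -
  have s: "(\<lambda>k. norm (c k)) summable_on UNIV" using c by (simp add: hermitian_def)
  obtain B where B: "\<And>k. norm (fourier P k) \<le> B" using fourier_bound[OF P] by blast
  have s': "(\<lambda>k. norm (fourier P k * c k)) summable_on UNIV"
    by (rule summable_on_comparison_test[OF summable_on_cmult_right[OF s, of B]])
      (auto simp: norm_mult intro: mult_right_mono B)
  show ?thesis using P s'
  proof (transfer fixing: c)
    fix P :: "real^'n \<Rightarrow> real"
    let ?F = "\<lambda>k. fourier_int P k"
    assume "torus_eq P P" and i: "set_integrable lborel (cbox 0 1) P"
      and s': "(\<lambda>k. norm (?F k * c k)) summable_on UNIV"
    then have m [measurable]: "P \<in> borel_measurable borel" and per: "periodic P" by (auto simp: torus_eq_refl)
    have iP: "integrable cell P" using i m by (simp add: set_integrable_cbox_eq)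
    have eq: "(LINT z:cbox 0 1|lborel. P (y - z) * Re (trig c z)) = Re (trig (\<lambda>k. ?F k * c k) y)" for y
    proof -
      have ig: "integrable cell (\<lambda>z. complex_of_real (P (y - z)))"
        using integrable_cell_reflect[OF m per, of y] iP by auto
      have "c k * (LINT z|cell. chr k z * of_real (P (y - z))) = ?F k * c k * chr k y" for k
      proof -
        have [measurable]: "(\<lambda>w. chr k (y - w)) \<in> borel_measurable borel"
          by (intro measurable_compose[OF _ borel_measurable_chr]) measurable
        \<comment> \<open>Writing \<open>z\<close> as \<open>y - (y - z)\<close> exhibits the
          integrand as a reflected periodic function, so the substitution \<open>w = y - z\<close>
          is \<open>integral_cell_reflect\<close>.\<close>
        have "(LINT z|cell. chr k (y - (y - z)) * of_real (P (y - z))) = (LINT w|cell. chr k (y - w) * of_real (P w))"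
        proof (rule integral_cell_reflect[of "\<lambda>w. chr k (y - w) * of_real (P w)"])
          show "periodic (\<lambda>w. chr k (y - w) * complex_of_real (P w))"
            using per periodic_chr[of k] by (simp add: periodic_def chr_diff chr_add)
        qed measurable
        also have "\<dots> = (LINT w|cell. chr k y * (of_real (P w) * cnj (chr k w)))"
          by (simp add: chr_diff mult_ac)
        also have "\<dots> = chr k y * (LINT w|cell. of_real (P w) * cnj (chr k w))"
          by (rule integral_mult_right_zero)
        finally show ?thesis unfolding fourier_cell[OF m] by simp
      qed
      with has_sum_integral_trig[OF s ig]
      have "((\<lambda>k. ?F k * c k * chr k y) has_sum (LINT z|cell. trig c z * of_real (P (y - z)))) UNIV" by simp
      from has_sum_unique[OF this has_sum_trig[OF s']]
      have "(LINT z|cell. complex_of_real (P (y - z) * Re (trig c z))) = trig (\<lambda>k. ?F k * c k) y"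
        by (simp add: of_real_Re_trig[OF c] mult.commute)
      then have "of_real (LINT z|cell. P (y - z) * Re (trig c z)) = trig (\<lambda>k. ?F k * c k) y"
        by (simp only: integral_complex_of_real)
      moreover have "(LINT z:cbox 0 1|lborel. P (y - z) * Re (trig c z)) = (LINT z|cell. P (y - z) * Re (trig c z))"
        by (rule set_integral_cbox_eq) measurable
      ultimately show ?thesis by (metis Re_complex_of_real)
    qed
    show "torus_eq (\<lambda>y. LINT z:cbox 0 1|lborel. P (y - z) * (if (\<lambda>k. norm (c k)) summable_on UNIV then Re (trig c z) else 0))
       (\<lambda>y. if (\<lambda>k. norm (?F k * c k)) summable_on UNIV then Re (trig (\<lambda>k. ?F k * c k) y) else 0)"
      using s s' periodic_trig[OF s'] by (simp add: eq torus_eq_refl periodic_def)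
  qed
qed

text \<open>Both integrals are expanded along the series; each term is the integration by parts for
  one character, where \<open>2 * pi * \<i> * k $ i\<close> appears.\<close>

lemma has_weak_partial_trig_fun:
  fixes c d :: "int^'n \<Rightarrow> complex"
  assumes c: "hermitian c" and d: "hermitian d" and cd: "\<And>k. d k = 2 * of_real pi * \<i> * of_int (k $ i) * c k"
  shows "has_weak_partial (trig_fun c) i (trig_fun d)"
proof -
  have L: "torus_L1 (trig_fun c)" "torus_L1 (trig_fun d)" using c d by (auto intro: torus_L1_trig_fun)
  have s: "(\<lambda>k. norm (c k)) summable_on UNIV" "(\<lambda>k. norm (d k)) summable_on UNIV"
    using c d by (auto simp: hermitian_def)
  show ?thesis using L
  proof (transfer fixing: c d i, intro conjI allI impI)
    fix \<phi> :: "real^'n \<Rightarrow> real" and D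
    assume \<phi>: "periodic \<phi>" "\<forall>y. (\<phi> has_derivative blinfun_apply (D y)) (at y)" "continuous_on UNIV D"
    let ?e = "axis i 1 :: real^'n"
    have c\<phi>: "continuous_on UNIV \<phi>"
      by (intro continuous_at_imp_continuous_on ballI has_derivative_continuous[OF \<phi>(2)[rule_format]])
    have cD: "continuous_on UNIV (\<lambda>y. D y ?e)" by (intro continuous_intros \<phi>(3))
    have int: "integrable cell (\<lambda>y. complex_of_real (g y))" if "continuous_on UNIV g" for g :: "real^'n \<Rightarrow> real"
    proof -
      have "set_integrable lborel (cbox 0 1) g"
        unfolding set_integrable_def using that
        by (intro borel_integrable_compact) (auto intro: continuous_on_subset)
      then have "integrable cell g" using set_integrable_cbox_eq[OF borel_measurable_continuous_onI[OF that]] by simp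
      then show ?thesis by simp
    qed
    have conv: "(LINT y:cbox 0 1|lborel. (if (\<lambda>k. norm (b k)) summable_on UNIV then Re (trig b y) else 0) * g y)
        = Re (LINT y|cell. trig b y * of_real (g y))"
      if "continuous_on UNIV g" "hermitian b" for g :: "real^'n \<Rightarrow> real" and b
    proof -
      have [measurable]: "g \<in> borel_measurable borel" using that(1) by (rule borel_measurable_continuous_onI)
      have "(LINT y:cbox 0 1|lborel. Re (trig b y) * g y) = (LINT y|cell. Re (trig b y) * g y)"
        by (rule set_integral_cbox_eq) measurable
      also have "\<dots> = Re (of_real (LINT y|cell. Re (trig b y) * g y))" by simp
      also have "\<dots> = Re (LINT y|cell. of_real (Re (trig b y) * g y))"
        by (simp only: integral_complex_of_real)
      also have "\<dots> = Re (LINT y|cell. trig b y * of_real (g y))"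
        by (simp add: of_real_Re_trig[OF that(2)])
      finally show ?thesis using that(2) by (simp add: hermitian_def)
    qed
    have "c k * (LINT y|cell. chr k y * of_real (D y ?e)) = - (d k * (LINT y|cell. chr k y * of_real (\<phi> y)))" for k
      using integral_chr_mult_partial[of \<phi> D k i] \<phi> by (simp add: cd)
    then have "((\<lambda>k. - (d k * (LINT y|cell. chr k y * of_real (\<phi> y)))) has_sum (LINT y|cell. trig c y * of_real (D y ?e))) UNIV"
      using has_sum_integral_trig[OF s(1) int[OF cD]] by simp
    moreover have "((\<lambda>k. - (d k * (LINT y|cell. chr k y * of_real (\<phi> y)))) has_sum - (LINT y|cell. trig d y * of_real (\<phi> y))) UNIV"
      using has_sum_integral_trig[OF s(2) int[OF c\<phi>]] by (simp add: has_sum_uminus)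
    ultimately have "(LINT y|cell. trig c y * of_real (D y ?e)) = - (LINT y|cell. trig d y * of_real (\<phi> y))"
      by (rule has_sum_unique)
    then show "(LINT y:cbox 0 1|lborel. (if (\<lambda>k. norm (c k)) summable_on UNIV then Re (trig c y) else 0) * blinfun_apply (D y) ?e)
      = - (LINT y:cbox 0 1|lborel. (if (\<lambda>k. norm (d k)) summable_on UNIV then Re (trig d y) else 0) * \<phi> y)"
      by (simp only: conv[OF cD c] conv[OF c\<phi> d]) simp
  qed
qed

lemma has_weak_partial_L1: "has_weak_partial f i g \<Longrightarrow> torus_L1 f \<and> torus_L1 g"
  by transfer simp

text \<open>The real and imaginary parts of the characters are admissible test functions.\<close>

lemma has_weak_partial_fourier:
  fixes f g :: "'n::finite torus_fun"
  assumes "has_weak_partial f i g"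
  shows "fourier g k = 2 * of_real pi * \<i> * of_int (k $ i) * fourier f k"
  using assms
proof (transfer fixing: k i)
  fix f g :: "real^'n \<Rightarrow> real"
  let ?e = "axis i 1 :: real^'n"
  assume "torus_eq f f" "torus_eq g g" and
    H: "set_integrable lborel (cbox 0 1) f \<and> set_integrable lborel (cbox 0 1) g \<and>
        (\<forall>(\<phi> :: real^'n \<Rightarrow> real) D. periodic \<phi> \<longrightarrow>
           (\<forall>y. (\<phi> has_derivative blinfun_apply (D y)) (at y)) \<longrightarrow> continuous_on UNIV D \<longrightarrow>
           (LINT y:cbox 0 1|lborel. f y * blinfun_apply (D y) ?e)
             = - (LINT y:cbox 0 1|lborel. g y * \<phi> y))"
  then have m [measurable]: "f \<in> borel_measurable borel" "g \<in> borel_measurable borel" by (auto simp: torus_eq_refl)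
  have int: "integrable cell f" "integrable cell g" using H m by (simp_all add: set_integrable_cbox_eq)
  have test: "(LINT y:cbox 0 1|lborel. f y * blinfun_apply (D y) ?e) = - (LINT y:cbox 0 1|lborel. g y * \<phi> y)"
    if "periodic \<phi>" "\<And>y. (\<phi> has_derivative blinfun_apply (D y)) (at y)" "continuous_on UNIV D"
    for \<phi> :: "real^'n \<Rightarrow> real" and D
    using H that by blast
  define w where "w = 2 * pi * real_of_int (k $ i)"
  have e: "int_vec k \<bullet> ?e = of_int (k $ i)" by (simp add: inner_axis int_vec_def)
  define \<theta> where "\<theta> y = 2 * pi * (int_vec k \<bullet> y)" for y :: "real^'n"
  define L where "L = (2 * pi) *\<^sub>R blinfun_inner_right (int_vec k :: real^'n)"
  have L: "blinfun_apply L v = 2 * pi * (int_vec k \<bullet> v)" for v by (simp add: L_def scaleR_blinfun.rep_eq)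
  have d\<theta>: "(\<theta> has_derivative blinfun_apply L) (at y)" for y
    unfolding \<theta>_def L by (auto intro!: derivative_eq_intros)
  have c\<theta>: "continuous_on UNIV \<theta>" unfolding \<theta>_def by (intro continuous_intros)
  have chr: "chr k y = Complex (cos (\<theta> y)) (sin (\<theta> y))" for y
    by (simp add: chr_def \<theta>_def cis.code)
  have per: "periodic (\<lambda>y. cos (\<theta> y))" "periodic (\<lambda>y. sin (\<theta> y))"
    using periodic_chr[of k] by (simp_all add: periodic_def chr)
  have mt [measurable]: "\<theta> \<in> borel_measurable borel" by (rule borel_measurable_continuous_onI[OF c\<theta>])
  have LLe: "L ?e = w" by (simp add: L e w_def)
  have "(LINT y:cbox 0 1|lborel. f y * blinfun_apply ((- sin (\<theta> y)) *\<^sub>R L) ?e) = - (LINT y:cbox 0 1|lborel. g y * cos (\<theta> y))"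
  proof -
    have "((\<lambda>y. cos (\<theta> y)) has_derivative blinfun_apply ((- sin (\<theta> y)) *\<^sub>R L)) (at y)" for y
      by (rule has_derivative_eq_rhs[OF has_derivative_cos[OF d\<theta>]]) (simp add: fun_eq_iff blinfun.bilinear_simps)
    moreover have "continuous_on UNIV (\<lambda>y. (- sin (\<theta> y)) *\<^sub>R L)" by (intro continuous_intros c\<theta>)
    ultimately show ?thesis using per(1) by (intro test)
  qed
  moreover have "(\<lambda>y. f y * blinfun_apply ((- sin (\<theta> y)) *\<^sub>R L) ?e) = (\<lambda>y. - w * (f y * sin (\<theta> y)))"
    by (simp add: fun_eq_iff blinfun.bilinear_simps LLe)
  moreover have "(LINT y:cbox 0 1|lborel. - w * (f y * sin (\<theta> y))) = (LINT y|cell. - w * (f y * sin (\<theta> y)))"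
    "(LINT y:cbox 0 1|lborel. g y * cos (\<theta> y)) = (LINT y|cell. g y * cos (\<theta> y))"
    by (rule set_integral_cbox_eq; measurable)+
  ultimately have C: "w * (LINT y|cell. f y * sin (\<theta> y)) = (LINT y|cell. g y * cos (\<theta> y))"
    by simp
  have "(LINT y:cbox 0 1|lborel. f y * blinfun_apply (cos (\<theta> y) *\<^sub>R L) ?e) = - (LINT y:cbox 0 1|lborel. g y * sin (\<theta> y))"
  proof -
    have "((\<lambda>y. sin (\<theta> y)) has_derivative blinfun_apply (cos (\<theta> y) *\<^sub>R L)) (at y)" for y
      by (rule has_derivative_eq_rhs[OF has_derivative_sin[OF d\<theta>]]) (simp add: fun_eq_iff blinfun.bilinear_simps)
    moreover have "continuous_on UNIV (\<lambda>y. cos (\<theta> y) *\<^sub>R L)" by (intro continuous_intros c\<theta>)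
    ultimately show ?thesis using per(2) by (intro test)
  qed
  moreover have "(\<lambda>y. f y * blinfun_apply (cos (\<theta> y) *\<^sub>R L) ?e) = (\<lambda>y. w * (f y * cos (\<theta> y)))"
    by (simp add: fun_eq_iff blinfun.bilinear_simps LLe)
  moreover have "(LINT y:cbox 0 1|lborel. w * (f y * cos (\<theta> y))) = (LINT y|cell. w * (f y * cos (\<theta> y)))"
    "(LINT y:cbox 0 1|lborel. g y * sin (\<theta> y)) = (LINT y|cell. g y * sin (\<theta> y))"
    by (rule set_integral_cbox_eq; measurable)+
  ultimately have S: "w * (LINT y|cell. f y * cos (\<theta> y)) = - (LINT y|cell. g y * sin (\<theta> y))"
    by simp
  have split: "(LINT y|cell. of_real (h y) * cnj (chr k y)) = Complex (LINT y|cell. h y * cos (\<theta> y)) (- (LINT y|cell. h y * sin (\<theta> y)))"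
    if "integrable cell h" for h
  proof -
    have i: "integrable cell (\<lambda>y. complex_of_real (h y) * cnj (chr k y))"
      using that by (intro integrable_mult_cnj_chr) simp
    show ?thesis
      using integral_Re[OF i] integral_Im[OF i] by (simp add: complex_eq_iff chr)
  qed
  show "fourier_int g k =
      2 * of_real pi * \<i> * of_int (k $ i) *
      fourier_int f k"
    unfolding fourier_cell[OF m(1)] fourier_cell[OF m(2)] split[OF int(1)] split[OF int(2)]
    using C S by (simp add: complex_eq_iff w_def)
qed

text \<open>The Fourier coefficients of a weak derivative are determined by those of
  \<open>f\<close>, so uniqueness of coefficients supplies the uniqueness required by
  \<open>THE\<close>.\<close>

lemma weak_partial_eqI: "has_weak_partial f i g \<Longrightarrow> weak_partial i f = g"
  unfolding weak_partial_def
  by (rule the_equality)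
    (auto intro!: fourier_eqI dest: has_weak_partial_L1 simp: has_weak_partial_fourier)

lemma torus_L2_L1:
  fixes f :: "'n::finite torus_fun"
  shows "f \<in> torus_L2 \<Longrightarrow> torus_L1 f"
  unfolding torus_L2_def mem_Collect_eq
proof transfer
  fix f :: "real^'n \<Rightarrow> real"
  assume "torus_eq f f" and i: "set_integrable lborel (cbox 0 1) (\<lambda>y. f y * f y)"
  then have m [measurable]: "f \<in> borel_measurable borel" by (auto simp: torus_eq_refl)
  have "integrable cell (\<lambda>y. f y * f y)" using i by (simp add: set_integrable_cbox_eq)
  then have "integrable cell (\<lambda>y. 1 + f y * f y)" by simp
  then have "integrable cell f"
  proof (rule Bochner_Integration.integrable_bound)
    show "AE y in cell. norm (f y) \<le> norm (1 + f y * f y)"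
    proof (rule AE_I2)
      fix y
      have "0 \<le> (1 - \<bar>f y\<bar>)\<^sup>2" by simp
      then have "\<bar>f y\<bar> \<le> 1 + f y * f y"
        by (simp add: power2_eq_square algebra_simps)
      then show "norm (f y) \<le> norm (1 + f y * f y)" by simp
    qed
  qed simp
  then show "set_integrable lborel (cbox 0 1) f" by (simp add: set_integrable_cbox_eq)
qed

text \<open>The bound is the integral of \<open>f\<^sup>2\<close>, from expanding the squared
  distance of \<open>f\<close> to a finite Fourier sum. It is needed to make the coefficients of
  \<Phi> tend to zero.\<close>

lemma bessel:
  fixes f :: "'n::finite torus_fun"
  shows "f \<in> torus_L2 \<Longrightarrow> \<exists>B. \<forall>F. finite F \<longrightarrow> (\<Sum>k\<in>F. (norm (fourier f k))\<^sup>2) \<le> B"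
proof -
  assume f: "f \<in> torus_L2"
  then have L1: "torus_L1 f" "torus_L1 (f * f)" by (auto intro: torus_L2_L1 simp: torus_L2_def)
  show ?thesis using L1
  proof transfer
    fix f :: "real^'n \<Rightarrow> real"
    assume "torus_eq f f" and i: "set_integrable lborel (cbox 0 1) f" "set_integrable lborel (cbox 0 1) (\<lambda>y. f y * f y)"
    then have m [measurable]: "f \<in> borel_measurable borel" by (auto simp: torus_eq_refl)
    have int: "integrable cell f" "integrable cell (\<lambda>y. f y * f y)" using i by (simp_all add: set_integrable_cbox_eq)
    define a where "a k = (LINT y|cell. of_real (f y) * cnj (chr k y))" for k
    have "(\<Sum>k\<in>F. (norm (a k))\<^sup>2) \<le> (LINT y|cell. f y * f y)" if F: "finite F" for F
    proof -
      define S where "S y = (\<Sum>k\<in>F. a k * chr k y)" for y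
      define A where "A = (\<Sum>k\<in>F. (norm (a k))\<^sup>2)"
      have iS: "integrable cell (\<lambda>y. of_real (f y) * cnj (S y))"
        unfolding S_def cnj_sum complex_cnj_mult sum_distrib_left
        using int by (intro Bochner_Integration.integrable_sum)
          (auto simp: mult.left_commute intro!: integrable_mult_cnj_chr)
      have "(LINT y|cell. of_real (f y) * cnj (S y)) = (LINT y|cell. (\<Sum>k\<in>F. cnj (a k) * (of_real (f y) * cnj (chr k y))))"
        by (simp add: S_def sum_distrib_left mult_ac)
      also have "\<dots> = (\<Sum>k\<in>F. cnj (a k) * a k)"
        using int by (subst Bochner_Integration.integral_sum) (auto simp: a_def intro!: integrable_mult_cnj_chr)
      also have "\<dots> = of_real A"
        unfolding A_def of_real_sum by (intro sum.cong refl) (simp only: complex_norm_square mult.commute)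
      finally have fS: "(LINT y|cell. of_real (f y) * cnj (S y)) = of_real A" .
      have ic: "integrable cell (\<lambda>y. b * chr k y)" for b k
        using integrable_cell_bounded[of "chr k" 1] by simp
      have SS: "S y * cnj (S y) = (\<Sum>j\<in>F. \<Sum>k\<in>F. a j * cnj (a k) * chr (j - k) y)" for y
        by (simp add: S_def sum_product chr_diff_index mult_ac)
      have iSS: "integrable cell (\<lambda>y. S y * cnj (S y))"
        unfolding SS by (intro Bochner_Integration.integrable_sum ic)
      have "(LINT y|cell. S y * cnj (S y)) = (\<Sum>j\<in>F. LINT y|cell. (\<Sum>k\<in>F. a j * cnj (a k) * chr (j - k) y))"
        unfolding SS by (intro Bochner_Integration.integral_sum Bochner_Integration.integrable_sum ic)
      also have "\<dots> = (\<Sum>j\<in>F. \<Sum>k\<in>F. LINT y|cell. a j * cnj (a k) * chr (j - k) y)"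
        by (intro sum.cong refl Bochner_Integration.integral_sum ic)
      also have "\<dots> = (\<Sum>j\<in>F. \<Sum>k\<in>F. a j * cnj (a k) * (if j = k then 1 else 0))"
        by (simp add: integral_chr)
      also have "\<dots> = (\<Sum>j\<in>F. a j * cnj (a j))"
        using F by (intro sum.cong refl) (simp add: if_distrib cong: if_cong)
      also have "\<dots> = of_real A"
        unfolding A_def of_real_sum by (intro sum.cong refl) (simp only: complex_norm_square)
      finally have SA: "(LINT y|cell. S y * cnj (S y)) = of_real A" .
      \<comment> \<open>The integrand is the squared modulus of \<open>f y - S y\<close>; with the
        two integrals just computed, \<open>- 2 * A + A\<close> leaves \<open>- A\<close>.\<close>
      have "0 \<le> (LINT y|cell. f y * f y - 2 * Re (of_real (f y) * cnj (S y)) + Re (S y * cnj (S y)))"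
      proof (rule integral_nonneg_AE, rule AE_I2)
        fix y
        have "f y * f y - 2 * Re (of_real (f y) * cnj (S y)) + Re (S y * cnj (S y))
            = (f y - Re (S y))\<^sup>2 + (Im (S y))\<^sup>2"
          by (simp add: power2_eq_square algebra_simps)
        then show "0 \<le> f y * f y - 2 * Re (of_real (f y) * cnj (S y)) + Re (S y * cnj (S y))" by simp
      qed
      also have "\<dots> = (LINT y|cell. f y * f y) - 2 * Re (LINT y|cell. of_real (f y) * cnj (S y)) + Re (LINT y|cell. S y * cnj (S y))"
        using int(2) integrable_Re[OF iS] integrable_Re[OF iSS] integral_Re[OF iS] integral_Re[OF iSS] by simp
      also have "\<dots> = (LINT y|cell. f y * f y) - A" by (simp only: fS SA) simp
      finally show ?thesis by (simp add: A_def)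
    qed
    then show "\<exists>B. \<forall>F. finite F \<longrightarrow> (\<Sum>k\<in>F. (norm (fourier_int f k))\<^sup>2) \<le> B"
      unfolding fourier_cell[OF m] a_def by blast
  qed
qed

section \<open>Functions with weighted absolutely summable Fourier coefficients\<close>

text \<open>The weighted Wiener algebra. For nonnegative order it is closed under products, and a
  derivative costs one unit of order. Elements of \<open>X_space s\<close> have order 2, so both
  derivatives in the equation are again absolutely convergent series.\<close>

definition wiener :: "real \<Rightarrow> 'n::finite torus_fun \<Rightarrow> bool" where
  "wiener r f \<longleftrightarrow> torus_L1 f \<and> (\<lambda>k. wt r k * norm (fourier f k)) summable_on UNIV"

lemma wiener_L1: "wiener r f \<Longrightarrow> torus_L1 f"
  by (simp add: wiener_def)

lemma wiener_mono: "wiener r f \<Longrightarrow> q \<le> r \<Longrightarrow> wiener q f"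
  unfolding wiener_def by (auto intro: summable_on_comparison_test intro!: mult_right_mono wt_mono)

lemma wiener_norm_summable: "wiener r f \<Longrightarrow> 0 \<le> r \<Longrightarrow> (\<lambda>k. norm (fourier f k)) summable_on UNIV"
  using wiener_mono[of r f 0] by (simp add: wiener_def)

lemma wiener_hermitian: "wiener r f \<Longrightarrow> 0 \<le> r \<Longrightarrow> hermitian (fourier f)"
  by (simp add: hermitian_def fourier_hermitian wiener_norm_summable)

lemma trig_fun_fourier: "wiener r f \<Longrightarrow> 0 \<le> r \<Longrightarrow> trig_fun (fourier f) = f"
  by (rule fourier_eqI) (auto simp: fourier_trig_fun wiener_hermitian torus_L1_trig_fun wiener_L1)

lemma hermitian_weighted:
  assumes "0 \<le> r" "(\<lambda>k. wt r k * norm (c k)) summable_on UNIV" "\<And>k. c (- k) = cnj (c k)"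
  shows "hermitian c"
  unfolding hermitian_def
proof
  show "(\<lambda>k. norm (c k)) summable_on UNIV"
  proof (rule summable_on_comparison_test[OF assms(2)])
    show "norm (c k) \<le> wt r k * norm (c k)" for k
      using mult_right_mono[OF one_le_wt[OF assms(1), of k], of "norm (c k)"] by simp
  qed simp
qed (simp add: assms)

lemma wiener_trig_fun:
  assumes "0 \<le> r" "(\<lambda>k. wt r k * norm (c k)) summable_on UNIV" "\<And>k. c (- k) = cnj (c k)"
  shows "wiener r (trig_fun c)" "fourier (trig_fun c) = c"
  using hermitian_weighted[OF assms] assms by (auto simp: wiener_def torus_L1_trig_fun fourier_trig_fun)

lemma wiener_add [intro]: "wiener r f \<Longrightarrow> wiener r g \<Longrightarrow> wiener r (f + g)"
  unfolding wiener_def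
proof (elim conjE, intro conjI)
  assume L: "torus_L1 f" "torus_L1 g"
    and s: "(\<lambda>k. wt r k * norm (fourier f k)) summable_on UNIV" "(\<lambda>k. wt r k * norm (fourier g k)) summable_on UNIV"
  show "torus_L1 (f + g)" using L ..
  show "(\<lambda>k. wt r k * norm (fourier (f + g) k)) summable_on UNIV"
  proof (rule summable_on_comparison_test[OF summable_on_add[OF s]])
    show "wt r k * norm (fourier (f + g) k) \<le> wt r k * norm (fourier f k) + wt r k * norm (fourier g k)" for k
      unfolding fourier_add[OF L] distrib_left[symmetric] by (intro mult_left_mono norm_triangle_ineq) simp
  qed simp
qed

lemma wiener_scaleR [intro]: "wiener r f \<Longrightarrow> wiener r (c *\<^sub>R f)"
  unfolding wiener_def
  by (auto simp: fourier_scaleR norm_mult mult.left_commute[of _ "\<bar>c\<bar>"] intro: summable_on_cmult_right)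

lemma wiener_of_real [intro, simp]: "wiener r (of_real c)"
  unfolding wiener_def
proof
  show "(\<lambda>k. wt r k * norm (fourier (of_real c :: 'a torus_fun) k)) summable_on UNIV"
    by (rule has_sum_imp_summable, rule has_sum_finite_neutralI[of "{0}"]) (auto simp: fourier_of_real)
qed simp

lemma wiener_0 [intro, simp]: "wiener r 0"
  using wiener_of_real[of r 0] by simp

lemma wiener_sum [intro]: "(\<And>i. i \<in> A \<Longrightarrow> wiener r (f i)) \<Longrightarrow> wiener r (\<Sum>i\<in>A. f i)"
  by (induction A rule: infinite_finite_induct) auto

lemma fourier_sum: "(\<And>i. i \<in> A \<Longrightarrow> wiener r (f i)) \<Longrightarrow> fourier (\<Sum>i\<in>A. f i) k = (\<Sum>i\<in>A. fourier (f i) k)"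
proof (induction A rule: infinite_finite_induct)
  case (insert x A)
  then have "torus_L1 (f x)" "torus_L1 (\<Sum>i\<in>A. f i)" by (auto intro!: wiener_L1[of r])
  then show ?case using insert by (simp add: fourier_add)
qed auto

lemma has_sum_finite_sum:
  fixes f :: "'i \<Rightarrow> 'a \<Rightarrow> 'b::topological_comm_monoid_add"
  assumes "\<And>i. i \<in> A \<Longrightarrow> (f i has_sum S i) U"
  shows "((\<lambda>x. \<Sum>i\<in>A. f i x) has_sum (\<Sum>i\<in>A. S i)) U"
  using assms by (induction A rule: infinite_finite_induct) (auto intro: has_sum_add)

text \<open>The shear \<open>(k, j) \<mapsto> (j, k - j)\<close> turns the double sum into a product
  of two sums.\<close>

lemma summable_convolution:
  fixes a b :: "int^'n \<Rightarrow> real"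
  assumes a: "a summable_on UNIV" "\<And>k. 0 \<le> a k" and b: "b summable_on UNIV" "\<And>k. 0 \<le> b k"
  shows "(\<lambda>j. a j * b (k - j)) summable_on UNIV"
    and "(\<lambda>k. \<Sum>\<^sub>\<infinity>j. a j * b (k - j)) summable_on UNIV"
proof -
  have s: "(\<lambda>(j, k). a j * b k) summable_on UNIV \<times> UNIV"
  proof (rule summable_on_SigmaI[where g="\<lambda>j. a j * infsum b UNIV"])
    show "((\<lambda>k. case (j, k) of (j, k) \<Rightarrow> a j * b k) has_sum a j * infsum b UNIV) UNIV" for j
      using has_sum_cmult_right[OF has_sum_infsum[OF b(1)]] by simp
    show "(\<lambda>j. a j * infsum b UNIV) summable_on UNIV" by (intro summable_on_cmult_left a)
  qed (use a b in auto)
  have bij: "bij_betw (\<lambda>(k, j). (j, k - j)) (UNIV \<times> UNIV) (UNIV \<times> (UNIV :: (int^'n) set))"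
    by (rule bij_betw_byWitness[of _ "\<lambda>(j, l). (l + j, j)"]) auto
  have s': "(\<lambda>(k, j). a j * b (k - j)) summable_on UNIV \<times> UNIV"
    using summable_on_reindex_bij_betw[OF bij, of "\<lambda>(j, k). a j * b k"] s by (simp add: case_prod_unfold)
  show "(\<lambda>k. \<Sum>\<^sub>\<infinity>j. a j * b (k - j)) summable_on UNIV"
    by (rule summable_on_Sigma_banach[OF s'])
  show "(\<lambda>j. a j * b (k - j)) summable_on UNIV"
    using summable_on_SigmaD1[OF s'] by simp
qed

lemma has_sum_fourier_mult:
  assumes "wiener 0 f" "torus_L1 g"
  shows "((\<lambda>j. fourier f j * fourier g (k - j)) has_sum fourier (f * g) k) UNIV"
  using has_sum_fourier_trig_fun_mult[OF wiener_hermitian[OF assms(1)] assms(2), of k] trig_fun_fourier[OF assms(1)] by simp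

text \<open>For nonnegative order both brackets are at least 1, so \<open>wt_triangle\<close> makes
  the weight submultiplicative up to a constant, and the weighted coefficients are dominated by a
  convolution of summable sequences.\<close>

lemma wiener_mult:
  assumes f: "wiener r f" and g: "wiener r g" and r: "0 \<le> r"
  shows "wiener r (f * g)"
  unfolding wiener_def
proof
  have f0: "wiener 0 f" using f r by (rule wiener_mono)
  show "torus_L1 (f * g)"
    using torus_L1_trig_fun_mult[OF wiener_hermitian[OF f r] wiener_L1[OF g]] trig_fun_fourier[OF f r] by simp
  define a where "a k = wt r k * norm (fourier f k)" for k
  define b where "b k = wt r k * norm (fourier g k)" for k
  have ab: "a summable_on UNIV" "\<And>k. 0 \<le> a k" "b summable_on UNIV" "\<And>k. 0 \<le> b k"
    using f g by (auto simp: wiener_def a_def[abs_def] b_def[abs_def])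
  define C where "C = 2 * 2 powr r"
  have wt: "wt r k \<le> C * (wt r j * wt r (k - j))" for k j
  proof -
    have "wt r j \<le> wt r j * wt r (k - j)" "wt r (k - j) \<le> wt r j * wt r (k - j)"
      using mult_left_mono[OF one_le_wt[OF r, of "k - j"], of "wt r j"]
        mult_right_mono[OF one_le_wt[OF r, of j], of "wt r (k - j)"] by auto
    then have "wt r j + wt r (k - j) \<le> 2 * (wt r j * wt r (k - j))" by linarith
    then have "2 powr r * (wt r j + wt r (k - j)) \<le> 2 powr r * (2 * (wt r j * wt r (k - j)))"
      by (rule mult_left_mono) simp
    then have "wt r k \<le> 2 powr r * (2 * (wt r j * wt r (k - j)))" using wt_triangle[OF r, of k j] by linarith
    then show ?thesis by (simp add: C_def mult_ac)
  qed
  have le: "wt r k * norm (fourier f j * fourier g (k - j)) \<le> C * (a j * b (k - j))" for k j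
    using mult_right_mono[OF wt[of k j], of "norm (fourier f j) * norm (fourier g (k - j))"]
    by (simp add: a_def b_def norm_mult mult_ac)
  note sab = summable_convolution[OF ab]
  have s: "(\<lambda>j. norm (fourier f j * fourier g (k - j))) summable_on UNIV" for k
  proof (rule summable_on_comparison_test[OF summable_on_cmult_right[OF sab(1)[of k], of C]])
    show "norm (fourier f j * fourier g (k - j)) \<le> C * (a j * b (k - j))" for j
      using le[of k j] mult_right_mono[OF one_le_wt[OF r, of k], of "norm (fourier f j * fourier g (k - j))"] by simp
  qed simp
  show "(\<lambda>k. wt r k * norm (fourier (f * g) k)) summable_on UNIV"
  proof (rule summable_on_comparison_test[OF summable_on_cmult_right[OF sab(2), of C]])
    fix k
    have "norm (fourier (f * g) k) \<le> (\<Sum>\<^sub>\<infinity>j. norm (fourier f j * fourier g (k - j)))"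
      using norm_infsum_bound[OF s[of k]] infsumI[OF has_sum_fourier_mult[OF f0 wiener_L1[OF g], of k]] by simp
    then have "wt r k * norm (fourier (f * g) k) \<le> wt r k * (\<Sum>\<^sub>\<infinity>j. norm (fourier f j * fourier g (k - j)))"
      by (rule mult_left_mono) simp
    also have "\<dots> = (\<Sum>\<^sub>\<infinity>j. wt r k * norm (fourier f j * fourier g (k - j)))"
      by (rule infsum_cmult_right'[symmetric])
    also have "\<dots> \<le> (\<Sum>\<^sub>\<infinity>j. C * (a j * b (k - j)))"
      by (rule infsum_mono[OF summable_on_cmult_right[OF s] summable_on_cmult_right[OF sab(1)] le])
    also have "\<dots> = C * (\<Sum>\<^sub>\<infinity>j. a j * b (k - j))" by (rule infsum_cmult_right')
    finally show "wt r k * norm (fourier (f * g) k) \<le> C * (\<Sum>\<^sub>\<infinity>j. a j * b (k - j))" .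
  qed simp
qed

lemma wiener_convolution:
  assumes P: "torus_L1 P" and f: "wiener r f" and r: "0 \<le> r"
  shows "wiener r (convolution P f)" "fourier (convolution P f) k = fourier P k * fourier f k"
proof -
  obtain B where B: "\<And>k. norm (fourier P k) \<le> B" using fourier_bound[OF P] by blast
  have c: "convolution P f = trig_fun (\<lambda>k. fourier P k * fourier f k)"
    using convolution_trig_fun[OF wiener_hermitian[OF f r] P] trig_fun_fourier[OF f r] by simp
  have "(\<lambda>k. wt r k * norm (fourier P k * fourier f k)) summable_on UNIV"
  proof (rule summable_on_comparison_test)
    show "(\<lambda>k. B * (wt r k * norm (fourier f k))) summable_on UNIV"
      using f by (intro summable_on_cmult_right) (simp add: wiener_def)
    show "wt r k * norm (fourier P k * fourier f k) \<le> B * (wt r k * norm (fourier f k))" for k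
      using mult_right_mono[OF B[of k], of "wt r k * norm (fourier f k)"] by (simp add: norm_mult mult_ac)
  qed simp
  from wiener_trig_fun[OF r this]
  show "wiener r (convolution P f)" "fourier (convolution P f) k = fourier P k * fourier f k"
    unfolding c by (simp_all add: fourier_hermitian)
qed

text \<open>A component of \<open>k\<close> is at most \<open>wt 1 k\<close> in modulus, which is
  the one unit of order that is spent.\<close>

lemma wiener_weak_partial:
  fixes f :: "'n::finite torus_fun"
  assumes f: "wiener (r + 1) f" and r: "0 \<le> r"
  shows "has_weak_partial f i (weak_partial i f)" "wiener r (weak_partial i f)"
    "fourier (weak_partial i f) k = 2 * of_real pi * \<i> * of_int (k $ i) * fourier f k"
proof -
  define d where "d k = 2 * of_real pi * \<i> * of_int (k $ i) * fourier f k" for k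
  have s: "(\<lambda>k. wt r k * norm (d k)) summable_on UNIV"
  proof (rule summable_on_comparison_test)
    show "(\<lambda>k. (2 * pi) * (wt (r + 1) k * norm (fourier f k))) summable_on UNIV"
      using f by (intro summable_on_cmult_right) (simp add: wiener_def)
    show "wt r k * norm (d k) \<le> (2 * pi) * (wt (r + 1) k * norm (fourier f k))" for k
    proof -
      have "\<bar>int_vec k $ i\<bar> \<le> wt 1 k"
        using component_le_norm_cart[of "int_vec k" i] norm_le_wt_1[of k] by linarith
      then have "\<bar>of_int (k $ i) :: real\<bar> \<le> wt 1 k" by (simp add: int_vec_def)
      from mult_right_mono[OF this, of "2 * pi * (wt r k * norm (fourier f k))"]
      show ?thesis by (simp add: d_def norm_mult wt_add mult_ac)
    qed
  qed simp
  have sym: "d (- k) = cnj (d k)" for k by (simp add: d_def fourier_hermitian)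
  have "has_weak_partial (trig_fun (fourier f)) i (trig_fun d)"
    using f r by (intro has_weak_partial_trig_fun wiener_hermitian[of "r + 1"] hermitian_weighted[OF r s sym])
      (auto simp: d_def)
  then have w: "has_weak_partial f i (trig_fun d)" using trig_fun_fourier[OF f] r by simp
  then have e: "weak_partial i f = trig_fun d" by (rule weak_partial_eqI)
  show "has_weak_partial f i (weak_partial i f)" using w e by simp
  show "wiener r (weak_partial i f)" unfolding e by (rule wiener_trig_fun(1)[OF r s sym])
  show "fourier (weak_partial i f) k = 2 * of_real pi * \<i> * of_int (k $ i) * fourier f k"
    unfolding e wiener_trig_fun(2)[OF r s sym] by (simp add: d_def)
qed

lemma weak_partial_add:
  assumes "wiener 1 f" "wiener 1 g"
  shows "weak_partial i (f + g) = weak_partial i f + weak_partial i g"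
proof -
  have "wiener (0 + 1) f" "wiener (0 + 1) g" "wiener (0 + 1) (f + g)" using assms by auto
  note w = this[THEN wiener_weak_partial(2)[OF _ order_refl], THEN wiener_L1] this[THEN wiener_weak_partial(3)[OF _ order_refl]]
  show ?thesis
    using assms[THEN wiener_L1]
    by (intro fourier_eqI torus_L1_add w(1-3)) (simp add: w fourier_add distrib_left)
qed

lemma weak_partial_scaleR:
  assumes "wiener 1 f"
  shows "weak_partial i (c *\<^sub>R f) = c *\<^sub>R weak_partial i f"
proof -
  have "wiener (0 + 1) f" "wiener (0 + 1) (c *\<^sub>R f)" using assms by auto
  note w = this[THEN wiener_weak_partial(2)[OF _ order_refl], THEN wiener_L1] this[THEN wiener_weak_partial(3)[OF _ order_refl]]
  show ?thesis
    by (intro fourier_eqI torus_L1_scaleR w(1-2)) (simp add: w fourier_scaleR)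
qed

lemma weak_partial_of_real_add:
  assumes "wiener 1 v"
  shows "weak_partial i (of_real c + v) = weak_partial i v"
proof -
  have "wiener (0 + 1) v" "wiener (0 + 1) (of_real c + v)" using assms by auto
  note w = this[THEN wiener_weak_partial(2)[OF _ order_refl], THEN wiener_L1] this[THEN wiener_weak_partial(3)[OF _ order_refl]]
  show ?thesis
    using assms[THEN wiener_L1]
    by (intro fourier_eqI w(1-2)) (simp add: w fourier_add fourier_of_real)
qed

section \<open>The equation in terms of Fourier coefficients\<close>

context
  fixes \<Phi> v :: "'n::finite torus_fun" and a c :: real
  assumes \<Phi>: "torus_L1 \<Phi>" and v: "wiener 2 v"
begin

text \<open>The orders \<open>1 + 1\<close> and \<open>0 + 1\<close> are left unevaluated to match
  the order \<open>r + 1\<close> in \<open>wiener_weak_partial\<close>.\<close>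

lemma v1: "wiener (1 + 1) v" "wiener (0 + 1) v" "wiener 1 v" "wiener 0 v"
  using v wiener_mono[OF v] by auto

lemma u1: "wiener 2 (of_real c + v)" "wiener 1 (of_real c + v)" "wiener 0 (of_real c + v)"
  using v v1 by auto

lemma partial_v: "wiener 1 (weak_partial i v)" "wiener (0 + 1) (weak_partial i v)"
  using wiener_weak_partial(2)[OF v1(1), of i] by auto

lemma partial_u: "weak_partial i (of_real c + v) = weak_partial i v"
  by (rule weak_partial_of_real_add[OF v1(3)])

lemma flux: "wiener 1 ((of_real c + v) * convolution \<Phi> (weak_partial i v))"
    "wiener (0 + 1) ((of_real c + v) * convolution \<Phi> (weak_partial i v))"
  using wiener_mult[OF u1(2) wiener_convolution(1)[OF \<Phi> partial_v(1)]] by auto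

lemma bif_map_eq:
  "bif_map a \<Phi> c v = a *\<^sub>R (\<Sum>i\<in>UNIV. weak_partial i (weak_partial i v)) +
     (\<Sum>i\<in>UNIV. weak_partial i ((of_real c + v) * convolution \<Phi> (weak_partial i v)))"
  by (simp add: bif_map_def laplacian_def divergence_def grad_def conv_field_def partial_u distrib_right)

lemma wiener_bif_map: "wiener 0 (bif_map a \<Phi> c v)"
  unfolding bif_map_eq
  by (intro wiener_add wiener_scaleR wiener_sum wiener_weak_partial(2)[OF partial_v(2)] wiener_weak_partial(2)[OF flux(2)]) auto

text \<open>Both \<open>u\<close> and the flux have order 1, so the differentiability demanded of a
  solution is automatic; what remains is linearity of the divergence, with the gradient of
  \<open>of_real c + v\<close> equal to that of \<open>v\<close>.\<close>

lemma is_solution_iff: "is_solution a \<Phi> (of_real c + v) \<longleftrightarrow> bif_map a \<Phi> c v = 0"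
proof -
  define J where "J i = a *\<^sub>R weak_partial i v + (of_real c + v) * convolution \<Phi> (weak_partial i v)" for i
  have J: "wiener 1 (J i)" "wiener (0 + 1) (J i)" for i
    unfolding J_def using partial_v(1)[of i] flux(1)[of i] by auto
  have eq: "(a *\<^sub>R grad (of_real c + v) + (of_real c + v) *s conv_field \<Phi> (grad (of_real c + v))) = (\<chi> i. J i)"
    by (simp add: vec_eq_iff grad_def conv_field_def partial_u J_def distrib_right)
  have wd: "weakly_differentiable g" if "wiener (0 + 1) g" for g :: "'n torus_fun"
    unfolding weakly_differentiable_def using wiener_weak_partial(1)[OF that order_refl] by blast
  have "weak_partial i (J i) = a *\<^sub>R weak_partial i (weak_partial i v)
      + weak_partial i ((of_real c + v) * convolution \<Phi> (weak_partial i v))" for i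
    unfolding J_def
    using partial_v(1)[of i] flux(1)[of i] by (subst weak_partial_add) (auto simp: weak_partial_scaleR)
  then have "divergence (\<chi> i. J i) = bif_map a \<Phi> c v"
    unfolding bif_map_eq divergence_def by (simp add: sum.distrib scaleR_sum_right)
  then show ?thesis
    unfolding is_solution_def Let_def eq using wd[OF J(2)] wd[of "of_real c + v"] u1 by simp
qed

text \<open>Two derivatives contribute \<open>2 * pi * \<i>\<close> twice, once with
  \<open>k\<close> from the divergence and once with \<open>j\<close> from the gradient; summing
  over the components gives the inner product of \<open>k\<close> and \<open>j\<close>.\<close>

lemma fourier_bif_map:
  assumes S: "((\<lambda>j. of_real (int_vec k \<bullet> int_vec j) * fourier \<Phi> j * fourier v j * fourier v (k - j)) has_sum S) UNIV"
  shows "fourier (bif_map a \<Phi> c v) k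
    = - (4 * of_real pi ^ 2) * (of_real ((norm (int_vec k))\<^sup>2) * (of_real a + of_real c * fourier \<Phi> k) * fourier v k + S)"
proof -
  let ?w = "2 * of_real pi * \<i> :: complex"
  have w2: "?w * ?w = - (4 * of_real pi ^ 2)" by (simp add: power2_eq_square)
  have k2: "(\<Sum>i\<in>UNIV. of_int (k $ i) * of_int (j $ i)) = (of_real (int_vec k \<bullet> int_vec j) :: complex)" for j
    by (simp add: inner_vec_def int_vec_def)
  define q where "q i = convolution \<Phi> (weak_partial i v)" for i
  have q: "wiener 0 (q i)" "fourier (q i) j = fourier \<Phi> j * (?w * of_int (j $ i) * fourier v j)" for i j
    using wiener_convolution[OF \<Phi> wiener_weak_partial(2)[OF v1(2)], of i] wiener_weak_partial(3)[OF v1(2), of i]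
    by (simp_all add: q_def)
  have "((\<lambda>j. fourier (q i) j * fourier (of_real c + v) (k - j)) has_sum fourier (q i * (of_real c + v)) k) UNIV" for i
    by (rule has_sum_fourier_mult[OF q(1) wiener_L1[OF u1(1)]])
  from has_sum_cmult_right[OF this]
  have "((\<lambda>j. \<Sum>i\<in>UNIV. (?w * of_int (k $ i)) * (fourier (q i) j * fourier (of_real c + v) (k - j)))
      has_sum (\<Sum>i\<in>UNIV. (?w * of_int (k $ i)) * fourier (q i * (of_real c + v)) k)) UNIV"
    by (intro has_sum_finite_sum) auto
  also have "(\<lambda>j. \<Sum>i\<in>UNIV. (?w * of_int (k $ i)) * (fourier (q i) j * fourier (of_real c + v) (k - j)))
      = (\<lambda>j. (?w * ?w) * (of_real (int_vec k \<bullet> int_vec j) * fourier \<Phi> j * fourier v j * fourier (of_real c + v) (k - j)))"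
    by (rule ext) (simp add: q k2[symmetric] sum_distrib_left sum_distrib_right mult_ac)
  finally have A: "((\<lambda>j. (?w * ?w) * (of_real (int_vec k \<bullet> int_vec j) * fourier \<Phi> j * fourier v j * fourier (of_real c + v) (k - j)))
      has_sum (\<Sum>i\<in>UNIV. (?w * of_int (k $ i)) * fourier (q i * (of_real c + v)) k)) UNIV" .
  \<comment> \<open>A constant has only the zeroth coefficient, so its share of the convolution is
    the term \<open>j = k\<close>: the linear part proportional to \<open>c\<close>.\<close>
  have "((\<lambda>j. of_real (int_vec k \<bullet> int_vec j) * fourier \<Phi> j * fourier v j * fourier (of_real c) (k - j))
      has_sum (of_real (int_vec k \<bullet> int_vec k) * fourier \<Phi> k * fourier v k * of_real c)) UNIV"
    by (rule has_sum_finite_neutralI[of "{k}"]) (auto simp: fourier_of_real)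
  from has_sum_cmult_right[OF has_sum_add[OF this S], of "?w * ?w"]
  have "((\<lambda>j. (?w * ?w) * (of_real (int_vec k \<bullet> int_vec j) * fourier \<Phi> j * fourier v j * fourier (of_real c + v) (k - j)))
      has_sum (?w * ?w) * (of_real (int_vec k \<bullet> int_vec k) * fourier \<Phi> k * fourier v k * of_real c + S)) UNIV"
    by (simp add: fourier_add[OF torus_L1_of_real wiener_L1[OF v]] distrib_left mult_ac)
  with A have B: "(\<Sum>i\<in>UNIV. (?w * of_int (k $ i)) * fourier (q i * (of_real c + v)) k)
      = (?w * ?w) * (of_real (int_vec k \<bullet> int_vec k) * fourier \<Phi> k * fourier v k * of_real c + S)"
    by (rule has_sum_unique)
  have "fourier (\<Sum>i\<in>UNIV. weak_partial i ((of_real c + v) * q i)) k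
      = (\<Sum>i\<in>UNIV. (?w * of_int (k $ i)) * fourier (q i * (of_real c + v)) k)"
    using wiener_weak_partial(2)[OF flux(2)] wiener_weak_partial(3)[OF flux(2)]
    by (subst fourier_sum[of _ 0]) (simp_all add: q_def mult.commute[of "of_real c + v"])
  moreover have "fourier (\<Sum>i\<in>UNIV. weak_partial i (weak_partial i v)) k = (?w * ?w) * (of_real (int_vec k \<bullet> int_vec k) * fourier v k)"
    using wiener_weak_partial(2)[OF partial_v(2)] wiener_weak_partial(3)[OF partial_v(2)] wiener_weak_partial(3)[OF v1(2)]
    by (subst fourier_sum[of _ 0]) (simp_all add: k2[symmetric] sum_distrib_left sum_distrib_right mult_ac)
  moreover have "torus_L1 (\<Sum>i\<in>UNIV. weak_partial i (weak_partial i v))"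
    "torus_L1 (\<Sum>i\<in>UNIV. weak_partial i ((of_real c + v) * q i))"
    unfolding q_def
    by (rule wiener_L1[of 0], intro wiener_sum wiener_weak_partial(2)[OF partial_v(2)] wiener_weak_partial(2)[OF flux(2)], simp)+
  ultimately have "fourier (bif_map a \<Phi> c v) k = of_real a * ((?w * ?w) * (of_real (int_vec k \<bullet> int_vec k) * fourier v k))
      + (?w * ?w) * (of_real (int_vec k \<bullet> int_vec k) * fourier \<Phi> k * fourier v k * of_real c + S)"
    unfolding bif_map_eq q_def[symmetric] by (simp only: fourier_add torus_L1_scaleR fourier_scaleR B)
  then show ?thesis unfolding w2 by (simp add: power2_norm_eq_inner algebra_simps)
qed

end

section \<open>A fixed point problem depending on a parameter\<close>

lemma norm_triangle_ineq3: "norm (x + y + z) \<le> norm x + norm y + norm (z :: 'a::real_normed_vector)"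
  using norm_triangle_ineq[of "x + y" z] norm_triangle_ineq[of x y] by linarith

text \<open>The factor \<open>t\<close> makes the map a contraction for small \<open>t\<close> on a
  ball where \<open>N\<close> is Lipschitz, whatever \<open>N 0\<close> and \<open>N' 0\<close> are.
  The derivative of the fixed point is not guessed from quotients: it is defined by the
  differentiated equation and then verified.\<close>

lemma fixed_point_family:
  fixes N :: "'a::banach \<Rightarrow> 'a" and N' :: "'a \<Rightarrow> 'a \<Rightarrow>\<^sub>L 'a"
  assumes der: "\<And>x. (N has_derivative N' x) (at x)" and cont: "continuous_on UNIV N'"
  obtains \<epsilon> \<rho> \<psi> \<psi>' where "\<epsilon> > 0" "\<rho> > 0"
    "\<And>t. \<bar>t\<bar> < \<epsilon> \<Longrightarrow> norm (\<psi> t) \<le> \<rho> \<and> \<psi> t = t *\<^sub>R N (\<psi> t)"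
    "\<And>t x. \<bar>t\<bar> < \<epsilon> \<Longrightarrow> norm x \<le> \<rho> \<Longrightarrow> x = t *\<^sub>R N x \<Longrightarrow> x = \<psi> t"
    "\<And>t. \<bar>t\<bar> < \<epsilon> \<Longrightarrow> (\<psi> has_vector_derivative \<psi>' t) (at t)"
    "continuous_on {-\<epsilon><..<\<epsilon>} \<psi>'"
proof -
  define M where "M = norm (N' 0) + 1"
  have M: "M > 0" unfolding M_def by (simp add: add_nonneg_pos)
  have "isCont N' 0" using cont by (simp add: continuous_on_eq_continuous_at)
  then obtain \<rho>0 where \<rho>0: "\<rho>0 > 0" "\<And>x. norm x < \<rho>0 \<Longrightarrow> norm (N' x - N' 0) < 1"
    unfolding continuous_at_eps_delta dist_norm by (metis diff_zero zero_less_one)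
  define \<rho> where "\<rho> = \<rho>0 / 2"
  have \<rho>: "\<rho> > 0" using \<rho>0 by (simp add: \<rho>_def)
  have N'M: "norm (N' x) \<le> M" if "norm x \<le> \<rho>" for x
  proof -
    have "norm (N' x - N' 0) < 1" using that \<rho>0 by (intro \<rho>0(2)) (simp add: \<rho>_def)
    then show ?thesis using norm_triangle_sub[of "N' x" "N' 0"] by (simp add: M_def)
  qed
  have lip: "norm (N x - N y) \<le> M * norm (x - y)" if "norm x \<le> \<rho>" "norm y \<le> \<rho>" for x y
  proof (rule differentiable_bound[of "cball 0 \<rho>" N "\<lambda>x. blinfun_apply (N' x)"])
    show "(N has_derivative blinfun_apply (N' z)) (at z within cball 0 \<rho>)" for z
      using der has_derivative_at_withinI by blast
    show "onorm (blinfun_apply (N' z)) \<le> M" if "z \<in> cball 0 \<rho>" for z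
      using N'M[of z] that by (simp add: norm_blinfun.rep_eq)
  qed (use that in auto)
  define A where "A = norm (N 0) + M * \<rho>"
  have A0: "A \<ge> 0" using M \<rho> by (simp add: A_def)
  have NA: "norm (N x) \<le> A" if "norm x \<le> \<rho>" for x
  proof -
    have "M * norm x \<le> M * \<rho>" using that M by (intro mult_left_mono) auto
    moreover have "norm (N x - N 0) \<le> M * norm x" using lip[OF that, of 0] \<rho> by simp
    ultimately show ?thesis using norm_triangle_sub[of "N x" "N 0"] by (simp add: A_def)
  qed
  \<comment> \<open>The first bound keeps the ball invariant, the second makes the Lipschitz
    constant at most \<open>1/2\<close>; the same \<open>1/2\<close> serves the linear equation for
    the derivative.\<close>
  define \<epsilon> where "\<epsilon> = min (\<rho> / (A + 1)) (1 / (2 * M))"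
  have \<epsilon>: "\<epsilon> > 0" using M \<rho> A0 by (simp add: \<epsilon>_def)
  have tA: "\<bar>t\<bar> * A \<le> \<rho>" and tM: "\<bar>t\<bar> * M \<le> 1/2" if "\<bar>t\<bar> < \<epsilon>" for t
  proof -
    have "\<bar>t\<bar> * (A + 1) \<le> \<rho>" using that A0 by (simp add: \<epsilon>_def field_simps)
    then show "\<bar>t\<bar> * A \<le> \<rho>" by (simp add: algebra_simps)
    show "\<bar>t\<bar> * M \<le> 1/2" using that M by (simp add: \<epsilon>_def field_simps)
  qed
  have ex: "\<exists>!x. x \<in> cball 0 \<rho> \<and> t *\<^sub>R N x = x" if t: "\<bar>t\<bar> < \<epsilon>" for t
  proof -
    have "\<exists>!x\<in>cball 0 \<rho>. t *\<^sub>R N x = x"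
    proof (rule Banach_fix[where c="1/2"])
      show "(\<lambda>x. t *\<^sub>R N x) ` cball 0 \<rho> \<subseteq> cball 0 \<rho>"
      proof clarsimp
        fix x :: 'a assume "norm x \<le> \<rho>"
        then show "\<bar>t\<bar> * norm (N x) \<le> \<rho>"
          using mult_left_mono[OF NA, of x "\<bar>t\<bar>"] tA[OF t] by simp
      qed
      show "dist (t *\<^sub>R N x) (t *\<^sub>R N y) \<le> 1/2 * dist x y"
        if "x \<in> cball 0 \<rho>" "y \<in> cball 0 \<rho>" for x y
      proof -
        have "norm (t *\<^sub>R N x - t *\<^sub>R N y) = \<bar>t\<bar> * norm (N x - N y)"
          by (simp flip: scaleR_diff_right)
        also have "\<dots> \<le> \<bar>t\<bar> * (M * norm (x - y))"
          using that by (intro mult_left_mono lip) auto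
        also have "\<dots> \<le> 1/2 * norm (x - y)"
          unfolding mult.assoc[symmetric] by (intro mult_right_mono tM t) auto
        finally show ?thesis by (simp add: dist_norm)
      qed
    qed (use \<rho> in \<open>auto simp: complete_eq_closed\<close>)
    then show ?thesis by simp
  qed
  define \<psi> where "\<psi> t = (THE x. x \<in> cball 0 \<rho> \<and> t *\<^sub>R N x = x)" for t
  have \<psi>: "norm (\<psi> t) \<le> \<rho>" "t *\<^sub>R N (\<psi> t) = \<psi> t" if "\<bar>t\<bar> < \<epsilon>" for t
    using theI'[OF ex[OF that]] by (auto simp: \<psi>_def)
  have \<psi>_uniq: "x = \<psi> t" if "\<bar>t\<bar> < \<epsilon>" "norm x \<le> \<rho>" "x = t *\<^sub>R N x" for t x
    using ex[OF that(1)] that \<psi>[OF that(1)] by (metis mem_cball_0)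
  have \<psi>lip: "norm (\<psi> \<tau> - \<psi> t) \<le> 2 * A * \<bar>\<tau> - t\<bar>" if t: "\<bar>t\<bar> < \<epsilon>" and \<tau>: "\<bar>\<tau>\<bar> < \<epsilon>" for \<tau> t
  proof -
    have "\<psi> \<tau> - \<psi> t = \<tau> *\<^sub>R (N (\<psi> \<tau>) - N (\<psi> t)) + (\<tau> - t) *\<^sub>R N (\<psi> t)"
      by (simp add: \<psi>(2)[OF t] \<psi>(2)[OF \<tau>] algebra_simps)
    then have "norm (\<psi> \<tau> - \<psi> t) \<le> \<bar>\<tau>\<bar> * norm (N (\<psi> \<tau>) - N (\<psi> t)) + \<bar>\<tau> - t\<bar> * norm (N (\<psi> t))"
      by (metis norm_scaleR norm_triangle_ineq)
    also have "\<dots> \<le> \<bar>\<tau>\<bar> * (M * norm (\<psi> \<tau> - \<psi> t)) + \<bar>\<tau> - t\<bar> * A"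
      using \<psi> t \<tau> by (intro add_mono mult_left_mono lip NA) auto
    also have "\<bar>\<tau>\<bar> * (M * norm (\<psi> \<tau> - \<psi> t)) \<le> 1/2 * norm (\<psi> \<tau> - \<psi> t)"
      unfolding mult.assoc[symmetric] by (intro mult_right_mono tM \<tau>) auto
    finally show ?thesis by (simp add: mult_ac)
  qed
  \<comment> \<open>Formal differentiation of \<open>\<psi> t = t *\<^sub>R N (\<psi> t)\<close>
    gives an affine equation for the derivative, which is again a contraction.\<close>
  have ex': "\<exists>!x. N (\<psi> t) + t *\<^sub>R N' (\<psi> t) x = x" if t: "\<bar>t\<bar> < \<epsilon>" for t
  proof -
    have "\<exists>!x\<in>UNIV. N (\<psi> t) + t *\<^sub>R N' (\<psi> t) x = x"
    proof (rule Banach_fix[where c="1/2"])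
      show "dist (N (\<psi> t) + t *\<^sub>R N' (\<psi> t) x) (N (\<psi> t) + t *\<^sub>R N' (\<psi> t) y) \<le> 1/2 * dist x y" for x y
      proof -
        have "dist (N (\<psi> t) + t *\<^sub>R N' (\<psi> t) x) (N (\<psi> t) + t *\<^sub>R N' (\<psi> t) y)
            = \<bar>t\<bar> * norm (N' (\<psi> t) (x - y))"
          by (simp add: dist_norm blinfun.diff_right flip: scaleR_diff_right)
        also have "\<dots> \<le> \<bar>t\<bar> * (M * norm (x - y))"
          by (intro mult_left_mono order_trans[OF norm_blinfun] mult_right_mono N'M \<psi> t) auto
        also have "\<dots> \<le> 1/2 * norm (x - y)"
          unfolding mult.assoc[symmetric] by (intro mult_right_mono tM t) auto
        finally show ?thesis by (simp add: dist_norm)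
      qed
    qed (auto simp: complete_UNIV)
    then show ?thesis by simp
  qed
  define \<psi>' where "\<psi>' t = (THE x. N (\<psi> t) + t *\<^sub>R N' (\<psi> t) x = x)" for t
  have \<psi>': "N (\<psi> t) + t *\<^sub>R N' (\<psi> t) (\<psi>' t) = \<psi>' t" if "\<bar>t\<bar> < \<epsilon>" for t
    using theI'[OF ex'[OF that]] by (simp add: \<psi>'_def)
  have deriv: "(\<psi> has_vector_derivative \<psi>' t) (at t)" if t: "\<bar>t\<bar> < \<epsilon>" for t
    unfolding has_vector_derivative_def has_derivative_at_alt
  proof (intro conjI allI impI)
    fix e :: real assume e: "e > 0"
    \<comment> \<open>The constants give two errors of at most a quarter of \<open>e\<close> times
      \<open>\<bar>\<tau> - t\<bar>\<close> each, while half of the remainder is absorbed. The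
      number \<open>2 * (A + 1)\<close> is an enlarged Lipschitz constant of \<psi>.\<close>
    define \<eta> where "\<eta> = e / (8 * (A + 1) * (\<epsilon> + 1))"
    have \<eta>: "\<eta> > 0" using e A0 \<epsilon> by (simp add: \<eta>_def)
    obtain d1 where d1: "d1 > 0" "\<And>y. norm (y - \<psi> t) < d1 \<Longrightarrow>
        norm (N y - N (\<psi> t) - N' (\<psi> t) (y - \<psi> t)) \<le> \<eta> * norm (y - \<psi> t)"
      using der[of "\<psi> t"] \<eta> unfolding has_derivative_at_alt by blast
    define d where "d = min (\<epsilon> - \<bar>t\<bar>) (min (d1 / (2 * (A + 1))) (e / (8 * M * (A + 1))))"
    have "d > 0" using t d1 A0 M e by (simp add: d_def)
    moreover have "norm (\<psi> \<tau> - \<psi> t - (\<tau> - t) *\<^sub>R \<psi>' t) \<le> e * norm (\<tau> - t)"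
      if "norm (\<tau> - t) < d" for \<tau>
    proof -
      have \<tau>: "\<bar>\<tau>\<bar> < \<epsilon>" using that by (simp add: d_def abs_if split: if_splits)
      have a1: "\<bar>\<tau> - t\<bar> * (2 * (A + 1)) < d1"
        using that A0 by (simp add: d_def field_simps)
      have "\<bar>\<tau> - t\<bar> < e / (8 * M * (A + 1))" using that by (simp add: d_def)
      then have a2: "\<bar>\<tau> - t\<bar> * (8 * M * (A + 1)) < e"
        using M A0 by (subst (asm) pos_less_divide_eq) auto
      define R where "R = \<psi> \<tau> - \<psi> t - (\<tau> - t) *\<^sub>R \<psi>' t"
      define D where "D = N (\<psi> \<tau>) - N (\<psi> t) - N' (\<psi> t) (\<psi> \<tau> - \<psi> t)"
      have "norm (\<psi> \<tau> - \<psi> t) \<le> \<bar>\<tau> - t\<bar> * (2 * (A + 1))"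
        using \<psi>lip[OF t \<tau>] by (rule order_trans) (simp add: algebra_simps)
      moreover from this have "norm D \<le> \<eta> * norm (\<psi> \<tau> - \<psi> t)"
        unfolding D_def using a1 by (intro d1(2)) linarith
      ultimately have D: "norm D \<le> \<eta> * (\<bar>\<tau> - t\<bar> * (2 * (A + 1)))"
        using \<eta> by (meson less_imp_le mult_left_mono order_trans)
      have "(\<tau> - t) *\<^sub>R \<psi>' t = (\<tau> - t) *\<^sub>R N (\<psi> t) + t *\<^sub>R N' (\<psi> t) ((\<tau> - t) *\<^sub>R \<psi>' t)"
        using arg_cong[OF \<psi>'[OF t], of "scaleR (\<tau> - t)"]
        by (simp only: blinfun.scaleR_right scaleR_add_right scaleR_left_commute)
      moreover have "\<psi> \<tau> - \<psi> t = \<tau> *\<^sub>R (N (\<psi> \<tau>) - N (\<psi> t)) + (\<tau> - t) *\<^sub>R N (\<psi> t)"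
        by (simp add: \<psi>(2)[OF t] \<psi>(2)[OF \<tau>] algebra_simps)
      moreover have "d - p = v - u" if "p = q + u" "d = v + q" for d p q u v :: 'a
        using that by simp
      ultimately have "R = \<tau> *\<^sub>R (N (\<psi> \<tau>) - N (\<psi> t)) - t *\<^sub>R N' (\<psi> t) ((\<tau> - t) *\<^sub>R \<psi>' t)"
        unfolding R_def by blast
      also have "(\<tau> - t) *\<^sub>R \<psi>' t = \<psi> \<tau> - \<psi> t - R" by (simp add: R_def)
      \<comment> \<open>The remainder solves the linearized equation with small data: a Taylor error
        of \<open>N\<close>, the absorbable term with \<open>N' (\<psi> t) R\<close>, and a term
        quadratic in \<open>\<tau> - t\<close>.\<close>
      finally have "R = t *\<^sub>R D + t *\<^sub>R N' (\<psi> t) R + (\<tau> - t) *\<^sub>R (N (\<psi> \<tau>) - N (\<psi> t))"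
        unfolding D_def by (simp add: algebra_simps blinfun.diff_right blinfun.add_right)
      then have "norm R = norm (t *\<^sub>R D + t *\<^sub>R N' (\<psi> t) R + (\<tau> - t) *\<^sub>R (N (\<psi> \<tau>) - N (\<psi> t)))"
        by (rule arg_cong)
      also have "\<dots> \<le> norm (t *\<^sub>R D) + norm (t *\<^sub>R N' (\<psi> t) R) + norm ((\<tau> - t) *\<^sub>R (N (\<psi> \<tau>) - N (\<psi> t)))"
        by (rule norm_triangle_ineq3)
      also have "\<dots> = \<bar>t\<bar> * norm D + \<bar>t\<bar> * norm (N' (\<psi> t) R) + \<bar>\<tau> - t\<bar> * norm (N (\<psi> \<tau>) - N (\<psi> t))"
        by simp
      also have "\<bar>t\<bar> * norm D \<le> (\<epsilon> + 1) * (\<eta> * (\<bar>\<tau> - t\<bar> * (2 * (A + 1))))"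
        using t D \<epsilon> by (intro mult_mono) auto
      also have "(\<epsilon> + 1) * (\<eta> * (\<bar>\<tau> - t\<bar> * (2 * (A + 1)))) = e / 4 * \<bar>\<tau> - t\<bar>"
      proof -
        have "\<eta> * (8 * (A + 1) * (\<epsilon> + 1)) = e" using A0 \<epsilon> by (simp add: \<eta>_def)
        moreover have "(\<epsilon> + 1) * (\<eta> * (\<bar>\<tau> - t\<bar> * (2 * (A + 1))))
            = \<eta> * (8 * (A + 1) * (\<epsilon> + 1)) / 4 * \<bar>\<tau> - t\<bar>"
          by (simp add: field_simps)
        ultimately show ?thesis by simp
      qed
      also have "\<bar>t\<bar> * norm (N' (\<psi> t) R) \<le> \<bar>t\<bar> * (M * norm R)"
        by (intro mult_left_mono order_trans[OF norm_blinfun] mult_right_mono N'M \<psi> t) auto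
      also have "\<bar>t\<bar> * (M * norm R) \<le> 1/2 * norm R"
        unfolding mult.assoc[symmetric] by (intro mult_right_mono tM t) auto
      also have "\<bar>\<tau> - t\<bar> * norm (N (\<psi> \<tau>) - N (\<psi> t)) \<le> \<bar>\<tau> - t\<bar> * (M * (\<bar>\<tau> - t\<bar> * (2 * (A + 1))))"
        using \<psi> t \<tau> M \<open>norm (\<psi> \<tau> - \<psi> t) \<le> \<bar>\<tau> - t\<bar> * (2 * (A + 1))\<close>
        by (intro mult_left_mono order_trans[OF lip]) auto
      also have "\<bar>\<tau> - t\<bar> * (M * (\<bar>\<tau> - t\<bar> * (2 * (A + 1)))) \<le> \<bar>\<tau> - t\<bar> * (e / 4)"
        using a2 by (intro mult_left_mono) (auto simp: algebra_simps)
      finally show ?thesis unfolding R_def[symmetric] by (simp add: mult_ac)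
    qed
    ultimately show "\<exists>d>0. \<forall>\<tau>. norm (\<tau> - t) < d \<longrightarrow> norm (\<psi> \<tau> - \<psi> t - (\<tau> - t) *\<^sub>R \<psi>' t) \<le> e * norm (\<tau> - t)"
      by blast
  qed (auto intro: bounded_linear_intros)
  have cont': "continuous_on {-\<epsilon><..<\<epsilon>} \<psi>'"
    unfolding continuous_on_def
  proof
    fix t assume t: "t \<in> {-\<epsilon><..<\<epsilon>}"
    then have t': "\<bar>t\<bar> < \<epsilon>" by auto
    let ?F = "at t within {-\<epsilon><..<\<epsilon>}"
    have c\<psi>: "(\<psi> \<longlongrightarrow> \<psi> t) ?F"
      using deriv[OF t'] by (meson has_vector_derivative_continuous continuous_at_imp_continuous_within continuous_within)
    have cN': "((\<lambda>\<tau>. N' (\<psi> \<tau>)) \<longlongrightarrow> N' (\<psi> t)) ?F"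
      using cont c\<psi> by (intro continuous_on_tendsto_compose[of UNIV N']) auto
    have cN: "((\<lambda>\<tau>. N (\<psi> \<tau>)) \<longlongrightarrow> N (\<psi> t)) ?F"
      by (rule isCont_tendsto_compose[OF has_derivative_continuous[OF der] c\<psi>])
    \<comment> \<open>Subtracting the affine equations at \<tau> and \<open>t\<close> leaves the
      unknown difference on the right with a factor of at most \<open>1/2\<close>; absorbing it
      produces the 2.\<close>
    let ?G = "\<lambda>\<tau>. 2 * (norm (N (\<psi> \<tau>) - N (\<psi> t)) + norm (\<tau> *\<^sub>R N' (\<psi> \<tau>) - t *\<^sub>R N' (\<psi> t)) * norm (\<psi>' t))"
    have "(?G \<longlongrightarrow> 2 * (norm (N (\<psi> t) - N (\<psi> t)) + norm (t *\<^sub>R N' (\<psi> t) - t *\<^sub>R N' (\<psi> t)) * norm (\<psi>' t))) ?F"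
      by (intro tendsto_intros cN cN')
    then have G: "(?G \<longlongrightarrow> 0) ?F" by simp
    have "norm (\<psi>' \<tau> - \<psi>' t) \<le> ?G \<tau>" if "\<bar>\<tau>\<bar> < \<epsilon>" for \<tau>
    proof -
      have "\<psi>' \<tau> - \<psi>' t = (N (\<psi> \<tau>) - N (\<psi> t)) + (\<tau> *\<^sub>R N' (\<psi> \<tau>) - t *\<^sub>R N' (\<psi> t)) (\<psi>' t)
          + \<tau> *\<^sub>R N' (\<psi> \<tau>) (\<psi>' \<tau> - \<psi>' t)"
      proof -
        have "\<psi>' \<tau> - \<psi>' t = (N (\<psi> \<tau>) + \<tau> *\<^sub>R N' (\<psi> \<tau>) (\<psi>' \<tau>)) - (N (\<psi> t) + t *\<^sub>R N' (\<psi> t) (\<psi>' t))"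
          by (simp add: \<psi>'[OF t'] \<psi>'[OF that])
        then show ?thesis
          by (simp add: algebra_simps blinfun.diff_right blinfun.diff_left blinfun.scaleR_left)
      qed
      then have "norm (\<psi>' \<tau> - \<psi>' t) = norm ((N (\<psi> \<tau>) - N (\<psi> t)) + (\<tau> *\<^sub>R N' (\<psi> \<tau>) - t *\<^sub>R N' (\<psi> t)) (\<psi>' t)
          + \<tau> *\<^sub>R N' (\<psi> \<tau>) (\<psi>' \<tau> - \<psi>' t))"
        by (rule arg_cong)
      also have "\<dots> \<le> norm (N (\<psi> \<tau>) - N (\<psi> t))
          + norm ((\<tau> *\<^sub>R N' (\<psi> \<tau>) - t *\<^sub>R N' (\<psi> t)) (\<psi>' t))
          + norm (\<tau> *\<^sub>R N' (\<psi> \<tau>) (\<psi>' \<tau> - \<psi>' t))"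
        by (rule norm_triangle_ineq3)
      finally have "norm (\<psi>' \<tau> - \<psi>' t) \<le> norm (N (\<psi> \<tau>) - N (\<psi> t))
          + norm ((\<tau> *\<^sub>R N' (\<psi> \<tau>) - t *\<^sub>R N' (\<psi> t)) (\<psi>' t))
          + norm (\<tau> *\<^sub>R N' (\<psi> \<tau>) (\<psi>' \<tau> - \<psi>' t))" .
      moreover have "norm (\<tau> *\<^sub>R N' (\<psi> \<tau>) (\<psi>' \<tau> - \<psi>' t)) \<le> 1/2 * norm (\<psi>' \<tau> - \<psi>' t)"
      proof -
        have "norm (\<tau> *\<^sub>R N' (\<psi> \<tau>) (\<psi>' \<tau> - \<psi>' t)) \<le> \<bar>\<tau>\<bar> * (M * norm (\<psi>' \<tau> - \<psi>' t))"
          unfolding norm_scaleR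
          by (intro mult_left_mono order_trans[OF norm_blinfun] mult_right_mono N'M \<psi> that) auto
        also have "\<dots> \<le> 1/2 * norm (\<psi>' \<tau> - \<psi>' t)"
          unfolding mult.assoc[symmetric] by (intro mult_right_mono tM that) auto
        finally show ?thesis .
      qed
      moreover have "norm ((\<tau> *\<^sub>R N' (\<psi> \<tau>) - t *\<^sub>R N' (\<psi> t)) (\<psi>' t))
          \<le> norm (\<tau> *\<^sub>R N' (\<psi> \<tau>) - t *\<^sub>R N' (\<psi> t)) * norm (\<psi>' t)"
        by (rule norm_blinfun)
      ultimately show ?thesis by simp
    qed
    then have "\<forall>\<^sub>F \<tau> in ?F. norm (\<psi>' \<tau> - \<psi>' t) \<le> ?G \<tau>"
      by (auto simp: eventually_at_filter abs_less_iff intro!: always_eventually)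
    then have "((\<lambda>\<tau>. \<psi>' \<tau> - \<psi>' t) \<longlongrightarrow> 0) ?F"
      using G by (rule Lim_null_comparison)
    then show "(\<psi>' \<longlongrightarrow> \<psi>' t) ?F" by (simp add: LIM_zero_cancel)
  qed
  show ?thesis
  proof (rule that[OF \<epsilon> \<rho>])
    show "norm (\<psi> t) \<le> \<rho> \<and> \<psi> t = t *\<^sub>R N (\<psi> t)" if "\<bar>t\<bar> < \<epsilon>" for t
      using \<psi>[OF that] by simp
  qed (fact \<psi>_uniq deriv cont')+
qed

section \<open>Bifurcation in the sequence space\<close>

lemma l2_pair_exists: "\<exists>x. \<forall>k. coord x k = (if k = p \<or> k = q then 1 else 0)"
proof -
  have "(\<lambda>k. (if k = p \<or> k = q then 1 else 0 :: real)\<^sup>2) summable_on UNIV"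
    by (rule has_sum_imp_summable, rule has_sum_finite_neutralI[OF _ _ _ refl, of "{p, q}"]) auto
  then have A: "coord (l2_of (\<lambda>k. if k = p \<or> k = q then 1 else 0)) = (\<lambda>k. if k = p \<or> k = q then 1 else 0)"
    by (intro l2_of_inverse) simp
  show ?thesis by (rule exI[of _ "l2_of (\<lambda>k. if k = p \<or> k = q then 1 else 0)"]) (simp only: A simp_thms)
qed

lemma bounded_linear_flip: "bounded_linear flip"
  by (rule bounded_linear_intro[of _ 1]; (rule l2_eqI)?; simp)

text \<open>Carries evenness of the branch over to its derivative.\<close>

lemma has_vector_derivative_invariant:
  fixes f :: "real \<Rightarrow> 'a::real_normed_vector" and L :: "'a \<Rightarrow> 'a"
  assumes L: "bounded_linear L" and f: "(f has_vector_derivative f') (at t)"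
    and "open I" "t \<in> I" and inv: "\<And>\<tau>. \<tau> \<in> I \<Longrightarrow> L (f \<tau>) = f \<tau>"
  shows "L f' = f'"
proof -
  have "((\<lambda>\<tau>. L (f \<tau>)) has_vector_derivative L f') (at t)"
    by (rule bounded_linear.has_vector_derivative[OF L f])
  then have "(f has_vector_derivative L f') (at t)"
    by (rule has_vector_derivative_transform_within_open[OF _ \<open>open I\<close> \<open>t \<in> I\<close>]) (rule inv)
  then show ?thesis using f by (rule vector_derivative_unique_at)
qed

locale bifurcation = quadratic r P M for r :: real and P :: "int^'n \<Rightarrow> real" and M +
  fixes a :: real and k0 :: "int^'n"
  assumes a: "a > 0" and k0: "k0 \<noteq> 0" and Pk0: "P k0 \<noteq> 0"
    and P_neq: "\<And>k. k \<noteq> k0 \<Longrightarrow> k \<noteq> - k0 \<Longrightarrow> P k \<noteq> P k0"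
    and P_tendsto_0: "\<And>\<eta>. \<eta> > 0 \<Longrightarrow> finite {k. \<eta> < \<bar>P k\<bar>}"
begin

section \<open>The linearization at the critical parameter\<close>

definition c0 :: real where "c0 = - a / P k0"

text \<open>The zero set in weighted coordinates. The condition at \<open>k = 0\<close> holds by
  itself, since \<open>quad\<close> has no zeroth mode.\<close>

definition solves :: "real \<Rightarrow> (int^'n) l2 \<Rightarrow> bool" where
  "solves c x \<longleftrightarrow> flip x = x \<and> coord x 0 = 0 \<and> (\<forall>k. (a + c * P k) * coord x k + coord (quad x x) k = 0)"

lemma k0_neq: "k0 \<noteq> - k0" "0 \<noteq> k0" "0 \<noteq> - k0"
proof -
  obtain i where i: "k0 $ i \<noteq> 0" using k0 by (auto simp: vec_eq_iff)
  show "k0 \<noteq> - k0"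
  proof
    assume "k0 = - k0"
    then have "k0 $ i = (- k0) $ i" by (rule arg_cong)
    then show False using i by simp
  qed
qed (use k0 in auto)

lemma symbol_neq_0: "k \<noteq> k0 \<Longrightarrow> k \<noteq> - k0 \<Longrightarrow> a + c0 * P k \<noteq> 0"
  using P_neq[of k] a Pk0 by (simp add: c0_def field_simps)

text \<open>All but finitely many \<open>P k\<close> are so small that the symbol is at least
  \<open>a / 2\<close>; the finitely many others enter a maximum. At \<open>k0\<close> and
  \<open>- k0\<close> division by zero gives 0, so the bound may range over all
  \<open>k\<close>.\<close>

lemma symbol_bounded_below: "\<exists>R>0. \<forall>k. \<bar>1 / (a + c0 * P k)\<bar> \<le> R"
proof -
  have c0: "c0 \<noteq> 0" using a Pk0 by (simp add: c0_def)
  define \<eta> where "\<eta> = a / (2 * \<bar>c0\<bar>)"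
  have \<eta>: "\<eta> > 0" using a c0 by (simp add: \<eta>_def)
  define A where "A = {k. \<eta> < \<bar>P k\<bar>}"
  have A: "finite A" unfolding A_def by (rule P_tendsto_0[OF \<eta>])
  define R where "R = Max (insert (2 / a) ((\<lambda>k. \<bar>1 / (a + c0 * P k)\<bar>) ` A))"
  have "\<bar>1 / (a + c0 * P k)\<bar> \<le> R" for k
  proof (cases "k \<in> A")
    case True
    then show ?thesis unfolding R_def using A by (intro Max_ge) auto
  next
    case False
    then have "\<bar>c0\<bar> * \<bar>P k\<bar> \<le> \<bar>c0\<bar> * \<eta>" by (intro mult_left_mono) (auto simp: A_def)
    also have "\<dots> = a / 2" using c0 by (simp add: \<eta>_def)
    finally have "\<bar>c0 * P k\<bar> \<le> a / 2" by (simp add: abs_mult)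
    then have "a / 2 \<le> a + c0 * P k" by linarith
    then have "\<bar>1 / (a + c0 * P k)\<bar> \<le> 2 / a"
      using a by (simp add: field_simps)
    also have "\<dots> \<le> R" unfolding R_def using A by (intro Max_ge) auto
    finally show ?thesis .
  qed
  moreover have "R > 0"
  proof -
    have "2 / a \<le> R" unfolding R_def using A by (intro Max_ge) auto
    moreover have "0 < 2 / a" using a by simp
    ultimately show ?thesis by linarith
  qed
  ultimately show ?thesis by blast
qed

text \<open>As a function a multiple of the cosine of frequency \<open>k0\<close>; it spans the even
  kernel of the linearization at \<open>c0\<close>.\<close>

definition e0 :: "(int^'n) l2" where
  "e0 = (SOME x. \<forall>k. coord x k = (if k = k0 \<or> k = - k0 then 1 else 0))"

lemma coord_e0: "coord e0 k = (if k = k0 \<or> k = - k0 then 1 else 0)"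
  using someI_ex[OF l2_pair_exists[of k0 "- k0"]] by (simp add: e0_def)

lemma flip_e0: "flip e0 = e0"
  by (rule l2_eqI) (auto simp: coord_e0)

text \<open>Inverts the symbol away from its zeros. The value 0 at \<open>k = 0\<close> is a choice:
  it builds zero mean into every fixed point.\<close>

definition inv_symbol :: "int^'n \<Rightarrow> real" where
  "inv_symbol k = (if k \<in> {0, k0, - k0} then 0 else 1 / (a + c0 * P k))"

lemma inv_symbol_bounded: "\<exists>R>0. \<forall>k. \<bar>inv_symbol k\<bar> \<le> R"
proof -
  obtain R where "R > 0" "\<And>k. \<bar>1 / (a + c0 * P k)\<bar> \<le> R"
    using symbol_bounded_below by blast
  then show ?thesis by (intro exI[of _ R]) (simp add: inv_symbol_def)
qed

lemma inv_symbol_even: "inv_symbol (- k) = inv_symbol k"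
  by (auto simp: inv_symbol_def P_even)

definition "K = multiplier inv_symbol"

lemma coord_K: "coord (K x) k = inv_symbol k * coord x k"
  and bounded_linear_K: "bounded_linear K"
  and norm_K: "\<exists>R>0. \<forall>x. norm (K x) \<le> R * norm x"
proof -
  obtain R where R: "R > 0" "\<And>k. \<bar>inv_symbol k\<bar> \<le> R" using inv_symbol_bounded by blast
  show "coord (K x) k = inv_symbol k * coord x k" unfolding K_def by (rule coord_multiplier[OF R(2)])
  show "bounded_linear K" unfolding K_def by (rule bounded_linear_multiplier[OF R(2)])
  show "\<exists>R>0. \<forall>x. norm (K x) \<le> R * norm x"
    unfolding K_def using R(1) by (intro exI[of _ R] conjI allI norm_multiplier R(2))
qed

lemma coord_P: "coord (multiplier P x) k = P k * coord x k"
  and bounded_linear_P: "bounded_linear (multiplier P)"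
  and norm_P: "norm (multiplier P x) \<le> M * norm x"
  using coord_multiplier[of P M, OF P_le] bounded_linear_multiplier[of P M, OF P_le] norm_multiplier[of P M, OF P_le]
  by auto

section \<open>Lyapunov-Schmidt reduction to a fixed point equation\<close>

interpretation quad: bounded_bilinear quad
  by (rule bounded_bilinear_quad)

text \<open>The average over \<open>k0\<close> and \<open>- k0\<close> makes \<beta> invariant under
  \<open>flip\<close> on all of \<open>l2\<close>, so that \<open>N\<close> commutes with
  \<open>flip\<close> before any evenness is known. On even sequences it is the coordinate at
  \<open>k0\<close> divided by \<open>P k0\<close>.\<close>

definition pair_functional :: "(int^'n) l2 \<Rightarrow>\<^sub>L real" where
  "pair_functional = Blinfun (\<lambda>z. (coord z k0 + coord z (- k0)) / (2 * P k0))"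

lemma pair_functional: "pair_functional z = (coord z k0 + coord z (- k0)) / (2 * P k0)"
  unfolding pair_functional_def
  by (rule bounded_linear_Blinfun_apply[THEN fun_cong])
    (intro bounded_linear_divide bounded_linear_add bounded_linear_coord bounded_linear_compose[OF bounded_linear_divide])

definition quad_at :: "(int^'n) l2 \<Rightarrow> (int^'n) l2" where
  "quad_at y = quad (e0 + y) (e0 + y)"

definition \<beta> :: "(int^'n) l2 \<Rightarrow> real" where
  "\<beta> y = pair_functional (quad_at y)"

text \<open>With \<open>c = c0 - t * \<beta> y\<close> inserted, the equation off the kernel reads
  \<open>(a + c0 * P k) * y k = t * (\<beta> y * P k * y k - Q k)\<close>, where \<open>Q\<close> is
  \<open>quad_at y\<close>; \<open>K\<close> inverts the symbol on the left.\<close>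

definition N :: "(int^'n) l2 \<Rightarrow> (int^'n) l2" where
  "N y = K (\<beta> y *\<^sub>R multiplier P y - quad_at y)"

lemma coord_N: "coord (N y) k = inv_symbol k * (\<beta> y * (P k * coord y k) - coord (quad_at y) k)"
  by (simp add: N_def coord_K coord_P)

lemma coord_N_0: "k \<in> {0, k0, - k0} \<Longrightarrow> coord (N y) k = 0"
  by (simp add: coord_N inv_symbol_def)

lemma flip_add: "flip (x + y) = flip x + flip y"
  and flip_diff: "flip (x - y) = flip x - flip y"
  and flip_scaleR: "flip (c *\<^sub>R x) = c *\<^sub>R flip x"
  by (rule l2_eqI, simp)+

lemma flip_quad_at: "flip (quad_at y) = quad_at (flip y)"
  by (simp add: quad_at_def flip_quad flip_add flip_e0)

lemma \<beta>_flip: "\<beta> (flip y) = \<beta> y"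
  by (simp add: \<beta>_def pair_functional add.commute flip: flip_quad_at)

lemma flip_N: "flip (N y) = N (flip y)"
  by (rule l2_eqI) (simp add: coord_N inv_symbol_even P_even \<beta>_flip flip: flip_quad_at)

lemma \<beta>_even: "flip y = y \<Longrightarrow> \<beta> y = coord (quad_at y) k0 / P k0"
  using coord_flip[of "quad_at y" k0] by (simp add: \<beta>_def pair_functional flip_quad_at)

definition dquad :: "(int^'n) l2 \<Rightarrow> (int^'n) l2 \<Rightarrow>\<^sub>L (int^'n) l2" where
  "dquad y = quad.prod_left (e0 + y) + quad.prod_right (e0 + y)"

definition N' :: "(int^'n) l2 \<Rightarrow> (int^'n) l2 \<Rightarrow>\<^sub>L (int^'n) l2" where
  "N' y = Blinfun K o\<^sub>L ((blinfun_scaleR_left (multiplier P y) o\<^sub>L (pair_functional o\<^sub>L dquad y))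
     + \<beta> y *\<^sub>R Blinfun (multiplier P) - dquad y)"

lemma has_derivative_quad_at: "(quad_at has_derivative dquad y) (at y)"
proof -
  have "((\<lambda>y. e0 + y) has_derivative (\<lambda>h. h)) (at y)"
    by (auto intro!: derivative_eq_intros)
  from quad.FDERIV[OF this this] show ?thesis
    unfolding quad_at_def by (rule has_derivative_eq_rhs) (simp add: fun_eq_iff dquad_def blinfun.bilinear_simps)
qed

lemma has_derivative_\<beta>: "(\<beta> has_derivative (pair_functional o\<^sub>L dquad y)) (at y)"
  unfolding \<beta>_def[abs_def]
  using bounded_linear.has_derivative[OF blinfun.bounded_linear_right has_derivative_quad_at]
  by (rule has_derivative_eq_rhs) (simp add: fun_eq_iff)

lemma has_derivative_N: "(N has_derivative N' y) (at y)"
proof -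
  have "((\<lambda>y. multiplier P y) has_derivative (\<lambda>h. multiplier P h)) (at y)"
    by (rule bounded_linear.has_derivative[OF bounded_linear_P has_derivative_ident])
  from has_derivative_scaleR[OF has_derivative_\<beta> this]
  have "((\<lambda>y. \<beta> y *\<^sub>R multiplier P y - quad_at y) has_derivative
      (\<lambda>h. \<beta> y *\<^sub>R multiplier P h + (pair_functional o\<^sub>L dquad y) h *\<^sub>R multiplier P y - dquad y h)) (at y)"
    by (rule has_derivative_diff[OF _ has_derivative_quad_at])
  from bounded_linear.has_derivative[OF bounded_linear_K this]
  show ?thesis unfolding N_def[abs_def]
    by (rule has_derivative_eq_rhs)
      (simp add: fun_eq_iff N'_def blinfun.bilinear_simps bounded_linear_Blinfun_apply bounded_linear_K bounded_linear_P add.commute)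
qed

lemma continuous_on_dquad: "continuous_on A dquad"
  unfolding dquad_def[abs_def]
  by (intro continuous_on_add bounded_linear.continuous_on[OF quad.bounded_linear_prod_left]
      bounded_linear.continuous_on[OF quad.bounded_linear_prod_right] continuous_on_const continuous_on_id)

lemma continuous_on_\<beta>: "continuous_on A \<beta>"
  by (intro continuous_at_imp_continuous_on ballI has_derivative_continuous[OF has_derivative_\<beta>])

lemma continuous_on_N': "continuous_on UNIV N'"
  unfolding N'_def[abs_def]
  by (intro continuous_on_add continuous_on_diff continuous_on_scaleR continuous_on_const continuous_on_dquad continuous_on_\<beta>
      bounded_bilinear.continuous_on[OF bounded_bilinear_blinfun_compose]
      bounded_linear.continuous_on[OF bounded_linear_blinfun_scaleR_left]
      bounded_linear.continuous_on[OF bounded_linear_P] continuous_on_id)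

text \<open>One factor \<open>t\<close> cancels since the linear part is homogeneous of degree 1 and
  \<open>quad\<close> of degree 2. The mode 0 is void, the modes \<open>k0\<close> and
  \<open>- k0\<close> give the same condition on \<open>c\<close>, and the others are the
  coordinates of the fixed point equation, whose two sides vanish on the excluded modes.\<close>

lemma solves_branch_iff:
  assumes t: "t \<noteq> 0" and y: "flip y = y" "coord y 0 = 0" "coord y k0 = 0"
  shows "solves c (t *\<^sub>R (e0 + y)) \<longleftrightarrow> c = c0 - t * \<beta> y \<and> y = t *\<^sub>R N y"
proof -
  have ym: "coord y (- k0) = 0" using y by (metis coord_flip)
  let ?x = "t *\<^sub>R (e0 + y)"
  have qx: "quad ?x ?x = (t * t) *\<^sub>R quad_at y"
    by (simp add: quad_at_def quad.scaleR_left quad.scaleR_right)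
  have x0: "flip ?x = ?x" "coord ?x 0 = 0"
    using y k0_neq by (simp_all add: flip_add flip_scaleR flip_e0 coord_e0)
  have q0: "coord (quad_at y) 0 = 0" by (simp add: quad_at_def)
  have qm: "coord (quad_at y) (- k0) = coord (quad_at y) k0"
    using flip_quad_at[of y] y(1) by (metis coord_flip)
  have \<beta>: "\<beta> y * P k0 = coord (quad_at y) k0" using \<beta>_even[OF y(1)] Pk0 by simp
  have c0: "a + c0 * P k0 = 0" using Pk0 by (simp add: c0_def)
  define eqn where "eqn k \<longleftrightarrow> (a + c * P k) * (coord e0 k + coord y k) + t * coord (quad_at y) k = 0" for k
  have s: "solves c ?x \<longleftrightarrow> (\<forall>k. eqn k)"
  proof -
    have "(a + c * P k) * (t * (coord e0 k + coord y k)) + t * t * coord (quad_at y) k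
        = t * ((a + c * P k) * (coord e0 k + coord y k) + t * coord (quad_at y) k)" for k
      by (simp add: algebra_simps)
    then have "(a + c * P k) * coord ?x k + coord (quad ?x ?x) k = 0 \<longleftrightarrow> eqn k" for k
      unfolding eqn_def qx using t by simp
    then show ?thesis unfolding solves_def using x0 by simp
  qed
  have e0: "eqn 0" using y q0 k0_neq by (simp add: eqn_def coord_e0)
  have ek: "eqn k0 \<longleftrightarrow> c = c0 - t * \<beta> y"
  proof -
    have "eqn k0 \<longleftrightarrow> a + c * P k0 + t * (\<beta> y * P k0) = 0"
      unfolding eqn_def \<beta> by (simp add: coord_e0 y(3))
    \<comment> \<open>The symbol vanishes at \<open>c0\<close>, and \<open>P k0 \<noteq> 0\<close>
      then determines \<open>c\<close>.\<close>
    also have "a + c * P k0 + t * (\<beta> y * P k0) = (a + c0 * P k0) + (c - (c0 - t * \<beta> y)) * P k0"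
      by (simp add: algebra_simps)
    finally have "eqn k0 \<longleftrightarrow> (c - (c0 - t * \<beta> y)) * P k0 = 0" unfolding c0 by simp
    then show ?thesis using Pk0 by simp
  qed
  have em: "eqn (- k0) \<longleftrightarrow> eqn k0" using ym y(3) by (simp add: eqn_def coord_e0 qm P_even)
  have gen: "eqn k \<longleftrightarrow> coord y k = t * coord (N y) k" if k: "k \<notin> {0, k0, - k0}" and c: "c = c0 - t * \<beta> y" for k
  proof -
    have "a + c0 * P k \<noteq> 0" using k by (intro symbol_neq_0) auto
    then have "coord y k = t * coord (N y) k \<longleftrightarrow>
        (a + c0 * P k) * coord y k = t * (\<beta> y * (P k * coord y k) - coord (quad_at y) k)"
      using k by (simp add: coord_N inv_symbol_def field_simps)
    also have "\<dots> \<longleftrightarrow> eqn k" using k by (auto simp: eqn_def c coord_e0 algebra_simps)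
    finally show ?thesis by simp
  qed
  have fp: "y = t *\<^sub>R N y \<longleftrightarrow> (\<forall>k. k \<notin> {0, k0, - k0} \<longrightarrow> coord y k = t * coord (N y) k)"
  proof
    assume "y = t *\<^sub>R N y"
    then have "coord y k = coord (t *\<^sub>R N y) k" for k by simp
    then show "\<forall>k. k \<notin> {0, k0, - k0} \<longrightarrow> coord y k = t * coord (N y) k" by simp
  next
    assume H: "\<forall>k. k \<notin> {0, k0, - k0} \<longrightarrow> coord y k = t * coord (N y) k"
    show "y = t *\<^sub>R N y"
    proof (rule l2_eqI)
      fix k
      show "coord y k = coord (t *\<^sub>R N y) k"
        using H y ym coord_N_0[of k y] by (cases "k \<in> {0, k0, - k0}") auto
    qed
  qed
  show ?thesis
  proof
    assume "solves c ?x"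
    then have "eqn k" for k using s by blast
    then show "c = c0 - t * \<beta> y \<and> y = t *\<^sub>R N y" using fp ek gen by blast
  next
    assume H: "c = c0 - t * \<beta> y \<and> y = t *\<^sub>R N y"
    have "eqn k" for k
    proof (cases "k \<in> {0, k0, - k0}")
      case True
      then show ?thesis using H e0 ek em by auto
    next
      case False
      then show ?thesis using H fp gen by blast
    qed
    then show "solves c ?x" using s by blast
  qed
qed

text \<open>Guarantees that rescaling a small solution by its kernel coordinate lands in the ball in
  which fixed points are unique. It also forces a solution near the bifurcation point without kernel
  component to be 0.\<close>

lemma small_solution_bound:
  assumes "\<rho> > 0"
  obtains \<delta> where "\<delta> > 0" "\<And>c x. solves c x \<Longrightarrow> \<bar>c - c0\<bar> < \<delta> \<Longrightarrow> norm x < \<delta> \<Longrightarrow>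
    norm (x - coord x k0 *\<^sub>R e0) \<le> \<rho> * \<bar>coord x k0\<bar>"
proof -
  obtain R where R: "R > 0" "\<And>x. norm (K x) \<le> R * norm x" using norm_K by blast
  obtain C where C: "C > 0" "\<And>x y. norm (quad x y) \<le> norm x * norm y * C" using quad.pos_bounded by blast
  \<comment> \<open>The first two bounds let half of the norm of the remainder be absorbed, the
    third leaves at most \<open>\<rho> / 2\<close> times the kernel coordinate.\<close>
  define \<delta> where "\<delta> = min (1 / (4 * R * (M + 1))) (min (1 / (4 * R * C)) (\<rho> / (2 * R * C * (norm e0 + 1))))"
  have n1: "norm e0 + 1 > 0" "M + 1 > 0" using M_nonneg by (simp_all add: add_nonneg_pos)
  have \<delta>: "\<delta> > 0" using assms R C n1 by (simp add: \<delta>_def)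
  have "\<delta> \<le> 1 / (4 * R * (M + 1))" by (simp add: \<delta>_def)
  then have "\<delta> * (4 * R * (M + 1)) \<le> 1"
    using R n1 by (subst (asm) pos_le_divide_eq) simp_all
  then have "R * \<delta> * (M + 1) \<le> 1/4" by (simp add: algebra_simps)
  moreover have "R * \<delta> * M \<le> R * \<delta> * (M + 1)" using R \<delta> by (intro mult_left_mono) auto
  ultimately have d1: "R * \<delta> * M \<le> 1/4" by linarith
  have "\<delta> \<le> 1 / (4 * R * C)" by (simp add: \<delta>_def)
  then have "\<delta> * (4 * R * C) \<le> 1"
    using R C by (subst (asm) pos_le_divide_eq) simp_all
  then have d2: "R * C * \<delta> \<le> 1/4" by (simp add: algebra_simps)
  have "\<delta> \<le> \<rho> / (2 * R * C * (norm e0 + 1))" by (simp add: \<delta>_def)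
  then have "2 * R * C * (norm e0 + 1) * \<delta> \<le> \<rho>"
    using R C n1 by (subst (asm) pos_le_divide_eq) (simp_all add: mult.commute)
  moreover have "2 * R * C * norm e0 * \<delta> \<le> 2 * R * C * (norm e0 + 1) * \<delta>"
    using R C \<delta> by (intro mult_right_mono mult_left_mono) auto
  ultimately have d3: "2 * (R * C * \<delta> * norm e0) \<le> \<rho>" by (simp add: mult_ac)
  have "norm (x - coord x k0 *\<^sub>R e0) \<le> \<rho> * \<bar>coord x k0\<bar>"
    if s: "solves c x" and c: "\<bar>c - c0\<bar> < \<delta>" and x: "norm x < \<delta>" for c x
  proof -
    define t where "t = coord x k0"
    define y where "y = x - t *\<^sub>R e0"
    have xm: "coord x (- k0) = t" using s by (metis coord_flip solves_def t_def)
    \<comment> \<open>The equation is solved for the remainder with the symbol frozen at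
      \<open>c0\<close>; the discrepancy \<open>c0 - c\<close> is small and multiplies a bounded
      operator.\<close>
    have "y = K ((c0 - c) *\<^sub>R multiplier P y - quad x x)"
    proof (rule l2_eqI)
      fix k
      show "coord y k = coord (K ((c0 - c) *\<^sub>R multiplier P y - quad x x)) k"
      proof (cases "k \<in> {0, k0, - k0}")
        case True
        then show ?thesis using s xm k0_neq by (auto simp: coord_K inv_symbol_def y_def coord_e0 t_def solves_def)
      next
        case False
        have "a + c0 * P k \<noteq> 0" using False by (intro symbol_neq_0) auto
        moreover have "coord x k = coord y k" using False by (simp add: y_def coord_e0)
        moreover have "(a + c * P k) * coord x k + coord (quad x x) k = 0" using s by (simp add: solves_def)
        ultimately show ?thesis using False by (simp add: coord_K coord_P inv_symbol_def field_simps)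
      qed
    qed
    then have "norm y \<le> R * norm ((c0 - c) *\<^sub>R multiplier P y - quad x x)"
      by (metis R(2))
    also have "\<dots> \<le> R * (\<bar>c0 - c\<bar> * norm (multiplier P y) + norm (quad x x))"
      using norm_triangle_ineq4[of "(c0 - c) *\<^sub>R multiplier P y" "quad x x"] R by (intro mult_left_mono) auto
    also have "\<dots> \<le> R * (\<delta> * (M * norm y) + norm x * norm x * C)"
      using R C c norm_P[of y] by (intro mult_left_mono add_mono mult_mono) auto
    also have "norm x * norm x * C \<le> \<delta> * (\<bar>t\<bar> * norm e0 + norm y) * C"
    proof -
      have "norm x \<le> \<bar>t\<bar> * norm e0 + norm y"
        using norm_triangle_ineq[of "t *\<^sub>R e0" y] by (simp add: y_def)
      then show ?thesis using x C \<delta> by (intro mult_right_mono mult_mono) auto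
    qed
    finally have "norm y \<le> R * (\<delta> * (M * norm y) + \<delta> * (\<bar>t\<bar> * norm e0 + norm y) * C)"
      using R by simp
    also have "\<dots> = (R * \<delta> * M) * norm y + (R * C * \<delta>) * norm y + (R * C * \<delta> * norm e0) * \<bar>t\<bar>"
      by (simp add: algebra_simps)
    also have "\<dots> \<le> 1/4 * norm y + 1/4 * norm y + (\<rho> / 2) * \<bar>t\<bar>"
      using d1 d2 d3 by (intro add_mono mult_right_mono) auto
    finally show ?thesis by (simp add: y_def t_def)
  qed
  with \<delta> show ?thesis by (rule that)
qed

text \<open>Existence comes from the fixed point family, exhaustion from
  \<open>small_solution_bound\<close> together with uniqueness in the ball of radius \<rho>. The set
  \<open>U\<close> has to be cut so that both curves have precisely the parameter range
  \<epsilon>.\<close>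

lemma local_branch:
  obtains \<epsilon> U \<phi> \<phi>' \<Psi> \<Psi>' where "\<epsilon> > 0" "open U"
    "\<And>c x. solves c x \<Longrightarrow> (c, x) \<in> U \<Longrightarrow> (x = 0 \<and> \<bar>c - c0\<bar> < \<epsilon>) \<or> (\<exists>t. \<bar>t\<bar> < \<epsilon> \<and> c = \<phi> t \<and> x = t *\<^sub>R (e0 + \<Psi> t))"
    "\<And>t. \<bar>t\<bar> < \<epsilon> \<Longrightarrow> (\<phi> t, t *\<^sub>R (e0 + \<Psi> t)) \<in> U \<and> solves (\<phi> t) (t *\<^sub>R (e0 + \<Psi> t))"
    "\<And>c. \<bar>c - c0\<bar> < \<epsilon> \<Longrightarrow> (c, 0) \<in> U"
    "\<And>t. \<bar>t\<bar> < \<epsilon> \<Longrightarrow> flip (\<Psi> t) = \<Psi> t \<and> coord (\<Psi> t) 0 = 0 \<and> coord (\<Psi> t) k0 = 0"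
    "\<And>t. \<bar>t\<bar> < \<epsilon> \<Longrightarrow> flip (\<Psi>' t) = \<Psi>' t \<and> coord (\<Psi>' t) 0 = 0"
    "\<And>t. \<bar>t\<bar> < \<epsilon> \<Longrightarrow> (\<phi> has_vector_derivative \<phi>' t) (at t)" "continuous_on {-\<epsilon><..<\<epsilon>} \<phi>'"
    "\<And>t. \<bar>t\<bar> < \<epsilon> \<Longrightarrow> (\<Psi> has_vector_derivative \<Psi>' t) (at t)" "continuous_on {-\<epsilon><..<\<epsilon>} \<Psi>'"
proof -
  obtain \<epsilon>0 \<rho> \<Psi> \<Psi>' where \<epsilon>0: "\<epsilon>0 > 0" and \<rho>: "\<rho> > 0"
    and \<Psi>: "\<And>t. \<bar>t\<bar> < \<epsilon>0 \<Longrightarrow> norm (\<Psi> t) \<le> \<rho> \<and> \<Psi> t = t *\<^sub>R N (\<Psi> t)"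
    and \<Psi>_uniq: "\<And>t x. \<bar>t\<bar> < \<epsilon>0 \<Longrightarrow> norm x \<le> \<rho> \<Longrightarrow> x = t *\<^sub>R N x \<Longrightarrow> x = \<Psi> t"
    and d\<Psi>: "\<And>t. \<bar>t\<bar> < \<epsilon>0 \<Longrightarrow> (\<Psi> has_vector_derivative \<Psi>' t) (at t)"
    and c\<Psi>': "continuous_on {-\<epsilon>0<..<\<epsilon>0} \<Psi>'"
    by (rule fixed_point_family[OF has_derivative_N continuous_on_N']) (rule that)
  \<comment> \<open>The reflected fixed point is a fixed point in the same ball, hence the
    same.\<close>
  have flip\<Psi>: "flip (\<Psi> t) = \<Psi> t" if "\<bar>t\<bar> < \<epsilon>0" for t
  proof (rule \<Psi>_uniq[OF that])
    show "norm (flip (\<Psi> t)) \<le> \<rho>" using \<Psi>[OF that] by simp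
    show "flip (\<Psi> t) = t *\<^sub>R N (flip (\<Psi> t))"
      using arg_cong[OF conjunct2[OF \<Psi>[OF that]], of flip] by (simp add: flip_scaleR flip_N)
  qed
  have coord\<Psi>: "coord (\<Psi> t) k = 0" if "\<bar>t\<bar> < \<epsilon>0" "k \<in> {0, k0, - k0}" for t k
    using arg_cong[OF conjunct2[OF \<Psi>[OF that(1)]], of "\<lambda>x. coord x k"] coord_N_0[OF that(2)] by simp
  define \<phi> where "\<phi> t = c0 - t * \<beta> (\<Psi> t)" for t
  define \<phi>' where "\<phi>' t = - (\<beta> (\<Psi> t) + t * pair_functional (dquad (\<Psi> t) (\<Psi>' t)))" for t
  obtain \<delta>0 where \<delta>0: "\<delta>0 > 0" "\<And>c x. solves c x \<Longrightarrow> \<bar>c - c0\<bar> < \<delta>0 \<Longrightarrow> norm x < \<delta>0 \<Longrightarrow>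
    norm (x - coord x k0 *\<^sub>R e0) \<le> \<rho> * \<bar>coord x k0\<bar>"
    by (rule small_solution_bound[OF \<rho>]) (rule that)
  define \<delta> where "\<delta> = min \<delta>0 \<epsilon>0"
  have \<delta>: "\<delta> > 0" using \<delta>0 \<epsilon>0 by (simp add: \<delta>_def)
  obtain C where C: "C > 0" "\<And>x y. norm (quad x y) \<le> norm x * norm y * C" using quad.pos_bounded by blast
  define A where "A = norm e0 + \<rho>"
  have A: "A > 0" using \<rho> by (simp add: A_def add_nonneg_pos)
  define B where "B = norm pair_functional * (A * A * C)"
  have B: "B \<ge> 0" using A C by (simp add: B_def)
  have nA: "norm (e0 + \<Psi> t) \<le> A" if "\<bar>t\<bar> < \<epsilon>0" for t
    using norm_triangle_ineq[of e0 "\<Psi> t"] \<Psi>[OF that] by (simp add: A_def)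
  have \<beta>B: "\<bar>\<beta> (\<Psi> t)\<bar> \<le> B" if "\<bar>t\<bar> < \<epsilon>0" for t
  proof -
    have "\<bar>\<beta> (\<Psi> t)\<bar> \<le> norm pair_functional * norm (quad_at (\<Psi> t))"
      unfolding \<beta>_def using norm_blinfun[of pair_functional "quad_at (\<Psi> t)"] by simp
    also have "norm (quad_at (\<Psi> t)) \<le> norm (e0 + \<Psi> t) * norm (e0 + \<Psi> t) * C"
      unfolding quad_at_def by (rule C(2))
    also have "\<dots> \<le> A * A * C" using nA[OF that] C A by (intro mult_right_mono mult_mono) auto
    finally show ?thesis by (simp add: B_def mult_left_mono)
  qed
  \<comment> \<open>\<open>B\<close> bounds \<beta> and \<open>A\<close> bounds the norm of
    \<open>e0 + \<Psi> t\<close> along the branch, so both components of the curve stay within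
    \<delta> of the bifurcation point.\<close>
  define \<epsilon> where "\<epsilon> = min \<epsilon>0 (min (\<delta> / (B + 1)) (\<delta> / (A + 1)))"
  have \<epsilon>: "\<epsilon> > 0" using \<epsilon>0 \<delta> A B by (simp add: \<epsilon>_def)
  have \<epsilon>\<epsilon>0: "\<bar>t\<bar> < \<epsilon>0" if "\<bar>t\<bar> < \<epsilon>" for t using that by (simp add: \<epsilon>_def)
  have "\<delta> / (A + 1) \<le> \<delta>" using \<delta> A by (simp add: field_simps)
  then have \<epsilon>\<delta>: "\<epsilon> \<le> \<delta>" by (simp add: \<epsilon>_def)
  have in1: "\<bar>\<phi> t - c0\<bar> < \<delta>" if "\<bar>t\<bar> < \<epsilon>" for t
  proof -
    have "\<bar>\<phi> t - c0\<bar> = \<bar>t\<bar> * \<bar>\<beta> (\<Psi> t)\<bar>" by (simp add: \<phi>_def abs_mult)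
    also have "\<dots> \<le> \<bar>t\<bar> * (B + 1)" using \<beta>B[OF \<epsilon>\<epsilon>0[OF that]] by (intro mult_left_mono) auto
    also have "\<dots> < \<delta>" using that B by (simp add: \<epsilon>_def pos_less_divide_eq)
    finally show ?thesis .
  qed
  have in2: "norm (t *\<^sub>R (e0 + \<Psi> t)) < \<delta>" if "\<bar>t\<bar> < \<epsilon>" for t
  proof -
    have "norm (t *\<^sub>R (e0 + \<Psi> t)) \<le> \<bar>t\<bar> * (A + 1)"
      using nA[OF \<epsilon>\<epsilon>0[OF that]] by (auto intro!: mult_left_mono)
    also have "\<dots> < \<delta>" using that A by (simp add: \<epsilon>_def pos_less_divide_eq)
    finally show ?thesis .
  qed
  have ck: "coord (t *\<^sub>R (e0 + \<Psi> t)) k0 = t" if "\<bar>t\<bar> < \<epsilon>" for t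
    using coord\<Psi>[OF \<epsilon>\<epsilon>0[OF that], of k0] by (simp add: coord_e0)
  \<comment> \<open>The bound on the coordinate at \<open>k0\<close> limits the parameter of the
    branch, since this coordinate equals \<open>t\<close> there. The last clause discards trivial
    solutions whose distance from \<open>c0\<close> lies between \<epsilon> and \<delta>; as the
    union of two open conditions it keeps \<open>U\<close> open.\<close>
  define U where "U = {(c, x). \<bar>c - c0\<bar> < \<delta> \<and> norm x < \<delta> \<and> \<bar>coord x k0\<bar> < \<epsilon> \<and> (x \<noteq> 0 \<or> \<bar>c - c0\<bar> < \<epsilon>)}"
  have solves0: "solves c 0" for c
    by (simp add: solves_def quad.zero_left) (rule l2_eqI, simp)
  show ?thesis
  proof (rule that[of \<epsilon> U \<phi> \<Psi> \<Psi>' \<phi>'])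
    have ccoord: "continuous_on UNIV (\<lambda>p :: real \<times> (int^'n) l2. coord (snd p) k0)"
      by (intro bounded_linear.continuous_on[OF bounded_linear_coord] continuous_intros)
    have "U = {p. \<bar>fst p - c0\<bar> < \<delta>} \<inter> {p. norm (snd p) < \<delta>} \<inter> {p. \<bar>coord (snd p) k0\<bar> < \<epsilon>} \<inter>
        ({p. snd p \<noteq> 0} \<union> {p. \<bar>fst p - c0\<bar> < \<epsilon>})"
      by (auto simp: U_def)
    also have "open \<dots>"
      by (intro open_Int open_Un open_Collect_less open_Collect_neq continuous_intros ccoord)
    finally show "open U" .
  next
    fix c x assume s: "solves c x" and U: "(c, x) \<in> U"
    define t where "t = coord x k0"
    have t: "\<bar>t\<bar> < \<epsilon>" and b: "norm (x - t *\<^sub>R e0) \<le> \<rho> * \<bar>t\<bar>"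
      using U \<delta>0(2)[OF s] by (auto simp: U_def \<delta>_def t_def)
    show "(x = 0 \<and> \<bar>c - c0\<bar> < \<epsilon>) \<or> (\<exists>t. \<bar>t\<bar> < \<epsilon> \<and> c = \<phi> t \<and> x = t *\<^sub>R (e0 + \<Psi> t))"
    proof (cases "t = 0")
      case True
      then have "x = 0" using b by simp
      then show ?thesis using U by (simp add: U_def)
    next
      case False
      define y where "y = (1 / t) *\<^sub>R x - e0"
      have xy: "x = t *\<^sub>R (e0 + y)" using False by (simp add: y_def)
      have fy: "flip y = y" "coord y 0 = 0" "coord y k0 = 0"
      proof -
        show "flip y = y" using s by (simp add: y_def flip_diff flip_scaleR flip_e0 solves_def)
        show "coord y 0 = 0" using s k0_neq by (simp add: y_def coord_e0 solves_def)
        show "coord y k0 = 0" using False by (simp add: y_def coord_e0 t_def)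
      qed
      have "\<bar>t\<bar> * norm y = norm (x - t *\<^sub>R e0)"
        unfolding xy by (simp add: scaleR_add_right)
      with b have "\<bar>t\<bar> * norm y \<le> \<bar>t\<bar> * \<rho>" by (simp only: mult.commute)
      then have "norm y \<le> \<rho>" using False by simp
      moreover have cy: "c = c0 - t * \<beta> y" "y = t *\<^sub>R N y"
        using solves_branch_iff[OF False fy, of c] s xy by auto
      ultimately have "y = \<Psi> t" using \<Psi>_uniq \<epsilon>\<epsilon>0[OF t] by blast
      then show ?thesis using t cy(1) xy by (auto simp: \<phi>_def)
    qed
  next
    fix t assume t: "\<bar>t\<bar> < \<epsilon>"
    show "(\<phi> t, t *\<^sub>R (e0 + \<Psi> t)) \<in> U \<and> solves (\<phi> t) (t *\<^sub>R (e0 + \<Psi> t))"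
    proof
      \<comment> \<open>For \<open>t \<noteq> 0\<close> the point is nonzero because its coordinate
        at \<open>k0\<close> is \<open>t\<close>; at \<open>t = 0\<close> the parameter is
        \<open>c0\<close> itself.\<close>
      have "t *\<^sub>R (e0 + \<Psi> t) \<noteq> 0 \<or> \<bar>\<phi> t - c0\<bar> < \<epsilon>"
      proof (cases "t = 0")
        case False
        then show ?thesis using ck[OF t] by (metis coord_simps(1))
      qed (simp add: \<phi>_def \<epsilon>)
      then show "(\<phi> t, t *\<^sub>R (e0 + \<Psi> t)) \<in> U"
        using in1[OF t] in2[OF t] ck[OF t] t unfolding U_def by auto
      show "solves (\<phi> t) (t *\<^sub>R (e0 + \<Psi> t))"
      proof (cases "t = 0")
        case True
        then show ?thesis using solves0 by simp
      next
        case False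
        have "flip (\<Psi> t) = \<Psi> t" "coord (\<Psi> t) 0 = 0" "coord (\<Psi> t) k0 = 0"
          using flip\<Psi> coord\<Psi> \<epsilon>\<epsilon>0[OF t] by auto
        from solves_branch_iff[OF False this] show ?thesis
          using \<Psi>[OF \<epsilon>\<epsilon>0[OF t]] by (simp add: \<phi>_def)
      qed
    qed
    show "flip (\<Psi> t) = \<Psi> t \<and> coord (\<Psi> t) 0 = 0 \<and> coord (\<Psi> t) k0 = 0"
      using flip\<Psi> coord\<Psi> \<epsilon>\<epsilon>0[OF t] by auto
    have I: "open {-\<epsilon>0<..<\<epsilon>0}" "t \<in> {-\<epsilon>0<..<\<epsilon>0}" using \<epsilon>\<epsilon>0[OF t] by auto
    have "flip (\<Psi>' t) = \<Psi>' t"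
      by (rule has_vector_derivative_invariant[OF bounded_linear_flip d\<Psi>[OF \<epsilon>\<epsilon>0[OF t]] I]) (auto intro!: flip\<Psi>)
    moreover have "coord (\<Psi>' t) 0 = 0"
    proof -
      have "((\<lambda>t. coord (\<Psi> t) 0) has_vector_derivative coord (\<Psi>' t) 0) (at t)"
        by (rule bounded_linear.has_vector_derivative[OF bounded_linear_coord d\<Psi>[OF \<epsilon>\<epsilon>0[OF t]]])
      then have "((\<lambda>t. 0) has_vector_derivative coord (\<Psi>' t) 0) (at t)"
        by (rule has_vector_derivative_transform_within_open[OF _ I]) (auto intro!: coord\<Psi>)
      then show ?thesis using vector_derivative_unique_at[OF _ has_vector_derivative_const] by blast
    qed
    ultimately show "flip (\<Psi>' t) = \<Psi>' t \<and> coord (\<Psi>' t) 0 = 0" ..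
    show "(\<Psi> has_vector_derivative \<Psi>' t) (at t)" by (rule d\<Psi>[OF \<epsilon>\<epsilon>0[OF t]])
    have "((\<lambda>t. \<beta> (\<Psi> t)) has_vector_derivative pair_functional (dquad (\<Psi> t) (\<Psi>' t))) (at t)"
      using has_derivative_compose[OF d\<Psi>[OF \<epsilon>\<epsilon>0[OF t], unfolded has_vector_derivative_def] has_derivative_\<beta>]
      unfolding has_vector_derivative_def
      by (rule has_derivative_eq_rhs) (simp add: fun_eq_iff blinfun.bilinear_simps)
    from has_vector_derivative_diff[OF has_vector_derivative_const has_vector_derivative_mult[OF has_vector_derivative_id this], of c0]
    show "(\<phi> has_vector_derivative \<phi>' t) (at t)"
      unfolding \<phi>_def[abs_def] \<phi>'_def by (simp add: algebra_simps)
  next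
    fix c assume c: "\<bar>c - c0\<bar> < \<epsilon>"
    then show "(c, 0) \<in> U" using \<epsilon>\<delta> \<epsilon> \<delta> by (auto simp: U_def)
  next
    have sub: "{-\<epsilon><..<\<epsilon>} \<subseteq> {-\<epsilon>0<..<\<epsilon>0}" by (auto simp: \<epsilon>_def)
    show c: "continuous_on {-\<epsilon><..<\<epsilon>} \<Psi>'" using c\<Psi>' sub by (rule continuous_on_subset)
    have c\<Psi>: "continuous_on {-\<epsilon><..<\<epsilon>} \<Psi>"
    proof (intro continuous_at_imp_continuous_on ballI)
      fix t assume "t \<in> {-\<epsilon><..<\<epsilon>}"
      then have "\<bar>t\<bar> < \<epsilon>" by auto
      then show "isCont \<Psi> t" by (intro has_vector_derivative_continuous[OF d\<Psi>] \<epsilon>\<epsilon>0)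
    qed
    have "continuous_on {-\<epsilon><..<\<epsilon>} (\<lambda>t. \<beta> (\<Psi> t))"
      by (rule continuous_on_compose2[OF continuous_on_\<beta>[of UNIV] c\<Psi>]) simp
    moreover have "continuous_on {-\<epsilon><..<\<epsilon>} (\<lambda>t. dquad (\<Psi> t))"
      by (rule continuous_on_compose2[OF continuous_on_dquad[of UNIV] c\<Psi>]) simp
    ultimately show "continuous_on {-\<epsilon><..<\<epsilon>} \<phi>'"
      unfolding \<phi>'_def[abs_def] using c by (intro continuous_intros)
  qed (fact \<epsilon>)
qed

end

section \<open>Sobolev functions as weighted sequences\<close>

text \<open>The Sobolev embedding into the Wiener algebra of order 2: Cauchy-Schwarz against
  \<open>wt (- s)\<close>, which is square summable because \<open>s\<close> exceeds half the
  dimension.\<close>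

lemma summable_coord_div_wt:
  fixes x :: "(int^'n) l2"
  assumes s: "s > real CARD('n) / 2"
  shows "(\<lambda>k. wt 2 k * norm (complex_of_real (coord x k / wt (s + 2) k))) summable_on UNIV"
proof -
  obtain G :: "(int^'n) l2" where G: "coord G = wt (- s)"
    using wt_l2[OF s] by blast
  have "wt 2 k = wt (- s) k * wt (s + 2) k" for k :: "int^'n"
    unfolding wt_add[symmetric] by (rule arg_cong[of _ _ "\<lambda>r. wt r k"]) simp
  then have "\<bar>coord G k * coord x k\<bar> = wt 2 k * norm (complex_of_real (coord x k / wt (s + 2) k))" for k
    by (simp add: G abs_mult norm_divide)
  then show ?thesis using abs_summable_coord_mult(1)[of G x] by simp
qed

text \<open>On even sequences an isometry into the Sobolev space of order
  \<open>s + 2\<close>.\<close>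

definition l2_fun :: "real \<Rightarrow> (int^'n) l2 \<Rightarrow> 'n::finite torus_fun" where
  "l2_fun s x = trig_fun (\<lambda>k. of_real (coord x k / wt (s + 2) k))"

text \<open>Even functions have real coefficients, so on \<open>X_space s\<close> taking the real
  part is a mere change of type.\<close>

definition fun_l2 :: "real \<Rightarrow> 'n::finite torus_fun \<Rightarrow> (int^'n) l2" where
  "fun_l2 s f = l2_of (\<lambda>k. wt (s + 2) k * Re (fourier f k))"

context
  fixes s :: real
  assumes s: "s > real CARD('n::finite) / 2"
begin

lemma coord_even: "flip x = x \<Longrightarrow> coord x (- k) = coord x k"
  by (metis coord_flip)

lemma
  fixes x :: "(int^'n) l2"
  assumes x: "flip x = x"
  shows wiener_l2_fun: "wiener 2 (l2_fun s x)"
    and fourier_l2_fun: "fourier (l2_fun s x) k = of_real (coord x k / wt (s + 2) k)"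
    and reflect_l2_fun: "reflect (l2_fun s x) = l2_fun s x"
proof -
  have e: "complex_of_real (coord x (- k) / wt (s + 2) (- k)) = of_real (coord x k / wt (s + 2) k)" for k
    by (simp add: coord_even[OF x])
  then have h: "complex_of_real (coord x (- k) / wt (s + 2) (- k)) = cnj (of_real (coord x k / wt (s + 2) k))" for k
    by simp
  note w = wiener_trig_fun[OF _ summable_coord_div_wt[OF s, of x] h]
  show "wiener 2 (l2_fun s x)" "fourier (l2_fun s x) k = of_real (coord x k / wt (s + 2) k)"
    unfolding l2_fun_def using w by simp_all
  show "reflect (l2_fun s x) = l2_fun s x" unfolding l2_fun_def by (rule reflect_trig_fun) (rule e)
qed

lemma wiener_L2: "wiener 0 f \<Longrightarrow> f \<in> torus_L2"
  using torus_L2_trig_fun[OF wiener_hermitian[of 0 f]] trig_fun_fourier[of 0 f] by simp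

lemma l2_fun_weighted_square:
  fixes x :: "(int^'n) l2"
  assumes "flip x = x"
  shows "(1 + (norm (int_vec k))\<^sup>2) powr (s + 2) * (norm (fourier (l2_fun s x) k))\<^sup>2 = (coord x k)\<^sup>2"
  by (simp add: fourier_l2_fun[OF assms] norm_divide power_divide flip: wt_square)

lemma l2_fun_sobolev:
  fixes x :: "(int^'n) l2"
  assumes "flip x = x"
  shows "l2_fun s x \<in> sobolev (s + 2)" "sobolev_norm (s + 2) (l2_fun s x) = norm x"
  unfolding sobolev_def sobolev_norm_def mem_Collect_eq l2_fun_weighted_square[OF assms] norm_l2_infsum
  using summable_coord_square[of x] wiener_L2 wiener_mono[OF wiener_l2_fun[OF assms], of 0] by auto

lemma l2_fun_eqI:
  fixes x :: "(int^'n) l2"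
  assumes "flip x = x" "torus_L1 f" "\<And>k. fourier f k = of_real (coord x k / wt (s + 2) k)"
  shows "f = l2_fun s x"
  using assms by (intro fourier_eqI) (auto simp: fourier_l2_fun intro: wiener_L1[OF wiener_l2_fun])

lemma l2_fun_linear:
  fixes x y :: "(int^'n) l2"
  assumes x: "flip x = x" and y: "flip y = y"
  shows "l2_fun s x + l2_fun s y = l2_fun s (x + y)"
    and "l2_fun s x - l2_fun s y = l2_fun s (x - y)"
    and "c *\<^sub>R l2_fun s x = l2_fun s (c *\<^sub>R x)"
  using wiener_L1[OF wiener_l2_fun[OF x]] wiener_L1[OF wiener_l2_fun[OF y]]
  by (auto intro!: l2_fun_eqI l2_eqI
      simp: coord_even[OF x] coord_even[OF y] fourier_add fourier_diff fourier_scaleR fourier_l2_fun[OF x] fourier_l2_fun[OF y]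
        add_divide_distrib diff_divide_distrib)

lemma l2_fun_0: "l2_fun s (0 :: (int^'n) l2) = 0"
  by (rule l2_fun_eqI[symmetric]) (auto intro: l2_eqI)

lemma l2_fun_X_space:
  fixes x :: "(int^'n) l2"
  assumes "flip x = x" "coord x 0 = 0"
  shows "l2_fun s x \<in> X_space s"
proof -
  have "torus_integral (l2_fun s x) = 0"
    using fourier_zero_torus_integral[of "l2_fun s x"] fourier_l2_fun[OF assms(1), of 0] assms(2) by simp
  then show ?thesis
    by (simp add: X_space_def sobolev_even0_def l2_fun_sobolev assms reflect_l2_fun)
qed

lemma
  fixes v :: "'n torus_fun"
  assumes v: "v \<in> X_space s"
  shows coord_fun_l2: "coord (fun_l2 s v) k = wt (s + 2) k * Re (fourier v k)"
    and flip_fun_l2: "flip (fun_l2 s v) = fun_l2 s v"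
    and coord_fun_l2_0: "coord (fun_l2 s v) 0 = 0"
    and l2_fun_fun_l2: "l2_fun s (fun_l2 s v) = v"
proof -
  have V: "v \<in> sobolev (s + 2)" "torus_integral v = 0" "reflect v = v"
    using v by (auto simp: X_space_def sobolev_even0_def)
  have re: "of_real (Re (fourier v k)) = fourier v k" for k
    using fourier_even_real[OF V(3), of k] by simp
  have "(norm (fourier v k))\<^sup>2 = (Re (fourier v k))\<^sup>2" for k
    using re[of k] by (metis norm_of_real power2_abs)
  then have "(\<lambda>k. (wt (s + 2) k * Re (fourier v k))\<^sup>2) summable_on UNIV"
    using V(1) by (simp add: sobolev_def power_mult_distrib wt_square)
  then have c: "coord (fun_l2 s v) = (\<lambda>k. wt (s + 2) k * Re (fourier v k))"
    unfolding fun_l2_def by (intro l2_of_inverse) simp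
  then show "coord (fun_l2 s v) k = wt (s + 2) k * Re (fourier v k)" by simp
  show f: "flip (fun_l2 s v) = fun_l2 s v" by (rule l2_eqI) (simp add: c fourier_hermitian)
  show "coord (fun_l2 s v) 0 = 0" using V(2) by (simp add: c fourier_zero_torus_integral)
  show "l2_fun s (fun_l2 s v) = v"
    by (rule l2_fun_eqI[OF f, symmetric]) (use V in \<open>auto simp: c re sobolev_def torus_L2_L1\<close>)
qed

lemma fun_l2_l2_fun:
  fixes x :: "(int^'n) l2"
  assumes "flip x = x" "coord x 0 = 0"
  shows "fun_l2 s (l2_fun s x) = x"
  by (rule l2_eqI) (simp add: coord_fun_l2[OF l2_fun_X_space[OF assms]] fourier_l2_fun[OF assms(1)])

lemma norm_fun_l2_diff:
  fixes v w :: "'n torus_fun"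
  assumes "v \<in> X_space s" "w \<in> X_space s"
  shows "sobolev_norm (s + 2) (v - w) = norm (fun_l2 s v - fun_l2 s w)"
proof -
  have "flip (fun_l2 s v - fun_l2 s w) = fun_l2 s v - fun_l2 s w"
    using assms by (intro l2_eqI) (simp add: coord_even flip_fun_l2)
  from l2_fun_sobolev(2)[OF this] show ?thesis
    using assms by (simp add: l2_fun_fun_l2 flip_fun_l2 flip: l2_fun_linear(2))
qed

text \<open>The isometry transports the topology. The product distance is at most the sum of the two
  distances, hence \<open>e / 2\<close> for each.\<close>

lemma open_in_R_X_preimage:
  fixes U :: "(real \<times> (int^'n) l2) set"
  assumes U: "open U"
  shows "open_in_R_X s {(c, v). v \<in> X_space s \<and> (c, fun_l2 s v) \<in> U}"
  unfolding open_in_R_X_def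
proof (intro conjI ballI)
  fix p assume "p \<in> {(c, v :: 'n torus_fun). v \<in> X_space s \<and> (c, fun_l2 s v) \<in> U}"
  then obtain c v where p: "p = (c, v)" "v \<in> X_space s" "(c, fun_l2 s v) \<in> U" by auto
  obtain e where e: "e > 0" "\<And>q. dist q (c, fun_l2 s v) < e \<Longrightarrow> q \<in> U"
    using U p(3) unfolding open_dist by blast
  have "(c', v') \<in> {(c, v). v \<in> X_space s \<and> (c, fun_l2 s v) \<in> U}"
    if "v' \<in> X_space s" "\<bar>c' - c\<bar> < e / 2 \<and> sobolev_norm (s + 2) (v' - v) < e / 2" for c' v'
  proof -
    have "dist (c', fun_l2 s v') (c, fun_l2 s v) \<le> dist c' c + dist (fun_l2 s v') (fun_l2 s v)"
      unfolding dist_prod_def fst_conv snd_conv by (rule sqrt_sum_squares_le_sum) auto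
    also have "\<dots> < e" using that norm_fun_l2_diff[OF that(1) p(2)] by (simp add: dist_norm)
    finally show ?thesis using e(2) that(1) by simp
  qed
  then show "case p of (c, v) \<Rightarrow> \<exists>\<delta>>0. \<forall>c'. \<forall>v'\<in>X_space s.
      \<bar>c' - c\<bar> < \<delta> \<and> sobolev_norm (s + 2) (v' - v) < \<delta> \<longrightarrow>
      (c', v') \<in> {(c, v). v \<in> X_space s \<and> (c, fun_l2 s v) \<in> U}"
    unfolding p(1) prod.case using e(1) by (intro exI[of _ "e / 2"]) auto
qed auto

text \<open>Difference quotients of the functions are images of difference quotients of the
  sequences. Evenness of every intermediate sequence is checked since linearity and isometry of
  \<open>l2_fun\<close> are available for even sequences.\<close>

lemma has_sobolev_derivative_l2_fun:
  fixes x :: "real \<Rightarrow> (int^'n) l2"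
  assumes d: "(x has_vector_derivative x') (at t)" and ev: "\<And>\<tau>. \<tau> \<in> I \<Longrightarrow> flip (x \<tau>) = x \<tau>" "flip x' = x'" and t: "t \<in> I"
  shows "has_sobolev_derivative (s + 2) (\<lambda>\<tau>. l2_fun s (x \<tau>)) (l2_fun s x') I t"
proof -
  have "((\<lambda>\<tau>. (x \<tau> - x t) /\<^sub>R (\<tau> - t) - x') \<longlongrightarrow> 0) (at t)"
  proof -
    have "((\<lambda>\<tau>. (1 / norm (\<tau> - t)) *\<^sub>R (x \<tau> - (x t + (\<tau> - t) *\<^sub>R x'))) \<longlongrightarrow> 0) (at t)"
      using d unfolding has_vector_derivative_def has_derivative_at2 by simp
    then have "((\<lambda>\<tau>. norm ((1 / norm (\<tau> - t)) *\<^sub>R (x \<tau> - (x t + (\<tau> - t) *\<^sub>R x')))) \<longlongrightarrow> 0) (at t)"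
      by (rule tendsto_norm_zero)
    \<comment> \<open>The quotient by \<open>norm (\<tau> - t)\<close> differs from the one by
      \<open>\<tau> - t\<close> at most in sign, which the outer norm removes.\<close>
    moreover have "\<forall>\<^sub>F \<tau> in at t. norm ((1 / norm (\<tau> - t)) *\<^sub>R (x \<tau> - (x t + (\<tau> - t) *\<^sub>R x')))
        = norm ((x \<tau> - x t) /\<^sub>R (\<tau> - t) - x')"
      unfolding eventually_at_filter
    proof (rule always_eventually, intro allI impI)
      fix \<tau> assume n: "\<tau> \<noteq> t"
      have "(x \<tau> - x t) /\<^sub>R (\<tau> - t) - x' = (x \<tau> - (x t + (\<tau> - t) *\<^sub>R x')) /\<^sub>R (\<tau> - t)"
        using n by (simp add: scaleR_diff_right scaleR_add_right)
      then show "norm ((1 / norm (\<tau> - t)) *\<^sub>R (x \<tau> - (x t + (\<tau> - t) *\<^sub>R x')))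
        = norm ((x \<tau> - x t) /\<^sub>R (\<tau> - t) - x')" by (simp add: divide_inverse)
    qed
    ultimately have "((\<lambda>\<tau>. norm ((x \<tau> - x t) /\<^sub>R (\<tau> - t) - x')) \<longlongrightarrow> 0) (at t)"
      by (rule Lim_transform_eventually)
    then show ?thesis by (rule tendsto_norm_zero_cancel)
  qed
  then have lim: "((\<lambda>\<tau>. norm ((x \<tau> - x t) /\<^sub>R (\<tau> - t) - x')) \<longlongrightarrow> 0) (at t within I)"
    by (intro tendsto_norm_zero) (rule tendsto_within_subset[OF _ subset_UNIV])
  have eq: "norm ((x \<tau> - x t) /\<^sub>R (\<tau> - t) - x')
      = sobolev_norm (s + 2) ((l2_fun s (x \<tau>) - l2_fun s (x t)) /\<^sub>R (\<tau> - t) - l2_fun s x')" if "\<tau> \<in> I" for \<tau>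
  proof -
    have e: "flip (x \<tau> - x t) = x \<tau> - x t"
      using ev(1)[OF that] ev(1)[OF t] by (intro l2_eqI) (simp add: coord_even)
    have e': "flip ((x \<tau> - x t) /\<^sub>R (\<tau> - t)) = (x \<tau> - x t) /\<^sub>R (\<tau> - t)"
      using e by (metis coord_flip coord_simps(5) l2_eqI)
    have e'': "flip ((x \<tau> - x t) /\<^sub>R (\<tau> - t) - x') = (x \<tau> - x t) /\<^sub>R (\<tau> - t) - x'"
      using e' ev(2) by (metis coord_flip coord_simps(3) l2_eqI)
    show ?thesis
      unfolding l2_fun_linear(2)[OF ev(1)[OF that] ev(1)[OF t]] l2_fun_linear(3)[OF e e] l2_fun_linear(2)[OF e' ev(2)]
        l2_fun_sobolev(2)[OF e''] ..
  qed
  have eventually_eq: "\<forall>\<^sub>F \<tau> in at t within I. norm ((x \<tau> - x t) /\<^sub>R (\<tau> - t) - x')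
      = sobolev_norm (s + 2) ((l2_fun s (x \<tau>) - l2_fun s (x t)) /\<^sub>R (\<tau> - t) - l2_fun s x')"
    unfolding eventually_at_filter by (intro always_eventually allI impI eq)
  show ?thesis
    unfolding has_sobolev_derivative_def by (rule Lim_transform_eventually[OF lim eventually_eq])
qed

end

section \<open>The bifurcation theorem\<close>

text \<open>The factor \<open>(norm (int_vec k))\<^sup>2 / wt r k\<close> undoes the normalization
  in \<open>quad_kernel\<close>; at \<open>k = 0\<close> the conventional value 0 of the kernel
  agrees with the vanishing inner product.\<close>

lemma (in quadratic) fourier_bif_map_l2_fun:
  fixes \<Phi> :: "'n::finite torus_fun"
  assumes rs: "r = s + 2" "s > real CARD('n) / 2" and \<Phi>: "torus_L1 \<Phi>" "\<And>k. fourier \<Phi> k = of_real (P k)"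
    and x: "flip x = x"
  shows "fourier (bif_map a \<Phi> c (l2_fun s x)) k = of_real
    (- (4 * pi\<^sup>2) * ((norm (int_vec k))\<^sup>2 / wt r k) * ((a + c * P k) * coord x k + coord (quad x x) k))"
proof -
  let ?v = "l2_fun s x"
  let ?n = "(norm (int_vec k))\<^sup>2"
  have fv: "fourier ?v k = of_real (coord x k / wt r k)" for k
    unfolding rs(1) by (rule fourier_l2_fun[OF rs(2) x])
  have "((\<lambda>j. ?n / wt r k * (quad_kernel r P k j * coord x j * coord x (k - j))) has_sum ?n / wt r k * coord (quad x x) k) UNIV"
    by (rule has_sum_cmult_right[OF has_sum_quad])
  also have "(\<lambda>j. ?n / wt r k * (quad_kernel r P k j * coord x j * coord x (k - j)))
      = (\<lambda>j. (int_vec k \<bullet> int_vec j) * P j * (coord x j / wt r j) * (coord x (k - j) / wt r (k - j)))"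
    by (rule ext, cases "k = 0") (simp_all add: quad_kernel_def field_simps)
  finally have "((\<lambda>j. complex_of_real ((int_vec k \<bullet> int_vec j) * P j * (coord x j / wt r j) * (coord x (k - j) / wt r (k - j))))
      has_sum of_real (?n / wt r k * coord (quad x x) k)) UNIV"
    by (simp only: has_sum_of_real_iff)
  then have "((\<lambda>j. of_real (int_vec k \<bullet> int_vec j) * fourier \<Phi> j * fourier ?v j * fourier ?v (k - j))
      has_sum of_real (?n / wt r k * coord (quad x x) k)) UNIV"
    by (simp add: fv \<Phi>)
  from fourier_bif_map[OF \<Phi>(1) wiener_l2_fun[OF rs(2) x] this, of a c]
  show ?thesis by (simp add: fv \<Phi> field_simps)
qed

text \<open>After division by \<open>- (4 * pi\<^sup>2) * (norm (int_vec k))\<^sup>2\<close> the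
  left side is a bounded expression \<open>z\<close> in \<open>l2\<close>. Multiplying back costs at
  most \<open>wt 2 k\<close>, that is two orders, and kills the mode 0, whence the zero
  mean.\<close>

lemma (in quadratic) bif_map_Y_space:
  fixes \<Phi> :: "'n::finite torus_fun"
  assumes rs: "r = s + 2" "s > real CARD('n) / 2" and \<Phi>: "torus_L1 \<Phi>" "\<And>k. fourier \<Phi> k = of_real (P k)"
    and x: "flip x = x"
  shows "bif_map a \<Phi> c (l2_fun s x) \<in> Y_space s"
proof -
  let ?w = "bif_map a \<Phi> c (l2_fun s x)"
  define z where "z = a *\<^sub>R x + c *\<^sub>R multiplier P x + quad x x"
  have z: "coord z k = (a + c * P k) * coord x k + coord (quad x x) k" for k
    by (simp add: z_def coord_multiplier[of P M, OF P_le] algebra_simps)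
  have fw: "fourier ?w k = of_real (- (4 * pi\<^sup>2) * ((norm (int_vec k))\<^sup>2 / wt r k) * coord z k)" for k
    unfolding z by (rule fourier_bif_map_l2_fun[OF rs \<Phi> x])
  have w: "wiener 0 ?w" by (rule wiener_bif_map[OF \<Phi>(1) wiener_l2_fun[OF rs(2) x]])
  have fz: "coord z (- k) = coord z k" for k
  proof -
    have "coord (quad x x) (- k) = coord (quad x x) k"
      using flip_quad[of x x] x by (metis coord_flip)
    then show ?thesis by (simp add: z P_even coord_even[OF rs(2) x])
  qed
  have "(\<lambda>k. (1 + (norm (int_vec k))\<^sup>2) powr s * (norm (fourier ?w k))\<^sup>2) summable_on UNIV"
  proof (rule summable_on_comparison_test[OF summable_on_cmult_right[OF summable_coord_square[of z], of "(4 * pi\<^sup>2)\<^sup>2"]])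
    fix k :: "int^'n"
    have q: "(norm (int_vec k))\<^sup>2 / wt r k \<le> 1 / wt s k"
    proof -
      have "(norm (int_vec k))\<^sup>2 \<le> wt 2 k" by (simp add: wt_2)
      then have "(norm (int_vec k))\<^sup>2 / wt r k \<le> wt 2 k / wt r k" by (rule divide_right_mono) simp
      also have "\<dots> = 1 / wt s k" by (simp add: rs(1) wt_add)
      finally show ?thesis .
    qed
    have "norm (fourier ?w k) = (4 * pi\<^sup>2) * ((norm (int_vec k))\<^sup>2 / wt r k) * \<bar>coord z k\<bar>"
      unfolding fw norm_of_real abs_mult by simp
    also have "\<dots> \<le> (4 * pi\<^sup>2) * (1 / wt s k) * \<bar>coord z k\<bar>"
      by (intro mult_right_mono mult_left_mono q) auto
    finally have "wt s k * norm (fourier ?w k) \<le> wt s k * ((4 * pi\<^sup>2) * (1 / wt s k) * \<bar>coord z k\<bar>)"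
      by (rule mult_left_mono) simp
    then have "wt s k * norm (fourier ?w k) \<le> (4 * pi\<^sup>2) * \<bar>coord z k\<bar>" by simp
    then have "(wt s k * norm (fourier ?w k))\<^sup>2 \<le> ((4 * pi\<^sup>2) * \<bar>coord z k\<bar>)\<^sup>2"
      by (rule power_mono) simp
    then show "(1 + (norm (int_vec k))\<^sup>2) powr s * (norm (fourier ?w k))\<^sup>2 \<le> (4 * pi\<^sup>2)\<^sup>2 * (coord z k)\<^sup>2"
      by (simp add: power_mult_distrib flip: wt_square)
  qed simp
  then have "?w \<in> sobolev s"
    using wiener_L2[OF rs(2) w] by (simp add: sobolev_def)
  moreover have "torus_integral ?w = 0"
    using fourier_zero_torus_integral[of ?w] fw[of 0] by simp
  moreover have "reflect ?w = ?w"
  proof -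
    have "reflect (trig_fun (fourier ?w)) = trig_fun (fourier ?w)"
      by (rule reflect_trig_fun) (simp add: fw fz)
    then show ?thesis using trig_fun_fourier[OF w] by simp
  qed
  ultimately show ?thesis by (simp add: Y_space_def sobolev_even0_def)
qed

text \<open>The prefactor of the coefficient formula vanishes only at \<open>k = 0\<close>, where
  the condition in \<open>solves\<close> holds anyway.\<close>

lemma (in bifurcation) bif_map_eq_0_iff:
  fixes \<Phi> :: "'n::finite torus_fun"
  assumes rs: "r = s + 2" "s > real CARD('n) / 2" and \<Phi>: "torus_L1 \<Phi>" "\<And>k. fourier \<Phi> k = of_real (P k)"
    and x: "flip x = x" "coord x 0 = 0"
  shows "bif_map a \<Phi> c (l2_fun s x) = 0 \<longleftrightarrow> solves c x"
proof -
  let ?w = "bif_map a \<Phi> c (l2_fun s x)"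
  have w: "wiener 0 ?w" by (rule wiener_bif_map[OF \<Phi>(1) wiener_l2_fun[OF rs(2) x(1)]])
  have "?w = 0 \<longleftrightarrow> (\<forall>k. fourier ?w k = 0)"
    using fourier_eqI[OF wiener_L1[OF w] torus_L1_0] by auto
  also have "\<dots> \<longleftrightarrow> (\<forall>k. k \<noteq> 0 \<longrightarrow> (a + c * P k) * coord x k + coord (quad x x) k = 0)"
    unfolding fourier_bif_map_l2_fun[OF rs \<Phi> x(1)] of_real_eq_0_iff mult_eq_0_iff by auto
  also have "\<dots> \<longleftrightarrow> solves c x"
    unfolding solves_def using x coord_quad_0[of x x] by (metis add.right_neutral mult_zero_right)
  finally show ?thesis .
qed

text \<open>If infinitely many coefficients exceeded \<eta>, finite sets of them would push the sum
  in Bessel's inequality beyond its bound. This is how the symbol is kept away from zero at high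
  frequencies.\<close>

lemma finite_large_fourier:
  fixes \<Phi> :: "'n::finite torus_fun"
  assumes "\<Phi> \<in> torus_L2" "\<eta> > 0"
  shows "finite {k. \<eta> < norm (fourier \<Phi> k)}"
proof (rule ccontr)
  assume inf: "infinite {k. \<eta> < norm (fourier \<Phi> k)}"
  obtain B where B: "\<And>F. finite F \<Longrightarrow> (\<Sum>k\<in>F. (norm (fourier \<Phi> k))\<^sup>2) \<le> B"
    using bessel[OF assms(1)] by blast
  obtain n :: nat where n: "B < real n * \<eta>\<^sup>2"
    using ex_less_of_nat_mult[of "\<eta>\<^sup>2" B] assms(2) by auto
  obtain F where F: "F \<subseteq> {k. \<eta> < norm (fourier \<Phi> k)}" "finite F" "card F = n"
    using infinite_arbitrarily_large[OF inf] by blast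
  have "real n * \<eta>\<^sup>2 = (\<Sum>k\<in>F. \<eta>\<^sup>2)" by (simp add: F)
  also have "\<dots> \<le> (\<Sum>k\<in>F. (norm (fourier \<Phi> k))\<^sup>2)"
    using F(1) assms(2) by (intro sum_mono power_mono) (auto simp: less_imp_le)
  also have "\<dots> \<le> B" by (rule B[OF F(2)])
  finally show False using n by simp
qed

theorem theorem2p1:
  fixes a s c0 :: real and \<Phi> :: "'n::finite torus_fun" and k0 :: "int^'n"
  assumes a: "a > 0"
    and \<Phi>: "\<Phi> \<in> torus_L2" "reflect \<Phi> = \<Phi>"
    and s: "s > real CARD('n) / 2"
    and k0: "k0 \<noteq> 0" "fourier \<Phi> k0 \<noteq> 0"
      "\<And>k. k \<noteq> k0 \<Longrightarrow> k \<noteq> - k0 \<Longrightarrow> fourier \<Phi> k \<noteq> fourier \<Phi> k0"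
    and c0: "c0 = - a / Re (fourier \<Phi> k0)"
  shows "(\<forall>c. \<forall>v\<in>X_space s. bif_map a \<Phi> c v \<in> Y_space s) \<and>
    (\<exists>\<epsilon>>0. \<exists>U. \<exists>v0\<in>X_space s. \<exists>\<phi> :: real \<Rightarrow> real. \<exists>\<psi> :: real \<Rightarrow> 'n torus_fun.
       open_in_R_X s U \<and> (c0, 0) \<in> U \<and>
       \<phi> C1_differentiable_on {-\<epsilon><..<\<epsilon>} \<and>
       C1_curve (s + 2) (X_space s) {-\<epsilon><..<\<epsilon>} \<psi> \<and>
       {(c, v). v \<in> X_space s \<and> bif_map a \<Phi> c v = 0} \<inter> U
         = {(\<phi> t, t *\<^sub>R v0 + t *\<^sub>R \<psi> t) | t. \<bar>t\<bar> < \<epsilon>} \<union> {(c, 0) | c. \<bar>c - c0\<bar> < \<epsilon>} \<and>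
       (let u = (\<lambda>t. of_real (\<phi> t) + t *\<^sub>R v0 + t *\<^sub>R \<psi> t)
        in differentiable_curve (s + 2) (sobolev (s + 2)) {-\<epsilon><..<\<epsilon>} u \<and>
           (\<exists>\<delta>>0. \<delta> \<le> \<epsilon> \<and> (\<forall>t. 0 < \<bar>t\<bar> \<and> \<bar>t\<bar> < \<delta> \<longrightarrow>
              is_solution a \<Phi> (u t) \<and> (\<forall>\<kappa>::real. u t \<noteq> of_real \<kappa>)))))"
proof -
  define P where "P k = Re (fourier \<Phi> k)" for k
  have \<Phi>1: "torus_L1 \<Phi>" by (rule torus_L2_L1[OF \<Phi>(1)])
  have P: "fourier \<Phi> k = of_real (P k)" for k
    using fourier_even_real[OF \<Phi>(2), of k] by (simp add: P_def)
  obtain M where M: "\<And>k. norm (fourier \<Phi> k) \<le> M" using fourier_bound[OF \<Phi>1] by blast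
  interpret B: bifurcation "s + 2" P M a k0
  proof
    show "\<bar>P k\<bar> \<le> M" for k using M[of k] by (simp add: P)
    show "P (- k) = P k" for k by (simp add: P_def fourier_hermitian)
    show "s + 2 > 1 + real CARD('n) / 2" using s by simp
    show "P k0 \<noteq> 0" using k0(2) by (simp add: P)
    show "P k \<noteq> P k0" if "k \<noteq> k0" "k \<noteq> - k0" for k using k0(3)[OF that] by (simp add: P)
    show "finite {k. \<eta> < \<bar>P k\<bar>}" if "\<eta> > 0" for \<eta>
      using finite_large_fourier[OF \<Phi>(1) that] by (simp add: P)
  qed (use a k0 in auto)
  have c0B: "c0 = B.c0" by (simp add: c0 B.c0_def P_def)
  note solves_iff = B.bif_map_eq_0_iff[OF refl s \<Phi>1 P]
  have X: "bif_map a \<Phi> c v \<in> Y_space s" if "v \<in> X_space s" for c v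
    using B.bif_map_Y_space[OF refl s \<Phi>1 P flip_fun_l2[OF s that], of a c] l2_fun_fun_l2[OF s that] by simp
  obtain \<epsilon> U \<phi> \<phi>' \<Psi> \<Psi>' where \<epsilon>: "\<epsilon> > 0" and U: "open U"
    and zeros: "\<And>c x. B.solves c x \<Longrightarrow> (c, x) \<in> U \<Longrightarrow>
      (x = 0 \<and> \<bar>c - B.c0\<bar> < \<epsilon>) \<or> (\<exists>t. \<bar>t\<bar> < \<epsilon> \<and> c = \<phi> t \<and> x = t *\<^sub>R (B.e0 + \<Psi> t))"
    and branch: "\<And>t. \<bar>t\<bar> < \<epsilon> \<Longrightarrow> (\<phi> t, t *\<^sub>R (B.e0 + \<Psi> t)) \<in> U \<and> B.solves (\<phi> t) (t *\<^sub>R (B.e0 + \<Psi> t))"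
    and trivial: "\<And>c. \<bar>c - B.c0\<bar> < \<epsilon> \<Longrightarrow> (c, 0) \<in> U"
    and \<Psi>: "\<And>t. \<bar>t\<bar> < \<epsilon> \<Longrightarrow> flip (\<Psi> t) = \<Psi> t \<and> coord (\<Psi> t) 0 = 0 \<and> coord (\<Psi> t) k0 = 0"
    and \<Psi>': "\<And>t. \<bar>t\<bar> < \<epsilon> \<Longrightarrow> flip (\<Psi>' t) = \<Psi>' t \<and> coord (\<Psi>' t) 0 = 0"
    and d\<phi>: "\<And>t. \<bar>t\<bar> < \<epsilon> \<Longrightarrow> (\<phi> has_vector_derivative \<phi>' t) (at t)" and c\<phi>': "continuous_on {-\<epsilon><..<\<epsilon>} \<phi>'"
    and d\<Psi>: "\<And>t. \<bar>t\<bar> < \<epsilon> \<Longrightarrow> (\<Psi> has_vector_derivative \<Psi>' t) (at t)" and c\<Psi>': "continuous_on {-\<epsilon><..<\<epsilon>} \<Psi>'"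
    by (rule B.local_branch) (rule that)
  have e0: "flip B.e0 = B.e0" "coord B.e0 0 = 0"
    using B.k0_neq by (simp_all add: B.flip_e0 B.coord_e0)
  define v0 where "v0 = l2_fun s B.e0"
  define \<psi> where "\<psi> t = l2_fun s (\<Psi> t)" for t
  define W where "W = {(c, v). v \<in> X_space s \<and> (c, fun_l2 s v) \<in> U}"
  have v0X: "v0 \<in> X_space s" unfolding v0_def by (rule l2_fun_X_space[OF s e0])
  define z where "z t = t *\<^sub>R (B.e0 + \<Psi> t)" for t
  have z: "flip (z t) = z t" "coord (z t) 0 = 0" if "\<bar>t\<bar> < \<epsilon>" for t
    using branch[OF that] by (auto simp: z_def B.solves_def)
  have vz: "t *\<^sub>R v0 + t *\<^sub>R \<psi> t = l2_fun s (z t)" if "\<bar>t\<bar> < \<epsilon>" for t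
  proof -
    have f: "flip (\<Psi> t) = \<Psi> t" using \<Psi>[OF that] by simp
    have fs: "flip (B.e0 + \<Psi> t) = B.e0 + \<Psi> t" using f e0 by (simp add: B.flip_add)
    have "t *\<^sub>R v0 + t *\<^sub>R \<psi> t = t *\<^sub>R (l2_fun s B.e0 + l2_fun s (\<Psi> t))"
      by (simp add: v0_def \<psi>_def scaleR_add_right)
    then show ?thesis
      unfolding l2_fun_linear(1)[OF s e0(1) f] l2_fun_linear(3)[OF s fs fs] z_def .
  qed
  have zero: "flip 0 = (0 :: (int^'n) l2)" "coord (0 :: (int^'n) l2) 0 = 0"
    by (rule l2_eqI, simp_all)
  have zX: "(0 :: 'n torus_fun) \<in> X_space s" using l2_fun_X_space[OF s zero] by (simp add: l2_fun_0[OF s])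
  have z0: "fun_l2 s 0 = (0 :: (int^'n) l2)"
    using fun_l2_l2_fun[OF s zero] by (simp add: l2_fun_0[OF s])
  have solves0: "B.solves c 0" for c
    using zero bounded_bilinear.zero_left[OF B.bounded_bilinear_quad] by (simp add: B.solves_def)
  have Wopen: "open_in_R_X s W" unfolding W_def by (rule open_in_R_X_preimage[OF s U])
  have c0W: "(c0, 0) \<in> W" using trivial[of c0] \<epsilon> zX z0 by (simp add: W_def c0B)
  have zero_set: "{(c, v). v \<in> X_space s \<and> bif_map a \<Phi> c v = 0} \<inter> W
         = {(\<phi> t, t *\<^sub>R v0 + t *\<^sub>R \<psi> t) | t. \<bar>t\<bar> < \<epsilon>} \<union> {(c, 0) | c. \<bar>c - c0\<bar> < \<epsilon>}" (is "?L = ?R")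
  proof (intro equalityI subsetI)
    fix p assume "p \<in> ?L"
    then obtain c v where p: "p = (c, v)" "v \<in> X_space s" "bif_map a \<Phi> c v = 0" "(c, fun_l2 s v) \<in> U"
      by (auto simp: W_def)
    let ?x = "fun_l2 s v"
    have "B.solves c ?x"
      using solves_iff[OF flip_fun_l2[OF s p(2)] coord_fun_l2_0[OF s p(2)], of c] p(3) l2_fun_fun_l2[OF s p(2)] by simp
    from zeros[OF this p(4)] show "p \<in> ?R"
    proof
      assume "?x = 0 \<and> \<bar>c - B.c0\<bar> < \<epsilon>"
      moreover from this have "v = 0" using l2_fun_fun_l2[OF s p(2)] by (simp add: l2_fun_0[OF s])
      ultimately show ?thesis using p(1) c0B by auto
    next
      assume "\<exists>t. \<bar>t\<bar> < \<epsilon> \<and> c = \<phi> t \<and> ?x = t *\<^sub>R (B.e0 + \<Psi> t)"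
      then obtain t where t: "\<bar>t\<bar> < \<epsilon>" "c = \<phi> t" "?x = z t" by (auto simp: z_def)
      then have "v = t *\<^sub>R v0 + t *\<^sub>R \<psi> t" using l2_fun_fun_l2[OF s p(2)] vz[OF t(1)] by simp
      then show ?thesis using p(1) t by blast
    qed
  next
    fix p assume "p \<in> ?R"
    then show "p \<in> ?L"
    proof
      assume "p \<in> {(\<phi> t, t *\<^sub>R v0 + t *\<^sub>R \<psi> t) | t. \<bar>t\<bar> < \<epsilon>}"
      then obtain t where t: "\<bar>t\<bar> < \<epsilon>" "p = (\<phi> t, l2_fun s (z t))" using vz by auto
      then show ?thesis
        using branch[OF t(1)] l2_fun_X_space[OF s z[OF t(1)]] fun_l2_l2_fun[OF s z[OF t(1)]] solves_iff[OF z[OF t(1)], of "\<phi> t"]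
        by (simp add: W_def z_def)
    next
      assume "p \<in> {(c, 0) | c. \<bar>c - c0\<bar> < \<epsilon>}"
      then obtain c where c: "p = (c, 0)" "\<bar>c - c0\<bar> < \<epsilon>" by auto
      have "bif_map a \<Phi> c 0 = 0" using solves_iff[OF zero, of c] solves0[of c] l2_fun_0[OF s] by simp
      then show ?thesis using c zX z0 trivial[of c] c0B by (simp add: W_def)
    qed
  qed
  have \<phi>C1: "\<phi> C1_differentiable_on {-\<epsilon><..<\<epsilon>}"
    unfolding C1_differentiable_on_def using d\<phi> c\<phi>' by (intro exI[of _ \<phi>']) (auto simp: abs_less_iff)
  have I: "\<bar>t\<bar> < \<epsilon>" if "t \<in> {-\<epsilon><..<\<epsilon>}" for t using that by auto
  have \<psi>C1: "C1_curve (s + 2) (X_space s) {-\<epsilon><..<\<epsilon>} \<psi>"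
    unfolding C1_curve_def
  proof (intro exI[of _ "\<lambda>t. l2_fun s (\<Psi>' t)"] conjI ballI)
    fix t assume t: "t \<in> {-\<epsilon><..<\<epsilon>}"
    show "\<psi> t \<in> X_space s" unfolding \<psi>_def using \<Psi>[OF I[OF t]] by (intro l2_fun_X_space[OF s]) auto
    show "l2_fun s (\<Psi>' t) \<in> X_space s" using \<Psi>'[OF I[OF t]] by (intro l2_fun_X_space[OF s]) auto
    show "has_sobolev_derivative (s + 2) \<psi> (l2_fun s (\<Psi>' t)) {-\<epsilon><..<\<epsilon>} t"
      unfolding \<psi>_def[abs_def]
      using \<Psi> \<Psi>' I t by (intro has_sobolev_derivative_l2_fun[OF s d\<Psi>]) auto
    have "((\<lambda>\<tau>. norm (\<Psi>' \<tau> - \<Psi>' t)) \<longlongrightarrow> 0) (at t within {-\<epsilon><..<\<epsilon>})"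
      using c\<Psi>' t by (intro tendsto_norm_zero LIM_zero) (simp add: continuous_on_def)
    moreover have "\<forall>\<^sub>F \<tau> in at t within {-\<epsilon><..<\<epsilon>}. norm (\<Psi>' \<tau> - \<Psi>' t)
        = sobolev_norm (s + 2) (l2_fun s (\<Psi>' \<tau>) - l2_fun s (\<Psi>' t))"
      unfolding eventually_at_filter
    proof (intro always_eventually allI impI)
      fix \<tau> assume \<tau>: "\<tau> \<in> {-\<epsilon><..<\<epsilon>}"
      have f: "flip (\<Psi>' \<tau>) = \<Psi>' \<tau>" "flip (\<Psi>' t) = \<Psi>' t" using \<Psi>' I[OF \<tau>] I[OF t] by auto
      then have "flip (\<Psi>' \<tau> - \<Psi>' t) = \<Psi>' \<tau> - \<Psi>' t" by (simp add: B.flip_diff)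
      from l2_fun_sobolev(2)[OF s this]
      show "norm (\<Psi>' \<tau> - \<Psi>' t) = sobolev_norm (s + 2) (l2_fun s (\<Psi>' \<tau>) - l2_fun s (\<Psi>' t))"
        unfolding l2_fun_linear(2)[OF s f] by simp
    qed
    ultimately show "((\<lambda>\<tau>. sobolev_norm (s + 2) (l2_fun s (\<Psi>' \<tau>) - l2_fun s (\<Psi>' t))) \<longlongrightarrow> 0) (at t within {-\<epsilon><..<\<epsilon>})"
      by (rule Lim_transform_eventually)
  qed
  define u where "u t = of_real (\<phi> t) + t *\<^sub>R v0 + t *\<^sub>R \<psi> t" for t
  \<comment> \<open>\<open>d\<close> represents the constant 1. Constants lie outside
    \<open>X_space s\<close> but in the range of \<open>l2_fun\<close>, so the whole curve
    \<open>u\<close>, mean included, is differentiated by the lemma used for \<psi>.\<close>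
  obtain d :: "(int^'n) l2" where d: "\<And>k. coord d k = (if k = 0 then 1 else 0)"
    using l2_pair_exists[of "0 :: int^'n" 0] by auto
  have fd: "flip (c *\<^sub>R d) = c *\<^sub>R d" for c by (rule l2_eqI) (simp add: d)
  have const: "of_real c = l2_fun s (c *\<^sub>R d)" for c
  proof (rule l2_fun_eqI[OF s fd])
    have "wt (s + 2) (0 :: int^'n) = 1" by (simp add: wt_def)
    then show "fourier (of_real c :: 'n torus_fun) k = of_real (coord (c *\<^sub>R d) k / wt (s + 2) k)" for k
      by (simp add: fourier_of_real d)
  qed simp
  define y where "y t = \<phi> t *\<^sub>R d + z t" for t
  have fy: "flip (y t) = y t" if "\<bar>t\<bar> < \<epsilon>" for t
    using fd z(1)[OF that] by (simp add: y_def B.flip_add)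
  have uy: "u t = l2_fun s (y t)" if "\<bar>t\<bar> < \<epsilon>" for t
    unfolding u_def add.assoc vz[OF that] const y_def by (rule l2_fun_linear(1)[OF s fd z(1)[OF that]])
  define y' where "y' t = \<phi>' t *\<^sub>R d + (B.e0 + \<Psi> t + t *\<^sub>R \<Psi>' t)" for t
  have dy: "(y has_vector_derivative y' t) (at t)" if "\<bar>t\<bar> < \<epsilon>" for t
  proof -
    have "((\<lambda>t. \<phi> t *\<^sub>R d) has_vector_derivative \<phi>' t *\<^sub>R d) (at t)"
      by (rule bounded_linear.has_vector_derivative[OF bounded_linear_scaleR_left d\<phi>[OF that]])
    moreover have "(z has_vector_derivative (B.e0 + \<Psi> t + t *\<^sub>R \<Psi>' t)) (at t)"
    proof -
      have "((\<lambda>t. B.e0 + \<Psi> t) has_vector_derivative 0 + \<Psi>' t) (at t)"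
        by (rule has_vector_derivative_add[OF has_vector_derivative_const d\<Psi>[OF that]])
      from bounded_bilinear.has_vector_derivative[OF bounded_bilinear_scaleR has_vector_derivative_id this]
      show ?thesis unfolding z_def[abs_def] by (simp add: add.commute)
    qed
    ultimately show ?thesis unfolding y_def[abs_def] y'_def by (rule has_vector_derivative_add)
  qed
  have fy': "flip (y' t) = y' t" if "\<bar>t\<bar> < \<epsilon>" for t
    using fd e0 \<Psi>[OF that] \<Psi>'[OF that] by (simp add: y'_def B.flip_add B.flip_scaleR)
  have u_curve: "differentiable_curve (s + 2) (sobolev (s + 2)) {-\<epsilon><..<\<epsilon>} u"
    unfolding differentiable_curve_def
  proof (intro ballI conjI)
    fix t assume t: "t \<in> {-\<epsilon><..<\<epsilon>}"
    show "u t \<in> sobolev (s + 2)" unfolding uy[OF I[OF t]] by (rule l2_fun_sobolev(1)[OF s fy[OF I[OF t]]])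
    have "has_sobolev_derivative (s + 2) (\<lambda>\<tau>. l2_fun s (y \<tau>)) (l2_fun s (y' t)) {-\<epsilon><..<\<epsilon>} t"
      by (rule has_sobolev_derivative_l2_fun[OF s dy[OF I[OF t]] fy[OF I] fy'[OF I[OF t]] t])
    moreover have "\<forall>\<^sub>F \<tau> in at t within {-\<epsilon><..<\<epsilon>}.
        sobolev_norm (s + 2) ((l2_fun s (y \<tau>) - l2_fun s (y t)) /\<^sub>R (\<tau> - t) - l2_fun s (y' t))
        = sobolev_norm (s + 2) ((u \<tau> - u t) /\<^sub>R (\<tau> - t) - l2_fun s (y' t))"
      unfolding eventually_at_filter
      by (intro always_eventually allI impI) (simp only: uy[OF I] uy[OF I[OF t]])
    ultimately have "has_sobolev_derivative (s + 2) u (l2_fun s (y' t)) {-\<epsilon><..<\<epsilon>} t"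
      unfolding has_sobolev_derivative_def by (rule Lim_transform_eventually)
    then show "\<exists>g'\<in>sobolev (s + 2). has_sobolev_derivative (s + 2) u g' {-\<epsilon><..<\<epsilon>} t"
      using l2_fun_sobolev(1)[OF s fy'[OF I[OF t]]] by blast
  qed
  have sol: "is_solution a \<Phi> (u t) \<and> (\<forall>\<kappa>::real. u t \<noteq> of_real \<kappa>)" if t: "0 < \<bar>t\<bar> \<and> \<bar>t\<bar> < \<epsilon>" for t
  proof (intro conjI allI)
    have t': "\<bar>t\<bar> < \<epsilon>" using t by simp
    have ut: "u t = of_real (\<phi> t) + l2_fun s (z t)" unfolding u_def add.assoc vz[OF t'] ..
    have "bif_map a \<Phi> (\<phi> t) (l2_fun s (z t)) = 0"
      using solves_iff[OF z[OF t'], of "\<phi> t"] branch[OF t'] by (simp add: z_def)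
    then show "is_solution a \<Phi> (u t)"
      unfolding ut using is_solution_iff[OF \<Phi>1 wiener_l2_fun[OF s z(1)[OF t']]] by blast
    \<comment> \<open>A constant has no mode at \<open>k0 \<noteq> 0\<close>, while the weighted
      coordinate of \<open>u t\<close> there is \<open>t\<close>.\<close>
    fix \<kappa> :: real
    show "u t \<noteq> of_real \<kappa>"
    proof
      assume "u t = of_real \<kappa>"
      then have "fourier (l2_fun s (y t)) k0 = fourier (of_real \<kappa> :: 'n torus_fun) k0"
        using uy[OF t'] by simp
      then have "coord (y t) k0 = 0" using k0(1) by (simp add: fourier_of_real fourier_l2_fun[OF s fy[OF t']])
      moreover have "coord (y t) k0 = t" using \<Psi>[OF t'] k0(1) by (simp add: y_def z_def d B.coord_e0)
      ultimately show False using t by simp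
    qed
  qed
  have ex: "\<exists>\<delta>>0. \<delta> \<le> \<epsilon> \<and> (\<forall>t. 0 < \<bar>t\<bar> \<and> \<bar>t\<bar> < \<delta> \<longrightarrow>
      is_solution a \<Phi> (u t) \<and> (\<forall>\<kappa>::real. u t \<noteq> of_real \<kappa>))"
    using \<epsilon> sol by (intro exI[of _ \<epsilon>]) blast
  have "let u = (\<lambda>t. of_real (\<phi> t) + t *\<^sub>R v0 + t *\<^sub>R \<psi> t)
        in differentiable_curve (s + 2) (sobolev (s + 2)) {-\<epsilon><..<\<epsilon>} u \<and>
           (\<exists>\<delta>>0. \<delta> \<le> \<epsilon> \<and> (\<forall>t. 0 < \<bar>t\<bar> \<and> \<bar>t\<bar> < \<delta> \<longrightarrow>
              is_solution a \<Phi> (u t) \<and> (\<forall>\<kappa>::real. u t \<noteq> of_real \<kappa>)))"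
    using u_curve ex unfolding u_def[abs_def] Let_def by (rule conjI)
  then show ?thesis
    using X \<epsilon> Wopen c0W \<phi>C1 \<psi>C1 zero_set v0X by blast
qed

end
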